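(* For every $T\in\mathbb{N}$, every directed graph $G=(V,E)$ with $n$ vertices and $m$ edges, and every pair of vertices $s,t$, there is $\zeta_{G,s,t}\in\mathbb{N}$ such that $\zeta_{G,s,t}\le (n+1)^T$, and $\zeta_{G,s,t}\neq 0$ if and only if there is an $s\to t$ path in $G$ of length at most $T$. Moreover, there is a catalytic logspace algorithm that, given $\ell,q,T\in\mathbb{N}$, oracle access to $G$, vertices $s,t$, and $\ell$-bit registers $R_{\sigma,v}$ on the catalytic tape for $\sigma\in\{0,1\}$ and $v\in V$ that are all valid for modulus $q$, returns $\zeta_{G,s,t}\bmod q$, and runs in time $\widetilde{O}(\ell^2\cdot T\cdot(n+m))$.
   Context: Registers: for $q,\ell\in\mathbb{N}$, let $d$ be the largest integer with $qd\le 2^\ell$; an $\ell$-bit register (interpreted as an integer in $\{0,\dots,2^\ell-1\}$) is valid for modulus $q$ if its initial value is less than $qd$. Catalytic model: read-only input, $O(\log)$-size read-write work tape, a read-write catalytic tape (here containing the registers) starting in an arbitrary configuration that must be restored exactly at halting, with constant-time random access to catalytic bits. Oracle access to $G$: vertex set $[n]$, with in-degree, out-degree, $i$-th in-neighbor and $i$-th out-neighbor queries. $\widetilde{O}(\cdot)$ hides polylogarithmic factors. *)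

theory Defs
  imports Complex_Main "Graph_Theory.Pair_Digraph"
begin

section \<open>Registers on the catalytic tape\<close>

text \<open>
  The tape consists of bits.  The registers occupy an initial segment of it, in the order
  \<open>R(0,0), \<dots>, R(0,n-1), R(1,0), \<dots>, R(1,n-1)\<close>; each has \<open>l\<close> bits, least significant bit first.
\<close>

definition register :: "nat \<Rightarrow> nat \<Rightarrow> bool list \<Rightarrow> nat \<Rightarrow> nat \<Rightarrow> nat" where
  "register n l cat \<sigma> v = horner_sum of_bool 2 (take l (drop ((\<sigma> * n + v) * l) cat))"

text \<open>Meaningful for \<open>q > 0\<close> only: for \<open>q = 0\<close> there is no largest \<open>d\<close> with \<open>q * d \<le> 2 ^ l\<close>.\<close>

definition valid_for :: "nat \<Rightarrow> nat \<Rightarrow> nat \<Rightarrow> bool" where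
  "valid_for q l r \<longleftrightarrow> r < q * (GREATEST d. q * d \<le> 2 ^ l)"


section \<open>Oracle access to a graph\<close>

text \<open>
  The neighbours of each vertex are listed in an arbitrary order, without repetitions.
  Nothing is promised about numbers that are not vertices.
\<close>

record graph_oracle =
  in_nbrs :: "nat \<Rightarrow> nat list"
  out_nbrs :: "nat \<Rightarrow> nat list"

definition oracle_for :: "nat pair_pre_digraph \<Rightarrow> graph_oracle \<Rightarrow> bool" where
  "oracle_for G orc \<longleftrightarrow> (\<forall>v \<in> pverts G.
     distinct (in_nbrs orc v) \<and> set (in_nbrs orc v) = {u. (u, v) \<in> parcs G} \<and>
     distinct (out_nbrs orc v) \<and> set (out_nbrs orc v) = {w. (v, w) \<in> parcs G})"


section \<open>Catalytic machines\<close>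

datatype symbol = Start | Blank | is_Bit: Bit (bit_of: bool)

text \<open>
  A work tape has a fixed number of cells for the whole computation: \<open>length (cells tp)\<close>.  Cell 0
  initially holds \<open>Start\<close>.  The number written on a tape is read from cell 1 up to the first cell
  that is not a bit, least significant bit first.
\<close>

record tape =
  pos :: nat
  cells :: "symbol list"

definition scan :: "tape \<Rightarrow> symbol" where
  "scan tp = cells tp ! pos tp"

definition put :: "symbol \<Rightarrow> tape \<Rightarrow> tape" where
  "put x tp = tp\<lparr>cells := (cells tp)[pos tp := x]\<rparr>"

definition move_left :: "tape \<Rightarrow> tape" where
  "move_left tp = tp\<lparr>pos := pos tp - 1\<rparr>"

definition move_right :: "tape \<Rightarrow> tape option" where
  "move_right tp = (if pos tp + 1 < length (cells tp) then Some (tp\<lparr>pos := pos tp + 1\<rparr>) else None)"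

definition number :: "tape \<Rightarrow> nat" where
  "number tp = horner_sum of_bool 2 (map bit_of (takeWhile is_Bit (drop 1 (cells tp))))"

fun bin :: "nat \<Rightarrow> bool list" where
  "bin k = (if k = 0 then [] else odd k # bin (k div 2))"

text \<open>Replaces the contents of a tape by a number, if the tape has room for it.\<close>

definition store :: "nat \<Rightarrow> tape \<Rightarrow> tape option" where
  "store k tp =
     (let ds = map Bit (bin k); len = length (cells tp) in
      if length ds < len
      then Some \<lparr>pos = 0, cells = Start # ds @ replicate (len - 1 - length ds) Blank\<rparr>
      else None)"

text \<open>
  The finite control is a list of instructions; the index of the current instruction is the state.
  An argument of type \<open>nat\<close> is the index of a work tape, except that the last argument of
  \<open>Branch\<close> and \<open>BranchInput\<close>, and the argument of \<open>Jump\<close>, are instruction indices.  A program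
  mentions only finitely many work tapes.  Each instruction takes one step; apart from the answers
  written by graph queries, it changes at most one cell.
\<close>

datatype instr =
    MoveLeft nat
  | MoveRight nat
  | Write nat symbol
  | Branch nat symbol nat
  | Jump nat
  | InputLeft
  | InputRight
  | BranchInput symbol nat
  | CatRead nat nat
  | CatWrite nat nat
  | InDegree nat nat
  | OutDegree nat nat
  | InNeighbor nat nat nat
  | OutNeighbor nat nat nat

record config =
  pc :: nat
  input :: tape
  work :: "nat \<Rightarrow> tape"
  catalytic :: "bool list"

definition goto :: "nat \<Rightarrow> config \<Rightarrow> config" where
  "goto l c = c\<lparr>pc := l\<rparr>"

definition set_work :: "nat \<Rightarrow> tape \<Rightarrow> config \<Rightarrow> config" where
  "set_work i tp c = c\<lparr>pc := pc c + 1, work := (work c)(i := tp)\<rparr>"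

text \<open>
  \<open>None\<close> is a crash.  It results from running off the right end of a tape, addressing a
  nonexistent catalytic bit, asking for a nonexistent neighbour, or obtaining an answer that does
  not fit on its tape.  \<open>CatRead a b\<close> and \<open>CatWrite a b\<close> move one bit between the scanned cell of
  tape \<open>b\<close> and the catalytic bit whose address is written on tape \<open>a\<close>.
  \<open>InNeighbor a i b\<close> puts on tape \<open>b\<close> the in-neighbour, with the index written on
  tape \<open>i\<close> (from 0), of the vertex written on tape \<open>a\<close>; similarly for the other queries.
\<close>

fun exec :: "graph_oracle \<Rightarrow> instr \<Rightarrow> config \<Rightarrow> config option" where
  "exec orc (MoveLeft i) c = Some (set_work i (move_left (work c i)) c)"
| "exec orc (MoveRight i) c = map_option (\<lambda>tp. set_work i tp c) (move_right (work c i))"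
| "exec orc (Write i x) c = Some (set_work i (put x (work c i)) c)"
| "exec orc (Branch i x l) c = Some (goto (if scan (work c i) = x then l else pc c + 1) c)"
| "exec orc (Jump l) c = Some (goto l c)"
| "exec orc InputLeft c = Some (c\<lparr>pc := pc c + 1, input := move_left (input c)\<rparr>)"
| "exec orc InputRight c =
     map_option (\<lambda>tp. c\<lparr>pc := pc c + 1, input := tp\<rparr>) (move_right (input c))"
| "exec orc (BranchInput x l) c = Some (goto (if scan (input c) = x then l else pc c + 1) c)"
| "exec orc (CatRead a b) c =
     (let j = number (work c a) in
      if j < length (catalytic c)
      then Some (set_work b (put (Bit (catalytic c ! j)) (work c b)) c)
      else None)"
| "exec orc (CatWrite a b) c =
     (let j = number (work c a); x = scan (work c b) in
      if j < length (catalytic c) \<and> is_Bit x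
      then Some (c\<lparr>pc := pc c + 1, catalytic := (catalytic c)[j := bit_of x]\<rparr>)
      else None)"
| "exec orc (InDegree a b) c =
     map_option (\<lambda>tp. set_work b tp c)
       (store (length (in_nbrs orc (number (work c a)))) (work c b))"
| "exec orc (OutDegree a b) c =
     map_option (\<lambda>tp. set_work b tp c)
       (store (length (out_nbrs orc (number (work c a)))) (work c b))"
| "exec orc (InNeighbor a i b) c =
     (let ns = in_nbrs orc (number (work c a)); j = number (work c i) in
      if j < length ns then map_option (\<lambda>tp. set_work b tp c) (store (ns ! j) (work c b)) else None)"
| "exec orc (OutNeighbor a i b) c =
     (let ns = out_nbrs orc (number (work c a)); j = number (work c i) in
      if j < length ns then map_option (\<lambda>tp. set_work b tp c) (store (ns ! j) (work c b)) else None)"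

text \<open>A machine halts when it jumps or falls through to the index just after its last instruction.\<close>

definition step :: "graph_oracle \<Rightarrow> instr list \<Rightarrow> config \<Rightarrow> config option" where
  "step orc M c = (if pc c < length M then exec orc (M ! pc c) c else None)"

fun run :: "graph_oracle \<Rightarrow> instr list \<Rightarrow> nat \<Rightarrow> config \<Rightarrow> config option" where
  "run orc M 0 c = Some c"
| "run orc M (Suc k) c = Option.bind (step orc M c) (run orc M k)"

definition input_tape :: "nat list \<Rightarrow> tape" where
  "input_tape xs = \<lparr>pos = 0, cells = Start # concat (map (\<lambda>x. map Bit (bin x) @ [Blank]) xs)\<rparr>"

definition initial :: "nat \<Rightarrow> nat list \<Rightarrow> bool list \<Rightarrow> config" where
  "initial S xs cat =
     \<lparr>pc = 0, input = input_tape xs, work = (\<lambda>i. \<lparr>pos = 0, cells = Start # replicate S Blank\<rparr>),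
      catalytic = cat\<rparr>"

text \<open>
  On input \<open>xs\<close>, with work tapes of \<open>S\<close> cells (besides the cell holding \<open>Start\<close>) and initial
  catalytic tape \<open>cat\<close>, the machine halts after exactly \<open>k\<close> steps, with the catalytic tape
  restored and \<open>y\<close> written on work tape 0.
\<close>

definition catalytic_run ::
  "graph_oracle \<Rightarrow> instr list \<Rightarrow> nat \<Rightarrow> nat list \<Rightarrow> bool list \<Rightarrow> nat \<Rightarrow> nat \<Rightarrow> bool" where
  "catalytic_run orc M S xs cat k y \<longleftrightarrow>
     (\<exists>c. run orc M k (initial S xs cat) = Some c \<and> pc c = length M \<and>
          catalytic c = cat \<and> number (work c 0) = y)"

text \<open>
  \<open>O(log)\<close> work space, where numeric inputs are measured by value, so that a work tape has
  room for a constant number of them.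
\<close>

definition log_space :: "nat \<Rightarrow> nat \<Rightarrow> nat \<Rightarrow> nat \<Rightarrow> nat \<Rightarrow> nat" where
  "log_space a n l q T = nat \<lceil>real a * log 2 (real (n + l + q + T + 2))\<rceil>"

text \<open>
  A representative of the class of bounds hidden in the soft-O of \<open>l\<^sup>2 * T * (n + m)\<close>.
  The maxima only matter for \<open>l = 0\<close> or \<open>T = 0\<close>, where the product would be 0.
  The logarithmic factors do not involve \<open>q\<close>.
\<close>

definition soft_time_bound :: "nat \<Rightarrow> nat \<Rightarrow> nat \<Rightarrow> nat \<Rightarrow> nat \<Rightarrow> nat \<Rightarrow> real" where
  "soft_time_bound C e l T n m =
     real C * real ((max 1 l)\<^sup>2 * max 1 T * (n + m)) * log 2 (real (l + T + n + m + 2)) ^ e"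

end

theory Submission
  imports Defs
begin

text \<open>
  Let \<open>A\<close> be the adjacency matrix of the graph and let \<open>F(-1) = F(0)\<close> be the unit vector at \<open>s\<close>.  The
  steps \<open>R(\<sigma>, _) += A R(1 - \<sigma>, _)\<close>, for alternating \<open>\<sigma>\<close>, are invertible in place; applied to two
  layers that hold \<open>F(-1)\<close> and \<open>F(0)\<close>, they compute \<open>F(k + 1) = A F(k) + F(k - 1)\<close>.  The number
  \<open>\<zeta> = F(T)(t)\<close> is a linear combination, with positive coefficients, of the numbers of walks of
  length \<open>0, \<dots>, T\<close> from \<open>s\<close> to \<open>t\<close>, and the recurrence bounds it by \<open>(n + 1) ^ T\<close>.

  The registers start with arbitrary contents.  By linearity, \<open>\<zeta>\<close> is the difference of the
  results of two runs, one from the given contents and one after adding 1 to both registers of \<open>s\<close>.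
  Each run is undone before the next action, so that the tape is restored.  All register arithmetic is
  modulo the largest multiple \<open>N = q d\<close> of \<open>q\<close> up to \<open>2 ^ l\<close>; on valid registers the steps are
  invertible, and \<open>q\<close> divides \<open>N\<close>.

  A register can be much longer than a work tape, and a work tape can be as long as a register, namely
  if \<open>q\<close> is close to \<open>2 ^ l\<close>.  Every operation on work tapes takes time linear in their length, and every
  arc costs \<open>O(l)\<close> such operations; this is where the factor \<open>l\<^sup>2\<close> comes from.
\<close>

section \<open>Structured programs for catalytic machines\<close>

text \<open>With \<open>F(-1) = 0\<close> only walks whose length has the parity of T would be
  counted. Starting from \<open>F(-1) = F(0)\<close>, the term \<open>F(k - 1)\<close> also acts as
  waiting at s, so that every length up to T contributes; hence both registers of s are bumped. The
  modulus has to serve two purposes. Reducing registers modulo q would destroy their contents, and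
  working modulo \<open>2 ^ l\<close> would determine the difference of the two runs only modulo
  \<open>2 ^ l\<close>, which says nothing about its residue modulo q. A multiple N of q that
  exceeds all initial contents avoids both problems. The bump is \<open>1 mod q\<close> and not 1,
  since for q = 1 it may happen that N = 1, and then 1 is not a residue below N. One fixed program
  has to serve all inputs, so the word length W of the arithmetic cannot occur in the program. It is
  data instead: the number of marks on a tape.\<close>

lemma run_add: "run orc M (j + k) c = Option.bind (run orc M j c) (run orc M k)"
proof (induction j arbitrary: c)
  case (Suc j)
  then show ?case by (cases "step orc M c") auto
qed simp

datatype test = On_work nat symbol | On_input symbol

primrec passes :: "test \<Rightarrow> config \<Rightarrow> bool" where
  "passes (On_work i x) c \<longleftrightarrow> scan (work c i) = x"
| "passes (On_input x) c \<longleftrightarrow> scan (input c) = x"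

primrec branch :: "test \<Rightarrow> nat \<Rightarrow> instr" where
  "branch (On_work i x) p = Branch i x p"
| "branch (On_input x) p = BranchInput x p"

lemma exec_branch:
  "exec orc (branch b p') (c\<lparr>pc := p\<rparr>) = Some (c\<lparr>pc := (if passes b c then p' else p + 1)\<rparr>)"
  by (cases b) (auto simp: goto_def)

datatype com =
    Skip
  | Instr instr
  | Seq com com (infixr ";;" 60)
  | Conditional test com com
  | Loop test com

abbreviation "Cond i x \<equiv> Conditional (On_work i x)"
abbreviation "CondInput x \<equiv> Conditional (On_input x)"
abbreviation "Until i x \<equiv> Loop (On_work i x)"
abbreviation "UntilInput x \<equiv> Loop (On_input x)"

primrec len :: "com \<Rightarrow> nat" where
  "len Skip = 0"
| "len (Instr i) = 1"
| "len (A ;; B) = len A + len B"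
| "len (Conditional b A B) = len A + len B + 2"
| "len (Loop b A) = len A + 2"

text \<open>Jump targets are absolute, hence the start index \<open>p\<close>. A branch instruction
  jumps when its test passes, so the else-part follows it directly and ends with a jump over the
  then-part; the test of a loop is its exit condition.\<close>

primrec compile :: "nat \<Rightarrow> com \<Rightarrow> instr list" where
  "compile p Skip = []"
| "compile p (Instr i) = [i]"
| "compile p (A ;; B) = compile p A @ compile (p + len A) B"
| "compile p (Conditional b A B) =
     branch b (p + len B + 2) # compile (p + 1) B @
     Jump (p + len B + 2 + len A) # compile (p + len B + 2) A"
| "compile p (Loop b A) = branch b (p + len A + 2) # compile (p + 1) A @ [Jump p]"

lemma length_compile [simp]: "length (compile p A) = len A"
  by (induction A arbitrary: p) auto

text \<open>The code may stand between arbitrary \<open>pre\<close> and \<open>post\<close>, which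
  makes the notion compositional in spite of absolute jump targets. The program counters of
  \<open>c\<close> and \<open>c'\<close> are overwritten and thus irrelevant. The time
  \<open>t\<close> is only an upper bound, so that branches of different cost can share one
  statement.\<close>

definition runs :: "graph_oracle \<Rightarrow> com \<Rightarrow> config \<Rightarrow> nat \<Rightarrow> config \<Rightarrow> bool" where
  "runs orc A c t c' \<longleftrightarrow>
     (\<forall>pre post. \<exists>k\<le>t. run orc (pre @ compile (length pre) A @ post) k (c\<lparr>pc := length pre\<rparr>)
        = Some (c'\<lparr>pc := length pre + len A\<rparr>))"

lemma runsD:
  assumes "runs orc A c t c'" "M = pre @ compile p A @ post" "p = length pre" "p' = p + len A"
  shows "\<exists>k\<le>t. run orc M k (c\<lparr>pc := p\<rparr>) = Some (c'\<lparr>pc := p'\<rparr>)"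
  using assms unfolding runs_def by blast

lemma runs_mono: "runs orc A c t c' \<Longrightarrow> t \<le> t' \<Longrightarrow> runs orc A c t' c'"
  unfolding runs_def by (meson order_trans)

lemma runs_Skip [intro!]: "runs orc Skip c 0 c"
  by (simp add: runs_def)

lemma runs_Seq:
  assumes "runs orc A c s c'" "runs orc B c' t c''"
  shows "runs orc (A ;; B) c (s + t) c''"
  unfolding runs_def
proof (intro allI)
  fix pre post :: "instr list"
  let ?M = "pre @ compile (length pre) (A ;; B) @ post"
  have "\<exists>j\<le>s. run orc ?M j (c\<lparr>pc := length pre\<rparr>) = Some (c'\<lparr>pc := length pre + len A\<rparr>)"
    by (rule runsD[OF assms(1), where pre = pre and post = "compile (length pre + len A) B @ post"]) simp_all
  then obtain j where j: "j \<le> s" "run orc ?M j (c\<lparr>pc := length pre\<rparr>) = Some (c'\<lparr>pc := length pre + len A\<rparr>)"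
    by blast
  have "\<exists>k\<le>t. run orc ?M k (c'\<lparr>pc := length pre + len A\<rparr>) = Some (c''\<lparr>pc := length pre + len A + len B\<rparr>)"
    by (rule runsD[OF assms(2), where pre = "pre @ compile (length pre) A" and post = post]) simp_all
  then obtain k where k: "k \<le> t" "run orc ?M k (c'\<lparr>pc := length pre + len A\<rparr>)
      = Some (c''\<lparr>pc := length pre + len A + len B\<rparr>)"
    by blast
  have "run orc ?M (j + k) (c\<lparr>pc := length pre\<rparr>) = Some (c''\<lparr>pc := length pre + len (A ;; B)\<rparr>)"
    by (simp only: run_add j(2) k(2) bind.bind_lunit len.simps add.assoc)
  then show "\<exists>k\<le>s + t. run orc ?M k (c\<lparr>pc := length pre\<rparr>) = Some (c''\<lparr>pc := length pre + len (A ;; B)\<rparr>)"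
    using add_mono[OF j(1) k(1)] by blast
qed

primrec straight :: "instr \<Rightarrow> bool" where
  "straight (MoveLeft i) = True"
| "straight (MoveRight i) = True"
| "straight (Write i x) = True"
| "straight (Branch i x p) = False"
| "straight (Jump p) = False"
| "straight InputLeft = True"
| "straight InputRight = True"
| "straight (BranchInput x p) = False"
| "straight (CatRead a b) = True"
| "straight (CatWrite a b) = True"
| "straight (InDegree a b) = True"
| "straight (OutDegree a b) = True"
| "straight (InNeighbor a i b) = True"
| "straight (OutNeighbor a i b) = True"

lemma exec_straight:
  assumes "straight i" "exec orc i c = Some c'"
  shows "exec orc i (c\<lparr>pc := p\<rparr>) = Some (c'\<lparr>pc := p + 1\<rparr>)"
  using assms by (cases i) (auto simp: set_work_def Let_def split: if_splits)

lemma step_at: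
  "M = pre @ i # post \<Longrightarrow> p = length pre \<Longrightarrow> step orc M (c\<lparr>pc := p\<rparr>) = exec orc i (c\<lparr>pc := p\<rparr>)"
  by (simp add: step_def)

text \<open>\<open>runs\<close> ignores program counters, so \<open>c'\<close> has to match the
  result of \<open>exec\<close> only in the other fields; target states can be described by their
  tapes alone.\<close>

lemma runs_Instr:
  assumes "straight i" "exec orc i c = Some c1" 
    "input c1 = input c'" "work c1 = work c'" "catalytic c1 = catalytic c'"
  shows "runs orc (Instr i) c 1 c'"
proof -
  have eq: "c1\<lparr>pc := p\<rparr> = c'\<lparr>pc := p\<rparr>" for p
    using assms(3-5) by (cases c1; cases c') simp
  show ?thesis
    unfolding runs_def
    by (intro allI exI[of _ 1]) (simp add: step_def exec_straight[OF assms(1,2)] eq del: exec.simps)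
qed

lemma runs_Conditional:
  assumes A: "passes b c \<Longrightarrow> runs orc A c t c'" and B: "\<not> passes b c \<Longrightarrow> runs orc B c t c'"
  shows "runs orc (Conditional b A B) c (t + 2) c'"
  unfolding runs_def
proof (intro allI)
  fix pre post :: "instr list"
  let ?p = "length pre"
  let ?C = "Conditional b A B"
  let ?M = "pre @ compile ?p ?C @ post"
  have M: "?M = pre @ branch b (?p + len B + 2) # (compile (?p + 1) B @
     Jump (?p + len B + 2 + len A) # compile (?p + len B + 2) A @ post)"
    by simp
  have 1: "step orc ?M (c\<lparr>pc := ?p\<rparr>) = Some (c\<lparr>pc := (if passes b c then ?p + len B + 2 else ?p + 1)\<rparr>)"
    unfolding step_at[OF M refl] by (rule exec_branch)
  show "\<exists>k\<le>t + 2. run orc ?M k (c\<lparr>pc := ?p\<rparr>) = Some (c'\<lparr>pc := ?p + len ?C\<rparr>)"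
  proof (cases "passes b c")
    case True
    have "\<exists>k\<le>t. run orc ?M k (c\<lparr>pc := ?p + len B + 2\<rparr>) = Some (c'\<lparr>pc := ?p + len B + 2 + len A\<rparr>)"
      by (rule runsD[OF A[OF True], where pre = "pre @ branch b (?p + len B + 2) # (compile (?p + 1) B @
        [Jump (?p + len B + 2 + len A)])" and post = post]) simp_all
    then obtain k where k: "k \<le> t" "run orc ?M k (c\<lparr>pc := ?p + len B + 2\<rparr>) = Some (c'\<lparr>pc := ?p + len B + 2 + len A\<rparr>)"
      by blast
    have "run orc ?M (Suc k) (c\<lparr>pc := ?p\<rparr>) = Some (c'\<lparr>pc := ?p + len B + 2 + len A\<rparr>)"
      by (simp only: run.simps(2) 1 True if_True k(2) bind.bind_lunit)
    then show ?thesis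
      using k(1) by (intro exI[of _ "Suc k"]) (simp add: add_ac)
  next
    case False
    have "\<exists>k\<le>t. run orc ?M k (c\<lparr>pc := ?p + 1\<rparr>) = Some (c'\<lparr>pc := ?p + 1 + len B\<rparr>)"
      by (rule runsD[OF B[OF False], where pre = "pre @ [branch b (?p + len B + 2)]" and
        post = "Jump (?p + len B + 2 + len A) # compile (?p + len B + 2) A @ post"]) simp_all
    then obtain k where k: "k \<le> t" "run orc ?M k (c\<lparr>pc := ?p + 1\<rparr>) = Some (c'\<lparr>pc := ?p + 1 + len B\<rparr>)"
      by blast
    have M': "?M = (pre @ branch b (?p + len B + 2) # compile (?p + 1) B) @
      Jump (?p + len B + 2 + len A) # (compile (?p + len B + 2) A @ post)"
      by simp
    have 2: "run orc ?M 1 (c'\<lparr>pc := ?p + 1 + len B\<rparr>) = Some (c'\<lparr>pc := ?p + len ?C\<rparr>)"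
      using step_at[OF M', of "?p + 1 + len B" orc c'] by (simp add: goto_def add_ac)
    have 3: "step orc ?M (c\<lparr>pc := ?p\<rparr>) = Some (c\<lparr>pc := ?p + 1\<rparr>)"
      using 1 False by simp
    have "run orc ?M (Suc (k + 1)) (c\<lparr>pc := ?p\<rparr>) = Some (c'\<lparr>pc := ?p + len ?C\<rparr>)"
      by (simp only: run.simps(2) run_add 3 k(2) 2 bind.bind_lunit)
    then show ?thesis using k(1) by (intro exI[of _ "Suc (k + 1)"]) simp
  qed
qed

lemmas runs_Cond = runs_Conditional[of "On_work i x" for i x, simplified passes.simps]
lemmas runs_CondInput = runs_Conditional[of "On_input x" for x, simplified passes.simps]

lemma runs_Loop_exit:
  assumes "passes b c"
  shows "runs orc (Loop b A) c 1 c"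
  unfolding runs_def
proof (intro allI exI[of _ "1::nat"] conjI)
  fix pre post :: "instr list"
  let ?p = "length pre"
  have M: "pre @ compile ?p (Loop b A) @ post =
      pre @ branch b (?p + len A + 2) # (compile (?p + 1) A @ [Jump ?p] @ post)"
    by simp
  show "run orc (pre @ compile ?p (Loop b A) @ post) 1 (c\<lparr>pc := ?p\<rparr>) = Some (c\<lparr>pc := ?p + len (Loop b A)\<rparr>)"
    using step_at[OF M, of ?p orc c] assms by (simp add: exec_branch add_ac)
qed simp

lemma runs_Loop_step:
  assumes b: "\<not> passes b c" and A: "runs orc A c s c'" and L: "runs orc (Loop b A) c' t c''"
  shows "runs orc (Loop b A) c (s + 2 + t) c''"
  unfolding runs_def
proof (intro allI)
  fix pre post :: "instr list"
  let ?p = "length pre"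
  let ?C = "Loop b A"
  let ?M = "pre @ compile ?p ?C @ post"
  have M: "?M = pre @ branch b (?p + len A + 2) # (compile (?p + 1) A @ [Jump ?p] @ post)"
    by simp
  have 1: "step orc ?M (c\<lparr>pc := ?p\<rparr>) = Some (c\<lparr>pc := ?p + 1\<rparr>)"
    unfolding step_at[OF M refl] using b by (simp add: exec_branch)
  have "\<exists>j\<le>s. run orc ?M j (c\<lparr>pc := ?p + 1\<rparr>) = Some (c'\<lparr>pc := ?p + 1 + len A\<rparr>)"
    by (rule runsD[OF A, where pre = "pre @ [branch b (?p + len A + 2)]" and post = "Jump ?p # post"]) simp_all
  then obtain j where j: "j \<le> s" "run orc ?M j (c\<lparr>pc := ?p + 1\<rparr>) = Some (c'\<lparr>pc := ?p + 1 + len A\<rparr>)"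
    by blast
  have M': "?M = (pre @ branch b (?p + len A + 2) # compile (?p + 1) A) @ Jump ?p # post"
    by simp
  have 2: "run orc ?M 1 (c'\<lparr>pc := ?p + 1 + len A\<rparr>) = Some (c'\<lparr>pc := ?p\<rparr>)"
    using step_at[OF M', of "?p + 1 + len A" orc c'] by (simp add: goto_def)
  have "\<exists>k\<le>t. run orc ?M k (c'\<lparr>pc := ?p\<rparr>) = Some (c''\<lparr>pc := ?p + len ?C\<rparr>)"
    by (rule runsD[OF L, where pre = pre and post = post]) simp_all
  then obtain k where k: "k \<le> t" "run orc ?M k (c'\<lparr>pc := ?p\<rparr>) = Some (c''\<lparr>pc := ?p + len ?C\<rparr>)"
    by blast
  have "run orc ?M (Suc (j + (1 + k))) (c\<lparr>pc := ?p\<rparr>) = Some (c''\<lparr>pc := ?p + len ?C\<rparr>)"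
    by (simp only: run.simps(2) run_add 1 j 2 k bind.bind_lunit)
  then show "\<exists>k\<le>s + 2 + t. run orc ?M k (c\<lparr>pc := ?p\<rparr>) = Some (c''\<lparr>pc := ?p + len ?C\<rparr>)"
    using j(1) k(1) by (intro exI[of _ "Suc (j + (1 + k))"]) simp
qed

lemma runs_Loop_iterate:
  assumes "\<And>j. j < N \<Longrightarrow> \<not> passes b (\<sigma> j)" "\<And>j. j < N \<Longrightarrow> runs orc A (\<sigma> j) t (\<sigma> (Suc j))" "passes b (\<sigma> N)"
  shows "runs orc (Loop b A) (\<sigma> 0) (N * (t + 2) + 1) (\<sigma> N)"
proof -
  \<comment> \<open>Induction on the number j of iterations still to come keeps the final state
    fixed.\<close>
  have "runs orc (Loop b A) (\<sigma> (N - j)) (j * (t + 2) + 1) (\<sigma> N)" if "j \<le> N" for j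
    using that
  proof (induction j)
    case 0
    then show ?case using runs_Loop_exit[OF assms(3)] by simp
  next
    case (Suc j)
    then have "Suc (N - Suc j) = N - j" by simp
    then have "runs orc (Loop b A) (\<sigma> (N - Suc j)) (t + 2 + (j * (t + 2) + 1)) (\<sigma> N)"
      using assms(1)[of "N - Suc j"] assms(2)[of "N - Suc j"] Suc by (intro runs_Loop_step) auto
    then show ?case by (simp add: algebra_simps)
  qed
  from this[of N] show ?thesis by simp
qed

lemmas runs_Until_exit = runs_Loop_exit[of "On_work i x" for i x, simplified passes.simps]
lemmas runs_Until_step = runs_Loop_step[of "On_work i x" for i x, simplified passes.simps]
lemmas runs_Until_iterate = runs_Loop_iterate[where b = "On_work i x" for i x, simplified passes.simps]
lemmas runs_UntilInput_iterate = runs_Loop_iterate[where b = "On_input x" for x, simplified passes.simps]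

section \<open>Execution rules for single instructions\<close>

lemma runs_MoveLeft:
  "c' = c\<lparr>work := (work c)(i := move_left (work c i))\<rparr> \<Longrightarrow> runs orc (Instr (MoveLeft i)) c 1 c'"
  by (rule runs_Instr[where ?c1.0 = "set_work i (move_left (work c i)) c"]) (auto simp: set_work_def)

lemma runs_MoveRight:
  "move_right (work c i) = Some tp \<Longrightarrow> c' = c\<lparr>work := (work c)(i := tp)\<rparr> \<Longrightarrow>
   runs orc (Instr (MoveRight i)) c 1 c'"
  by (rule runs_Instr[where ?c1.0 = "set_work i tp c"]) (auto simp: set_work_def)

lemma runs_Write:
  "c' = c\<lparr>work := (work c)(i := put x (work c i))\<rparr> \<Longrightarrow> runs orc (Instr (Write i x)) c 1 c'"
  by (rule runs_Instr[where ?c1.0 = "set_work i (put x (work c i)) c"]) (auto simp: set_work_def)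

lemma runs_InputRight:
  "move_right (input c) = Some tp \<Longrightarrow> c' = c\<lparr>input := tp\<rparr> \<Longrightarrow>
   runs orc (Instr InputRight) c 1 c'"
  by (rule runs_Instr[where ?c1.0 = "c\<lparr>pc := pc c + 1, input := tp\<rparr>"]) auto

lemma runs_CatRead:
  "number (work c a) < length (catalytic c) \<Longrightarrow>
   c' = c\<lparr>work := (work c)(b := put (Bit (catalytic c ! number (work c a))) (work c b))\<rparr> \<Longrightarrow>
   runs orc (Instr (CatRead a b)) c 1 c'"
  by (rule runs_Instr[where ?c1.0 = "set_work b (put (Bit (catalytic c ! number (work c a))) (work c b)) c"]) (auto simp: set_work_def Let_def)

lemma runs_CatWrite:
  "number (work c a) < length (catalytic c) \<Longrightarrow> scan (work c b) = Bit z \<Longrightarrow>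
   c' = c\<lparr>catalytic := (catalytic c)[number (work c a) := z]\<rparr> \<Longrightarrow>
   runs orc (Instr (CatWrite a b)) c 1 c'"
  by (rule runs_Instr[where ?c1.0 = "c\<lparr>pc := pc c + 1, catalytic := (catalytic c)[number (work c a) := z]\<rparr>"]) (auto simp: set_work_def Let_def)

lemma runs_InDegree:
  "store (length (in_nbrs orc (number (work c a)))) (work c b) = Some tp \<Longrightarrow>
   c' = c\<lparr>work := (work c)(b := tp)\<rparr> \<Longrightarrow>
   runs orc (Instr (InDegree a b)) c 1 c'"
  by (rule runs_Instr[where ?c1.0 = "set_work b tp c"]) (auto simp: set_work_def Let_def)

lemma runs_InNeighbor:
  "number (work c i) < length (in_nbrs orc (number (work c a))) \<Longrightarrow>
   store (in_nbrs orc (number (work c a)) ! number (work c i)) (work c b) = Some tp \<Longrightarrow>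
   c' = c\<lparr>work := (work c)(b := tp)\<rparr> \<Longrightarrow>
   runs orc (Instr (InNeighbor a i b)) c 1 c'"
  by (rule runs_Instr[where ?c1.0 = "set_work b tp c"]) (auto simp: set_work_def Let_def)

section \<open>Arithmetic along a ruler\<close>

declare bin.simps [simp del]

lemma bin_0 [simp]: "bin 0 = []"
  by (simp add: bin.simps)

lemma bin_pos: "0 < k \<Longrightarrow> bin k = odd k # bin (k div 2)"
  by (subst bin.simps) simp

lemma nth_bin: "j < length (bin k) \<Longrightarrow> bin k ! j = bit k j"
proof (induction k arbitrary: j rule: less_induct)
  case (less k)
  then have "0 < k" by (cases k) auto
  then show ?case
    using less by (cases j) (auto simp: bin_pos bit_0 bit_Suc)
qed

lemma less_power_length_bin: "k < 2 ^ length (bin k)"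
proof (induction k rule: less_induct)
  case (less k)
  show ?case
  proof (cases "k = 0")
    case False
    then have "k div 2 < 2 ^ length (bin (k div 2))" using less by simp
    then have "k < 2 * 2 ^ length (bin (k div 2))" by linarith
    then show ?thesis using False by (simp add: bin_pos)
  qed simp
qed

lemma power_length_bin_le: "0 < k \<Longrightarrow> 2 ^ length (bin k) \<le> 2 * k"
proof (induction k rule: less_induct)
  case (less k)
  show ?case
  proof (cases "k = 1")
    case False
    then have "2 ^ length (bin (k div 2)) \<le> 2 * (k div 2)" using less by simp
    then show ?thesis using less.prems by (simp add: bin_pos)
  qed (simp add: bin_pos)
qed

lemma length_bin_le: "k < 2 ^ W \<Longrightarrow> length (bin k) \<le> W"
proof (cases "k = 0")
  case False
  assume "k < 2 ^ W"
  then have "(2::nat) ^ length (bin k) < 2 * 2 ^ W"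
    using power_length_bin_le[of k] False by linarith
  then have "(2::nat) ^ length (bin k) < 2 ^ Suc W" by simp
  then have "length (bin k) < Suc W" by (simp only: power_strict_increasing_iff[of "2::nat"] one_less_numeral_iff semiring_norm)
  then show ?thesis by simp
qed simp

definition bits :: "nat \<Rightarrow> nat \<Rightarrow> bool list" where
  "bits W k = map (bit k) [0..<W]"

lemma length_bits [simp]: "length (bits W k) = W"
  by (simp add: bits_def)

lemma nth_bits [simp]: "j < W \<Longrightarrow> bits W k ! j = bit k j"
  by (simp add: bits_def)

lemma horner_sum_bits: "k < 2 ^ W \<Longrightarrow> horner_sum of_bool 2 (bits W k) = k"
  by (simp add: bits_def horner_sum_bit_eq_take_bit take_bit_nat_eq_self)

lemma not_bit_large: "k < 2 ^ W \<Longrightarrow> W \<le> i \<Longrightarrow> \<not> bit k i" for k :: nat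
  by (metis bit_take_bit_iff leD take_bit_nat_eq_self)

lemma bin_padded: "k < 2 ^ W \<Longrightarrow> bin k @ replicate (W - length (bin k)) False = bits W k"
  using length_bin_le[of k W]
  by (intro nth_equalityI)
     (auto simp: bits_def nth_append nth_bin not_bit_large[OF less_power_length_bin])

text \<open>The schoolbook carry into position j, for carry-in b. Stated arithmetically instead of
  recursively, it turns at position W directly into the overflow of the sum.\<close>

definition carry :: "nat \<Rightarrow> nat \<Rightarrow> bool \<Rightarrow> nat \<Rightarrow> bool" where
  "carry x y b j \<longleftrightarrow> 2 ^ j \<le> x mod 2 ^ j + y mod 2 ^ j + of_bool b"

lemma carry_0 [simp]: "carry x y b 0 = b"
  by (simp add: carry_def)

lemma mod_power_Suc: "x mod 2 ^ Suc j = x mod 2 ^ j + of_bool (bit x j) * 2 ^ j" for x :: nat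
  using take_bit_Suc_from_most[of j x] by (simp add: take_bit_eq_mod ac_simps)

lemma carry_Suc: "carry x y b (Suc j) \<longleftrightarrow>
    bit x j \<and> bit y j \<or> bit x j \<and> carry x y b j \<or> bit y j \<and> carry x y b j"
proof -
  have "2 * P \<le> u + of_bool A * P + (v + of_bool B * P) + of_bool b \<longleftrightarrow>
      A \<and> B \<or> A \<and> P \<le> u + v + of_bool b \<or> B \<and> P \<le> u + v + of_bool b"
    if "u < P" "v < P" for u v P :: nat and A B
    using that by (cases A; cases B; cases b) auto
  from this[of "x mod 2 ^ j" "2 ^ j" "y mod 2 ^ j" "bit x j" "bit y j"] show ?thesis
    unfolding carry_def mod_power_Suc by simp
qed

text \<open>If both summands are split at position j, the low parts contribute exactly the carry to
  the quotient by \<open>2 ^ j\<close>; digit j is therefore the parity of three bits.\<close>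

lemma bit_add_carry: "bit (x + y + of_bool b) j \<longleftrightarrow> (bit x j \<noteq> (bit y j \<noteq> carry x y b j))"
proof -
  have lt: "x mod 2 ^ j < 2 ^ j" "y mod 2 ^ j < 2 ^ j" by simp_all
  define s where "s = x mod 2 ^ j + y mod 2 ^ j + of_bool b"
  have x: "x = 2 ^ j * (x div 2 ^ j) + x mod 2 ^ j" and y: "y = 2 ^ j * (y div 2 ^ j) + y mod 2 ^ j" by simp_all
  have "x + y + of_bool b = 2 ^ j * (x div 2 ^ j + y div 2 ^ j) + s"
    unfolding s_def by (subst x, subst y) (simp only: distrib_left add_ac)
  then have "(x + y + of_bool b) div 2 ^ j = x div 2 ^ j + y div 2 ^ j + s div 2 ^ j"
    by simp
  moreover have "s div 2 ^ j = of_bool (carry x y b j)"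
  proof (cases "2 ^ j \<le> s")
    case True
    moreover have "u + v + of_bool b < P * 2" if "u < P" "v < P" for u v P :: nat
      using that by (cases b) auto
    with lt have "s < 2 ^ j * 2" unfolding s_def by blast
    ultimately have "s div 2 ^ j = 1"
      by (intro div_nat_eqI) auto
    then show ?thesis using True by (simp add: carry_def s_def)
  qed (simp add: carry_def s_def)
  ultimately show ?thesis
    by (auto simp: bit_iff_odd)
qed

lemma carry_whole: "x < 2 ^ W \<Longrightarrow> y < 2 ^ W \<Longrightarrow> carry x y b W \<longleftrightarrow> 2 ^ W \<le> x + y + of_bool b"
  by (simp add: carry_def)

text \<open>All digits of \<open>2 ^ W - 1\<close> below position W are 1, so the subtraction never
  borrows.\<close>

lemma bit_complement: "x < 2 ^ W \<Longrightarrow> bit (2 ^ W - 1 - x) j \<longleftrightarrow> j < W \<and> \<not> bit x j" for x :: nat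
proof (induction W arbitrary: x j)
  case (Suc W)
  have h: "(2 * P - 1 - x) div 2 = P - 1 - x div 2" "odd (2 * P - 1 - x) \<longleftrightarrow> even x" if "x < 2 * P" for P
  proof -
    define k where "k = x div 2"
    consider "x = 2 * k" | "x = Suc (2 * k)" unfolding k_def by (cases "even x") auto
    then have "(2 * P - 1 - x) div 2 = P - 1 - k \<and> (odd (2 * P - 1 - x) \<longleftrightarrow> even x)"
    proof cases
      case 1
      then have "2 * P - 1 - x = Suc (2 * (P - 1 - k))" using that by arith
      then show ?thesis by (simp add: 1)
    next
      case 2
      then have "2 * P - 1 - x = 2 * (P - 1 - k)" using that by arith
      then show ?thesis by (simp add: 2)
    qed
    then show "(2 * P - 1 - x) div 2 = P - 1 - x div 2" "odd (2 * P - 1 - x) \<longleftrightarrow> even x"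
      unfolding k_def by blast+
  qed
  have d: "x div 2 < 2 ^ W" using Suc.prems by (simp add: less_mult_imp_div_less mult.commute)
  have p: "x < 2 * 2 ^ W" using Suc.prems by simp
  show ?case
    unfolding power_Suc using Suc.IH[OF d] h[OF p]
    by (cases j) (simp_all add: bit_0 bit_Suc)
qed simp

text \<open>Contents of a tape in the middle of a sweep: new digits below position j, old ones from
  there on.\<close>

definition mix :: "nat \<Rightarrow> nat \<Rightarrow> (nat \<Rightarrow> bool) \<Rightarrow> (nat \<Rightarrow> bool) \<Rightarrow> bool list" where
  "mix W j f g = map (\<lambda>i. if i < j then f i else g i) [0..<W]"

lemma length_mix [simp]: "length (mix W j f g) = W"
  by (simp add: mix_def)

lemma nth_mix [simp]: "i < W \<Longrightarrow> mix W j f g ! i = (if i < j then f i else g i)"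
  by (simp add: mix_def)

lemma mix_0: "mix W 0 f g = map g [0..<W]"
  by (simp add: mix_def)

lemma mix_all: "mix W W f g = map f [0..<W]"
  by (simp add: mix_def)

lemma mix_extend: "b = f j \<Longrightarrow> (mix W j f g)[j := b] = mix W (Suc j) f g"
  by (rule nth_equalityI) (auto simp: nth_list_update less_Suc_eq)

lemma mix_retract: "b = g j \<Longrightarrow> (mix W (Suc j) f g)[j := b] = mix W j f g"
  by (rule nth_equalityI) (auto simp: nth_list_update less_Suc_eq)

section \<open>Tapes holding numbers or flags, and parallel sweeps over them\<close>

definition ptape :: "nat \<Rightarrow> bool list \<Rightarrow> nat \<Rightarrow> tape" where
  "ptape S bs p = \<lparr>pos = p, cells = Start # map Bit bs @ replicate (S - length bs) Blank\<rparr>"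

text \<open>The flag replaces \<open>Start\<close> under a head that never moves, so one branch
  instruction tests it.\<close>

definition ftape :: "nat \<Rightarrow> bool \<Rightarrow> tape" where
  "ftape S b = \<lparr>pos = 0, cells = Bit b # replicate S Blank\<rparr>"

lemma scan_ptape_0 [simp]: "scan (ptape S bs 0) = Start"
  by (simp add: scan_def ptape_def)

lemma scan_ptape_Suc:
  "p < S \<Longrightarrow> length bs \<le> S \<Longrightarrow> scan (ptape S bs (Suc p)) = (if p < length bs then Bit (bs ! p) else Blank)"
  by (simp add: scan_def ptape_def nth_append)

lemma put_ptape: "p < length bs \<Longrightarrow> put (Bit b) (ptape S bs (Suc p)) = ptape S (bs[p := b]) (Suc p)"
  by (simp add: put_def ptape_def list_update_append map_update)

lemma put_ptape_end:
  "length bs < S \<Longrightarrow> put (Bit b) (ptape S bs (Suc (length bs))) = ptape S (bs @ [b]) (Suc (length bs))"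
  by (cases "S - length bs") (auto simp add: put_def ptape_def list_update_append Suc_diff_Suc[symmetric])

lemma move_left_ptape: "move_left (ptape S bs p) = ptape S bs (p - 1)"
  by (simp add: move_left_def ptape_def)

lemma move_right_ptape: "p < S \<Longrightarrow> length bs \<le> S \<Longrightarrow> move_right (ptape S bs p) = Some (ptape S bs (Suc p))"
  by (simp add: move_right_def ptape_def)

lemma number_ptape: "number (ptape S bs p) = horner_sum of_bool 2 bs"
proof -
  have "takeWhile is_Bit (replicate k Blank) = []" for k by (cases k) auto
  then have "takeWhile is_Bit (map Bit bs @ replicate k Blank) = map Bit bs" for k
    by (induction bs) auto
  then show ?thesis by (simp add: number_def ptape_def comp_def)
qed

lemma store_ptape:
  "length bs \<le> S \<Longrightarrow> length (bin k) \<le> S \<Longrightarrow> store k (ptape S bs p) = Some (ptape S (bin k) 0)"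
  by (simp add: store_def ptape_def Let_def)

lemma scan_ftape [simp]: "scan (ftape S b) = Bit b"
  by (simp add: scan_def ftape_def)

lemma put_ftape [simp]: "put (Bit b) (ftape S b') = ftape S b"
  by (simp add: put_def ftape_def)

text \<open>
  Tape 32 carries a ruler: \<open>W\<close> marks.  All arithmetic is done by moving the ruler and two
  further tapes in parallel over these cells, once to the right and once back; tape 33 stays
  empty and stands in for the second operand of unary operations.
\<close>

abbreviation "ruler \<equiv> 32 :: nat"
abbreviation "dummy \<equiv> 33 :: nat"

definition advance :: "nat \<Rightarrow> nat \<Rightarrow> com" where
  "advance x y = Instr (MoveRight ruler) ;; Instr (MoveRight x) ;; Instr (MoveRight y)"

definition retreat :: "nat \<Rightarrow> nat \<Rightarrow> com" where
  "retreat x y = Instr (MoveLeft ruler) ;; Instr (MoveLeft x) ;; Instr (MoveLeft y)"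

text \<open>\<open>F\<close> acts on each position from the least significant one upwards,
  \<open>B\<close> on the way back. Carries travel upwards and use \<open>F\<close>; a right shift
  needs the next higher digit and uses \<open>B\<close>.\<close>

definition sweep :: "nat \<Rightarrow> nat \<Rightarrow> com \<Rightarrow> com \<Rightarrow> com" where
  "sweep x y F B = advance x y ;; Until ruler Blank (F ;; advance x y) ;;
     retreat x y ;; Until ruler Start (B ;; retreat x y)"

definition aligned :: "nat \<Rightarrow> nat \<Rightarrow> nat \<Rightarrow> nat \<Rightarrow> config \<Rightarrow> nat \<Rightarrow> bool list \<Rightarrow> bool list \<Rightarrow> config" where
  "aligned S W x y c p xs ys = c\<lparr>work := (work c)(ruler := ptape S (replicate W True) p,
     x := ptape S xs p, y := ptape S ys p)\<rparr>"

lemma runs_advance: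
  assumes "distinct [ruler, x, y]" "W \<le> S" "length xs \<le> S" "length ys \<le> S" "p < S"
  shows "runs orc (advance x y) (aligned S W x y c p xs ys) 3 (aligned S W x y c (Suc p) xs ys)"
proof -
  have "runs orc (advance x y) (aligned S W x y c p xs ys) (1 + (1 + 1)) (aligned S W x y c (Suc p) xs ys)"
    unfolding advance_def
    by (intro runs_Seq runs_MoveRight)
       (use assms in \<open>auto simp: aligned_def move_right_ptape fun_upd_twist\<close>)
  then show ?thesis by (simp add: numeral_3_eq_3)
qed

lemma runs_retreat:
  assumes "distinct [ruler, x, y]"
  shows "runs orc (retreat x y) (aligned S W x y c (Suc p) xs ys) 3 (aligned S W x y c p xs ys)"
proof -
  have "runs orc (retreat x y) (aligned S W x y c (Suc p) xs ys) (1 + (1 + 1)) (aligned S W x y c p xs ys)"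
    unfolding retreat_def
    by (intro runs_Seq runs_MoveLeft)
       (use assms in \<open>auto simp: aligned_def move_left_ptape fun_upd_twist\<close>)
  then show ?thesis by (simp add: numeral_3_eq_3)
qed

lemma scan_aligned_ruler:
  assumes "distinct [ruler, x, y]" "W < S" "p \<le> Suc W"
  shows "scan (work (aligned S W x y c p xs ys) ruler) =
    (if p = 0 then Start else if p \<le> W then Bit True else Blank)"
  using assms by (cases p) (auto simp: aligned_def scan_ptape_Suc)

lemma runs_sweep:
  assumes d: "distinct [ruler, x, y]" and "W < S"
    and xs: "\<And>j. length (xs j) \<le> S" "\<And>j. length (xs' j) \<le> S" and ys: "length ys \<le> S"
    and F: "\<And>j. j < W \<Longrightarrow> runs orc F (aligned S W x y (c j) (Suc j) (xs j) ys) s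
              (aligned S W x y (c (Suc j)) (Suc j) (xs (Suc j)) ys)"
    and B: "\<And>j. j < W \<Longrightarrow> runs orc B (aligned S W x y (c' (Suc j)) (Suc j) (xs' (Suc j)) ys) t
              (aligned S W x y (c' j) (Suc j) (xs' j) ys)"
    and mid: "c' W = c W" "xs' W = xs W"
  shows "runs orc (sweep x y F B) (aligned S W x y (c 0) 0 (xs 0) ys) ((W + 1) * (s + t + 18))
    (aligned S W x y (c' 0) 0 (xs' 0) ys)"
proof -
  have 1: "runs orc (advance x y) (aligned S W x y (c 0) 0 (xs 0) ys) 3 (aligned S W x y (c 0) (Suc 0) (xs 0) ys)"
    using assms by (intro runs_advance) auto
  have 2: "runs orc (Until ruler Blank (F ;; advance x y)) (aligned S W x y (c 0) (Suc 0) (xs 0) ys)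
     (W * (s + 3 + 2) + 1) (aligned S W x y (c W) (Suc W) (xs W) ys)"
    by (rule runs_Until_iterate[where \<sigma> = "\<lambda>j. aligned S W x y (c j) (Suc j) (xs j) ys"], goal_cases)
       (use assms in \<open>auto simp: scan_aligned_ruler intro!: runs_Seq[OF F] runs_advance\<close>)
  have 3: "runs orc (retreat x y) (aligned S W x y (c W) (Suc W) (xs W) ys) 3 (aligned S W x y (c W) W (xs W) ys)"
    using d by (rule runs_retreat)
  \<comment> \<open>The iteration rule counts upwards while the heads return, hence positions
    \<open>W - j\<close>.\<close>
  have "runs orc (Until ruler Start (B ;; retreat x y)) (aligned S W x y (c' (W - 0)) (W - 0) (xs' (W - 0)) ys)
     (W * (t + 3 + 2) + 1) (aligned S W x y (c' (W - W)) (W - W) (xs' (W - W)) ys)"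
  proof (rule runs_Until_iterate[where \<sigma> = "\<lambda>j. aligned S W x y (c' (W - j)) (W - j) (xs' (W - j)) ys"], goal_cases)
    case (2 j)
    then obtain i where i: "W - j = Suc i" "W - Suc j = i" "i < W" by (cases "W - j") auto
    show ?case unfolding i(1,2) using d i(3) by (intro runs_Seq[OF B] runs_retreat)
  qed (use assms in \<open>auto simp: scan_aligned_ruler\<close>)
  then have 4: "runs orc (Until ruler Start (B ;; retreat x y)) (aligned S W x y (c W) W (xs W) ys)
     (W * (t + 3 + 2) + 1) (aligned S W x y (c' 0) 0 (xs' 0) ys)"
    by (simp add: mid)
  \<comment> \<open>The two loops take \<open>W * (s + 5) + 1\<close> and
    \<open>W * (t + 5) + 1\<close> steps, the two moves outside them 3 each; 18 is the overhead 10
    per cell plus the constant 8.\<close>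
  show ?thesis
    unfolding sweep_def
    by (rule runs_mono[OF runs_Seq[OF 1 runs_Seq[OF 2 runs_Seq[OF 3 4]]]]) (simp add: algebra_simps)
qed

definition half_flip :: "nat \<Rightarrow> nat \<Rightarrow> com" where
  "half_flip x z = Cond x (Bit True) (Instr (Write x (Bit False)) ;; Instr (Write z (Bit True)))
     (Instr (Write x (Bit True)) ;; Instr (Write z (Bit False)))"

text \<open>
  Adds bit \<open>y\<close> and carry \<open>z\<close> to bit \<open>x\<close>.  If \<open>y = z\<close>, nothing changes; otherwise
  \<open>x\<close> is inverted and its old value is the new carry.
\<close>

definition full_adder :: "nat \<Rightarrow> nat \<Rightarrow> nat \<Rightarrow> com" where
  "full_adder x y z = Cond y (Bit True) (Cond z (Bit True) Skip (half_flip x z))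
     (Cond z (Bit True) (half_flip x z) Skip)"

lemma put_scan: "scan tp = x \<Longrightarrow> put x tp = tp"
  by (auto simp: scan_def put_def)

lemma runs_half_flip:
  assumes "scan (work c x) = Bit a" "x \<noteq> z"
  shows "runs orc (half_flip x z) c 4 (c\<lparr>work := (work c)(x := put (Bit (\<not> a)) (work c x),
     z := put (Bit a) (work c z))\<rparr>)"
proof -
  have "runs orc (half_flip x z) c ((1 + 1) + 2) (c\<lparr>work := (work c)(x := put (Bit (\<not> a)) (work c x),
     z := put (Bit a) (work c z))\<rparr>)"
    unfolding half_flip_def
    by (rule runs_Cond; rule runs_Seq[OF runs_Write[OF refl] runs_Write]) (use assms in simp_all)
  then show ?thesis by (rule runs_mono) simp
qed

lemma runs_full_adder:
  assumes "scan (work c x) = Bit a" "scan (work c y) = Bit b" "scan (work c z) = Bit d" "x \<noteq> z"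
  shows "runs orc (full_adder x y z) c 8 (c\<lparr>work := (work c)(
     x := put (Bit (a \<noteq> (b \<noteq> d))) (work c x),
     z := put (Bit (a \<and> b \<or> a \<and> d \<or> b \<and> d)) (work c z))\<rparr>)"
proof -
  let ?c = "c\<lparr>work := (work c)(x := put (Bit (a \<noteq> (b \<noteq> d))) (work c x),
     z := put (Bit (a \<and> b \<or> a \<and> d \<or> b \<and> d)) (work c z))\<rparr>"
  have skip: "runs orc Skip c 4 ?c" if "b = d"
  proof -
    have "(a \<and> b \<or> a \<and> d \<or> b \<and> d) = d" using that by auto
    then have "?c = c" using that assms by (simp add: put_scan)
    then show ?thesis using runs_mono[OF runs_Skip] by simp
  qed
  have flip: "runs orc (half_flip x z) c 4 ?c" if "b \<noteq> d"
  proof -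
    have "(a \<and> b \<or> a \<and> d \<or> b \<and> d) = a" "(a \<noteq> (b \<noteq> d)) = (\<not> a)" using that by auto
    then show ?thesis using runs_half_flip[OF assms(1,4), of orc] by simp
  qed
  have "runs orc (full_adder x y z) c (4 + 2 + 2) ?c"
    unfolding full_adder_def
    by (rule runs_Cond; rule runs_Cond; (rule skip | rule flip)) (use assms(2,3) in simp_all)
  then show ?thesis by simp
qed

section \<open>Abstract states\<close>

record astate =
  nv :: "nat \<Rightarrow> nat"
  fl :: "nat \<Rightarrow> bool"
  ct :: "bool list"
  clk :: nat

text \<open>
  Tapes 0 to 31 hold numbers of exactly \<open>W\<close> bits (leading zeros included), tapes 34 to 39 hold flags
  in cell 0.  The field \<open>clk\<close> counts time in units of \<open>tick\<close> machine steps; it is a ghost, which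
  \<open>conc\<close> ignores.
\<close>

locale machine =
  fixes orc :: graph_oracle and S W :: nat and inp :: tape
  assumes WS: "W < S"
begin

definition conc :: "astate \<Rightarrow> config" where
  "conc a = \<lparr>pc = 0, input = inp,
     work = (\<lambda>i. if i < 32 then ptape S (bits W (nv a i)) 0
                 else if i = ruler then ptape S (replicate W True) 0
                 else if i = dummy then ptape S [] 0
                 else if i < 40 then ftape S (fl a i)
                 else ptape S [] 0),
     catalytic = ct a\<rparr>"

text \<open>Each primitive operation makes at most one sweep and takes at most
  \<open>26 * (W + 1)\<close> steps. Charging a whole tick even for a single instruction reduces the
  time analysis to counting operations.\<close>

definition tick :: nat where
  "tick = 50 * (W + 1)"

text \<open>Total correctness in the style of weakest preconditions. Since the clock is a field of
  the state, a time bound is an ordinary part of \<open>Q\<close>.\<close>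

definition wp :: "com \<Rightarrow> (astate \<Rightarrow> bool) \<Rightarrow> astate \<Rightarrow> bool" where
  "wp A Q a \<longleftrightarrow> (\<exists>a'. clk a \<le> clk a' \<and>
     runs orc A (conc a) ((clk a' - clk a) * tick) (conc a') \<and> Q a')"

lemma conc_clk [simp]: "conc (a\<lparr>clk := k\<rparr>) = conc a"
  by (simp add: conc_def cong: if_cong)

lemma conc_cong: "nv a = nv b \<Longrightarrow> fl a = fl b \<Longrightarrow> ct a = ct b \<Longrightarrow> conc a = conc b"
  by (simp add: conc_def cong: if_cong)

lemma tick_ge: "50 \<le> tick"
  by (simp add: tick_def)

lemma wp_mono: "wp A P a \<Longrightarrow> (\<And>a'. P a' \<Longrightarrow> Q a') \<Longrightarrow> wp A Q a"
  unfolding wp_def by blast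

lemma wp_Skip: "Q a \<Longrightarrow> wp Skip Q a"
  unfolding wp_def by auto

lemma wp_Seq: "wp A (wp B Q) a \<Longrightarrow> wp (A ;; B) Q a"
proof -
  assume "wp A (wp B Q) a"
  then obtain b c where b: "clk a \<le> clk b" "runs orc A (conc a) ((clk b - clk a) * tick) (conc b)"
    and c: "clk b \<le> clk c" "runs orc B (conc b) ((clk c - clk b) * tick) (conc c)" "Q c"
    unfolding wp_def by blast
  have "(clk b - clk a) * tick + (clk c - clk b) * tick = (clk c - clk a) * tick"
    using b(1) c(1) by (simp flip: add_mult_distrib)
  then have "runs orc (A ;; B) (conc a) ((clk c - clk a) * tick) (conc c)"
    using runs_Seq[OF b(2) c(2)] by simp
  then show ?thesis using b(1) c(1,3) unfolding wp_def by (meson order_trans)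
qed

lemma wp_prim:
  assumes "runs orc A (conc a) t (conc a')" "t \<le> tick" "clk a' = clk a + 1" "Q a'"
  shows "wp A Q a"
  unfolding wp_def using assms by (intro exI[of _ a']) (auto intro: runs_mono)

lemma scan_flag: "34 \<le> f \<Longrightarrow> f < 40 \<Longrightarrow> scan (work (conc a) f) = Bit (fl a f)"
  by (simp add: conc_def)

text \<open>One unit of the clock pays for the branch and the jump around a conditional
  part.\<close>

lemma wp_delay:
  assumes "wp A Q (a\<lparr>clk := clk a + 1\<rparr>)"
    and "\<And>s c. runs orc A (conc a) s c \<Longrightarrow> runs orc B (conc a) (s + 2) c"
  shows "wp B Q a"
proof -
  obtain b where b: "clk a + 1 \<le> clk b" "runs orc A (conc a) ((clk b - (clk a + 1)) * tick) (conc b)" "Q b"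
    using assms(1) unfolding wp_def by auto
  obtain d where "clk b = clk a + 1 + d"
    using b(1) le_Suc_ex by blast
  then have "(clk b - (clk a + 1)) * tick + 2 \<le> (clk b - clk a) * tick"
    using tick_ge by simp
  then show ?thesis
    using b runs_mono[OF assms(2)[OF b(2)]] unfolding wp_def by (intro exI[of _ b]) simp
qed

abbreviation If_flag :: "nat \<Rightarrow> com \<Rightarrow> com \<Rightarrow> com" where
  "If_flag f A B \<equiv> Cond f (Bit True) A B"

abbreviation While_flag :: "nat \<Rightarrow> com \<Rightarrow> com" where
  "While_flag f A \<equiv> Until f (Bit False) A"

lemma wp_If_flag:
  assumes "34 \<le> f" "f < 40" "fl a f \<Longrightarrow> wp A Q (a\<lparr>clk := clk a + 1\<rparr>)" "\<not> fl a f \<Longrightarrow> wp B Q (a\<lparr>clk := clk a + 1\<rparr>)"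
  shows "wp (If_flag f A B) Q a"
proof (cases "fl a f")
  case True
  show ?thesis
    by (rule wp_delay[OF assms(3)[OF True]], rule runs_Cond)
       (use True assms in \<open>auto simp: scan_flag\<close>)
next
  case False
  show ?thesis
    by (rule wp_delay[OF assms(4)[OF False]], rule runs_Cond)
       (use False assms in \<open>auto simp: scan_flag\<close>)
qed

lemma wp_While_flag_exit:
  assumes "34 \<le> f" "f < 40" "\<not> fl a f" "Q (a\<lparr>clk := clk a + 1\<rparr>)"
  shows "wp (While_flag f A) Q a"
  by (rule wp_prim[where t = 1 and a' = "a\<lparr>clk := clk a + 1\<rparr>"])
     (use assms tick_ge in \<open>auto intro!: runs_Until_exit[unfolded One_nat_def] simp: scan_flag\<close>)

lemma wp_While_flag_step:
  assumes "34 \<le> f" "f < 40" "fl a f" "wp A (wp (While_flag f A) Q) (a\<lparr>clk := clk a + 1\<rparr>)"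
  shows "wp (While_flag f A) Q a"
proof -
  obtain b c where b: "clk a + 1 \<le> clk b" "runs orc A (conc a) ((clk b - (clk a + 1)) * tick) (conc b)"
    and c: "clk b \<le> clk c" "runs orc (While_flag f A) (conc b) ((clk c - clk b) * tick) (conc c)" "Q c"
    using assms(4) unfolding wp_def by auto
  have "runs orc (While_flag f A) (conc a)
      ((clk b - (clk a + 1)) * tick + 2 + (clk c - clk b) * tick) (conc c)"
    by (rule runs_Until_step[OF _ b(2) c(2)]) (use assms in \<open>simp add: scan_flag\<close>)
  moreover obtain d e where "clk b = clk a + 1 + d" "clk c = clk b + e"
    using b(1) c(1) le_Suc_ex by meson
  then have "(clk b - (clk a + 1)) * tick + 2 + (clk c - clk b) * tick \<le> (clk c - clk a) * tick"
    using tick_ge by (simp add: add_mult_distrib)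
  ultimately show ?thesis
    using b(1) c(1,3) unfolding wp_def by (intro exI[of _ c]) (auto intro: runs_mono)
qed

abbreviation set_flag :: "nat \<Rightarrow> bool \<Rightarrow> com" where
  "set_flag f b \<equiv> Instr (Write f (Bit b))"

lemma conc_set_flag:
  "34 \<le> f \<Longrightarrow> f < 40 \<Longrightarrow> (conc a)\<lparr>work := (work (conc a))(f := ftape S b)\<rparr> = conc (a\<lparr>fl := (fl a)(f := b)\<rparr>)"
  by (auto simp: conc_def fun_eq_iff)

lemma work_flag: "34 \<le> f \<Longrightarrow> f < 40 \<Longrightarrow> work (conc a) f = ftape S (fl a f)"
  by (simp add: conc_def)

lemma work_num: "x < 32 \<Longrightarrow> work (conc a) x = ptape S (bits W (nv a x)) 0"
  by (simp add: conc_def)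

lemma catalytic_conc [simp]: "catalytic (conc a) = ct a"
  by (simp add: conc_def)

lemma wp_set_flag:
  assumes "34 \<le> f" "f < 40" "Q (a\<lparr>fl := (fl a)(f := b), clk := clk a + 1\<rparr>)"
  shows "wp (set_flag f b) Q a"
  by (rule wp_prim[where t = 1 and a' = "a\<lparr>fl := (fl a)(f := b), clk := clk a + 1\<rparr>"], rule runs_Write)
     (use assms tick_ge in \<open>simp_all add: work_flag conc_set_flag\<close>)

lemma number_conc: "x < 32 \<Longrightarrow> nv a x < 2 ^ W \<Longrightarrow> number (work (conc a) x) = nv a x"
  by (simp add: work_num number_ptape horner_sum_bits)

lemma wp_CatRead:
  assumes "x < 32" "34 \<le> f" "f < 40" "nv a x < 2 ^ W" "nv a x < length (ct a)"
    and "Q (a\<lparr>fl := (fl a)(f := ct a ! nv a x), clk := clk a + 1\<rparr>)"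
  shows "wp (Instr (CatRead x f)) Q a"
  by (rule wp_prim[where t = 1 and a' = "a\<lparr>fl := (fl a)(f := ct a ! nv a x), clk := clk a + 1\<rparr>"], rule runs_CatRead)
     (use assms tick_ge in \<open>simp_all add: number_conc work_flag conc_set_flag\<close>)

lemma wp_CatWrite:
  assumes "x < 32" "34 \<le> f" "f < 40" "nv a x < 2 ^ W" "nv a x < length (ct a)"
    and "Q (a\<lparr>ct := (ct a)[nv a x := fl a f], clk := clk a + 1\<rparr>)"
  shows "wp (Instr (CatWrite x f)) Q a"
  by (rule wp_prim[where t = 1 and a' = "a\<lparr>ct := (ct a)[nv a x := fl a f], clk := clk a + 1\<rparr>"],
      rule runs_CatWrite[where z = "fl a f"])
     (use assms tick_ge in \<open>simp_all add: number_conc work_flag, simp add: conc_def cong: if_cong\<close>)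

lemma wp_full_adder:
  assumes "34 \<le> x" "x < 40" "34 \<le> y" "y < 40" "34 \<le> z" "z < 40" "x \<noteq> z"
    and "Q (a\<lparr>fl := (fl a)(x := (fl a x \<noteq> (fl a y \<noteq> fl a z)),
        z := (fl a x \<and> fl a y \<or> fl a x \<and> fl a z \<or> fl a y \<and> fl a z)), clk := clk a + 1\<rparr>)"
  shows "wp (full_adder x y z) Q a"
proof (rule wp_prim[where t = 8 and Q = Q])
  let ?a = "a\<lparr>fl := (fl a)(x := (fl a x \<noteq> (fl a y \<noteq> fl a z)),
        z := (fl a x \<and> fl a y \<or> fl a x \<and> fl a z \<or> fl a y \<and> fl a z)), clk := clk a + 1\<rparr>"
  have eq: "conc ?a = (conc a)\<lparr>work := (work (conc a))(x := put (Bit (fl a x \<noteq> (fl a y \<noteq> fl a z))) (work (conc a) x),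
     z := put (Bit (fl a x \<and> fl a y \<or> fl a x \<and> fl a z \<or> fl a y \<and> fl a z)) (work (conc a) z))\<rparr>"
    using assms(1-7) by (simp add: work_flag) (auto simp: conc_def fun_eq_iff)
  show "runs orc (full_adder x y z) (conc a) 8 (conc ?a)"
    unfolding eq by (rule runs_full_adder) (use assms(1-7) in \<open>simp_all add: scan_flag\<close>)
  show "Q ?a" using assms(8) .
qed (use tick_ge in simp_all)

section \<open>Sweeps for assignment, complement, addition, halving and padding\<close>

definition aligned1 :: "nat \<Rightarrow> astate \<Rightarrow> nat \<Rightarrow> bool list \<Rightarrow> config" where
  "aligned1 x a p xs = aligned S W x dummy (conc a) p xs []"

definition aligned2 :: "nat \<Rightarrow> nat \<Rightarrow> astate \<Rightarrow> nat \<Rightarrow> bool list \<Rightarrow> config" where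
  "aligned2 x y a p xs = aligned S W x y (conc a) p xs (bits W (nv a y))"

lemma aligned1_0: "x < 32 \<Longrightarrow> aligned1 x a 0 (bits W k) = conc (a\<lparr>nv := (nv a)(x := k)\<rparr>)"
  by (auto simp: aligned1_def aligned_def conc_def fun_eq_iff)

lemma aligned2_0:
  "x < 32 \<Longrightarrow> y < 32 \<Longrightarrow> x \<noteq> y \<Longrightarrow> aligned2 x y a 0 (bits W k) = conc (a\<lparr>nv := (nv a)(x := k)\<rparr>)"
  by (auto simp: aligned2_def aligned_def conc_def fun_eq_iff)

definition unary :: "nat \<Rightarrow> com \<Rightarrow> com" where
  "unary x F = sweep x dummy F Skip"

lemma runs_unary:
  assumes x: "x < 32"
    and F: "\<And>j. j < W \<Longrightarrow> runs orc F (aligned1 x a (Suc j) (mix W j (bit k) (bit (nv a x)))) 8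
              (aligned1 x a (Suc j) ((mix W j (bit k) (bit (nv a x)))[j := bit k j]))"
  shows "runs orc (unary x F) (conc a) tick (conc (a\<lparr>nv := (nv a)(x := k)\<rparr>))"
proof -
  let ?xs = "\<lambda>j. mix W j (bit k) (bit (nv a x))"
  have "runs orc (sweep x dummy F Skip) (aligned S W x dummy (conc a) 0 (?xs 0) []) ((W + 1) * (8 + 0 + 18))
     (aligned S W x dummy (conc a) 0 (?xs W) [])"
    by (rule runs_sweep[where xs = ?xs and xs' = "\<lambda>_. ?xs W" and c = "\<lambda>_. conc a" and c' = "\<lambda>_. conc a"])
       (use x WS F in \<open>auto simp: aligned1_def mix_extend\<close>)
  moreover have "aligned S W x dummy (conc a) 0 (?xs 0) [] = conc a"
    using aligned1_0[OF x, of a "nv a x"] by (simp add: aligned1_def mix_0 bits_def)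
  moreover have "aligned S W x dummy (conc a) 0 (?xs W) [] = conc (a\<lparr>nv := (nv a)(x := k)\<rparr>)"
    using aligned1_0[OF x, of a k] by (simp add: aligned1_def mix_all bits_def)
  ultimately show ?thesis
    unfolding unary_def by (auto simp: tick_def intro: runs_mono)
qed

lemma runs_Write_aligned1:
  assumes "x < 32" "j < W" "length xs = W"
  shows "runs orc (Instr (Write x (Bit b))) (aligned1 x a (Suc j) xs) 1 (aligned1 x a (Suc j) (xs[j := b]))"
  by (rule runs_Write) (use assms in \<open>auto simp: aligned1_def aligned_def put_ptape fun_upd_twist\<close>)

lemma scan_aligned1: "x < 32 \<Longrightarrow> j < W \<Longrightarrow> length xs = W \<Longrightarrow> scan (work (aligned1 x a (Suc j) xs) x) = Bit (xs ! j)"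
  using WS by (simp add: aligned1_def aligned_def scan_ptape_Suc)

definition zero :: "nat \<Rightarrow> com" where
  "zero x = unary x (Instr (Write x (Bit False)))"

lemma wp_zero:
  assumes "x < 32" "Q (a\<lparr>nv := (nv a)(x := 0), clk := clk a + 1\<rparr>)"
  shows "wp (zero x) Q a"
  unfolding zero_def
  by (rule wp_prim[where t = tick and a' = "a\<lparr>nv := (nv a)(x := 0), clk := clk a + 1\<rparr>"])
     (use assms in \<open>auto intro!: runs_unary runs_mono[OF runs_Write_aligned1]\<close>)

definition complement :: "nat \<Rightarrow> com" where
  "complement x = unary x (Cond x (Bit True) (Instr (Write x (Bit False))) (Instr (Write x (Bit True))))"

lemma wp_complement:
  assumes "x < 32" "nv a x < 2 ^ W" "Q (a\<lparr>nv := (nv a)(x := 2 ^ W - 1 - nv a x), clk := clk a + 1\<rparr>)"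
  shows "wp (complement x) Q a"
  unfolding complement_def
proof (rule wp_prim[where t = tick and a' = "a\<lparr>nv := (nv a)(x := 2 ^ W - 1 - nv a x), clk := clk a + 1\<rparr>"])
  show "runs orc (unary x (Cond x (Bit True) (Instr (Write x (Bit False))) (Instr (Write x (Bit True)))))
     (conc a) tick (conc (a\<lparr>nv := (nv a)(x := 2 ^ W - 1 - nv a x), clk := clk a + 1\<rparr>))"
    unfolding conc_clk
  proof (rule runs_unary)
    fix j assume j: "j < W"
    let ?xs = "mix W j (bit (2 ^ W - 1 - nv a x)) (bit (nv a x))"
    have "runs orc (Cond x (Bit True) (Instr (Write x (Bit False))) (Instr (Write x (Bit True))))
      (aligned1 x a (Suc j) ?xs) (1 + 2) (aligned1 x a (Suc j) (?xs[j := bit (2 ^ W - 1 - nv a x) j]))"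
    proof (rule runs_Cond)
      assume "scan (work (aligned1 x a (Suc j) ?xs) x) = Bit True"
      then have "bit (2 ^ W - 1 - nv a x) j = False"
        using assms j by (simp add: scan_aligned1 bit_complement[simplified])
      then show "runs orc (Instr (Write x (Bit False))) (aligned1 x a (Suc j) ?xs) 1
         (aligned1 x a (Suc j) (?xs[j := bit (2 ^ W - 1 - nv a x) j]))"
        using assms j runs_Write_aligned1 by auto
    next
      assume "scan (work (aligned1 x a (Suc j) ?xs) x) \<noteq> Bit True"
      then have "bit (2 ^ W - 1 - nv a x) j = True"
        using assms j by (simp add: scan_aligned1 bit_complement[simplified])
      then show "runs orc (Instr (Write x (Bit True))) (aligned1 x a (Suc j) ?xs) 1
         (aligned1 x a (Suc j) (?xs[j := bit (2 ^ W - 1 - nv a x) j]))"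
        using assms j runs_Write_aligned1 by auto
    qed
    then show "runs orc (Cond x (Bit True) (Instr (Write x (Bit False))) (Instr (Write x (Bit True))))
      (aligned1 x a (Suc j) ?xs) 8 (aligned1 x a (Suc j) (?xs[j := bit (2 ^ W - 1 - nv a x) j]))"
      by (rule runs_mono) simp
  qed (use assms in simp)
qed (use assms in simp_all)

abbreviation "carry_flag \<equiv> 34 :: nat"

definition add_carry :: "nat \<Rightarrow> nat \<Rightarrow> com" where
  "add_carry x y = sweep x y (full_adder x y carry_flag) Skip"

text \<open>During the sweep the flag holds the carry into the current position. After W positions
  it holds the overflow of the whole sum, from which comparisons are obtained later.\<close>

lemma runs_add_carry:
  assumes "x < 32" "y < 32" "x \<noteq> y" "nv a x < 2 ^ W" "nv a y < 2 ^ W"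
  defines "z \<equiv> nv a x + nv a y + of_bool (fl a carry_flag)"
  shows "runs orc (add_carry x y) (conc a) tick
    (conc (a\<lparr>nv := (nv a)(x := z mod 2 ^ W), fl := (fl a)(carry_flag := 2 ^ W \<le> z)\<rparr>))"
proof -
  let ?b = "\<lambda>j. carry (nv a x) (nv a y) (fl a carry_flag) j"
  let ?a = "\<lambda>j. a\<lparr>fl := (fl a)(carry_flag := ?b j)\<rparr>"
  let ?xs = "\<lambda>j. mix W j (bit z) (bit (nv a x))"
  let ?ys = "bits W (nv a y)"
  have "runs orc (sweep x y (full_adder x y carry_flag) Skip) (aligned S W x y (conc (?a 0)) 0 (?xs 0) ?ys)
     ((W + 1) * (8 + 0 + 18)) (aligned S W x y (conc (?a W)) 0 (?xs W) ?ys)"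
  proof (rule runs_sweep[where xs = ?xs and xs' = "\<lambda>_. ?xs W" and c = "\<lambda>j. conc (?a j)" and c' = "\<lambda>_. conc (?a W)"])
    fix j assume j: "j < W"
    let ?c = "aligned S W x y (conc (?a j)) (Suc j) (?xs j) ?ys"
    have w: "work ?c x = ptape S (?xs j) (Suc j)" "work ?c y = ptape S ?ys (Suc j)"
      "work ?c carry_flag = ftape S (?b j)"
      using assms by (auto simp: aligned_def work_flag)
    have "runs orc (full_adder x y carry_flag) ?c 8 (?c\<lparr>work := (work ?c)(
       x := put (Bit (bit (nv a x) j \<noteq> (bit (nv a y) j \<noteq> ?b j))) (work ?c x),
       carry_flag := put (Bit (bit (nv a x) j \<and> bit (nv a y) j \<or> bit (nv a x) j \<and> ?b j \<or>
         bit (nv a y) j \<and> ?b j)) (work ?c carry_flag))\<rparr>)"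
      by (rule runs_full_adder)
         (use assms(1-3) j WS in \<open>auto simp: w scan_ptape_Suc nth_bits\<close>)
    also have "(bit (nv a x) j \<noteq> (bit (nv a y) j \<noteq> ?b j)) = bit z j"
      unfolding z_def bit_add_carry by blast
    also have "(bit (nv a x) j \<and> bit (nv a y) j \<or> bit (nv a x) j \<and> ?b j \<or> bit (nv a y) j \<and> ?b j) = ?b (Suc j)"
      unfolding carry_Suc by blast
    also have "?c\<lparr>work := (work ?c)(x := put (Bit (bit z j)) (work ?c x),
         carry_flag := put (Bit (?b (Suc j))) (work ?c carry_flag))\<rparr> =
       aligned S W x y (conc (?a (Suc j))) (Suc j) (?xs (Suc j)) ?ys"
      unfolding w using assms(1-3) j
      by (auto simp: put_ptape mix_extend aligned_def conc_def fun_eq_iff)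
    finally show "runs orc (full_adder x y carry_flag) ?c 8 (aligned S W x y (conc (?a (Suc j))) (Suc j) (?xs (Suc j)) ?ys)" .
  qed (use assms WS in auto)
  moreover have "aligned S W x y (conc (?a 0)) 0 (?xs 0) ?ys = conc a"
    using aligned2_0[of x y "?a 0" "nv a x"] assms(1-3) by (simp add: aligned2_def mix_0 bits_def)
  moreover have "aligned S W x y (conc (?a W)) 0 (?xs W) ?ys =
      conc (a\<lparr>nv := (nv a)(x := z mod 2 ^ W), fl := (fl a)(carry_flag := 2 ^ W \<le> z)\<rparr>)"
  proof -
    have "bits W (z mod 2 ^ W) = bits W z"
      by (auto simp: bits_def bit_take_bit_iff simp flip: take_bit_eq_mod)
    moreover have "?xs W = bits W z"
      by (simp add: mix_all bits_def)
    moreover have "?b W \<longleftrightarrow> 2 ^ W \<le> z"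
      unfolding z_def by (rule carry_whole[OF assms(4,5)])
    ultimately have "aligned S W x y (conc (?a W)) 0 (?xs W) ?ys =
        conc (?a W\<lparr>nv := (nv (?a W))(x := z mod 2 ^ W)\<rparr>)"
      using aligned2_0[of x y "?a W" "z mod 2 ^ W"] assms(1-3) by (simp add: aligned2_def)
    then show ?thesis
      using \<open>?b W \<longleftrightarrow> 2 ^ W \<le> z\<close> by (auto intro: conc_cong)
  qed
  ultimately show ?thesis
    unfolding add_carry_def by (auto simp: tick_def intro: runs_mono)
qed

lemma wp_add_carry:
  assumes "x < 32" "y < 32" "x \<noteq> y" "nv a x < 2 ^ W" "nv a y < 2 ^ W"
    and "Q (a\<lparr>nv := (nv a)(x := (nv a x + nv a y + of_bool (fl a carry_flag)) mod 2 ^ W),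
      fl := (fl a)(carry_flag := 2 ^ W \<le> nv a x + nv a y + of_bool (fl a carry_flag)), clk := clk a + 1\<rparr>)"
  shows "wp (add_carry x y) Q a"
  by (rule wp_prim[where t = tick and Q = Q, OF _ _ _ assms(6)]) (use runs_add_carry[OF assms(1-5)] in simp_all)

text \<open>The shift proceeds from the top digit down, with the digit just read kept in the flag;
  what is left in the flag at the bottom is the parity.\<close>

definition halve :: "nat \<Rightarrow> nat \<Rightarrow> com" where
  "halve x f = set_flag f False ;;
     sweep x dummy Skip (Cond x (Bit True)
       (Cond f (Bit True) Skip (Instr (Write x (Bit False)) ;; set_flag f True))
       (Cond f (Bit True) (Instr (Write x (Bit True)) ;; set_flag f False) Skip))"

lemma runs_halve:
  assumes "x < 32" "34 \<le> f" "f < 40" "nv a x < 2 ^ W"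
  shows "runs orc (halve x f) (conc a) tick (conc (a\<lparr>nv := (nv a)(x := nv a x div 2), fl := (fl a)(f := odd (nv a x))\<rparr>))"
proof -
  define k where "k = nv a x"
  let ?a = "\<lambda>j. a\<lparr>fl := (fl a)(f := bit k j)\<rparr>"
  let ?xs = "\<lambda>j. mix W j (bit k) (bit (k div 2))"
  let ?C = "\<lambda>j. aligned S W x dummy (conc (?a j))"
  \<comment> \<open>The digit shifted in at the top is bit W of k, which is 0 because
    \<open>k < 2 ^ W\<close>.\<close>
  have "runs orc (set_flag f False) (conc a) 1 (conc (?a W))"
    using assms not_bit_large[of k W W]
    by (intro runs_Write) (simp add: work_flag conc_set_flag k_def)
  moreover have "runs orc (sweep x dummy Skip (Cond x (Bit True)
       (Cond f (Bit True) Skip (Instr (Write x (Bit False)) ;; set_flag f True))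
       (Cond f (Bit True) (Instr (Write x (Bit True)) ;; set_flag f False) Skip)))
     (?C W 0 (?xs W) []) ((W + 1) * (0 + 6 + 18)) (?C 0 0 (?xs 0) [])"
  proof (rule runs_sweep[where xs = "\<lambda>_. ?xs W" and xs' = ?xs and c = "\<lambda>_. conc (?a W)" and c' = "\<lambda>j. conc (?a j)"])
    fix j assume j: "j < W"
    let ?c = "?C (Suc j) (Suc j) (?xs (Suc j)) []"
    let ?c' = "?C j (Suc j) (?xs j) []"
    have w: "work ?c x = ptape S (?xs (Suc j)) (Suc j)" "work ?c f = ftape S (bit k (Suc j))"
      using assms by (auto simp: aligned_def work_flag)
    have sx: "scan (work ?c x) = Bit (bit k j)" and sf: "scan (work ?c f) = Bit (bit k (Suc j))"
      unfolding w using j WS by (simp_all add: scan_ptape_Suc)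
    have r: "?xs j = (?xs (Suc j))[j := bit k (Suc j)]"
      by (rule mix_retract[symmetric]) (simp add: bit_Suc)
    have skip: "runs orc Skip ?c 2 ?c'" if "bit k j = bit k (Suc j)"
    proof -
      have "?xs j = ?xs (Suc j)"
        unfolding r using j that by (subst list_update_id[symmetric, of _ j]) simp
      then have "?c' = ?c" using that by simp
      then show ?thesis using runs_mono[OF runs_Skip] by simp
    qed
    have flip: "runs orc (Instr (Write x (Bit b)) ;; set_flag f (\<not> b)) ?c 2 ?c'"
      if "b = bit k (Suc j)" "bit k j = (\<not> b)" for b
    proof -
      have "runs orc (Instr (Write x (Bit b)) ;; set_flag f (\<not> b)) ?c (1 + 1) ?c'"
        by (rule runs_Seq[OF runs_Write[OF refl] runs_Write])
           (use assms(1-3) j that in \<open>auto simp: w put_ptape r aligned_def conc_def fun_eq_iff\<close>)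
      then show ?thesis by (simp add: numeral_2_eq_2)
    qed
    have "runs orc (Cond x (Bit True)
       (Cond f (Bit True) Skip (Instr (Write x (Bit False)) ;; set_flag f True))
       (Cond f (Bit True) (Instr (Write x (Bit True)) ;; set_flag f False) Skip)) ?c (2 + 2 + 2) ?c'"
    proof (rule runs_Cond; rule runs_Cond)
      show "runs orc (Instr (Write x (Bit False)) ;; set_flag f True) ?c 2 ?c'"
        if "scan (work ?c x) = Bit True" "scan (work ?c f) \<noteq> Bit True"
        using flip[of False] that unfolding sx sf by simp
      show "runs orc (Instr (Write x (Bit True)) ;; set_flag f False) ?c 2 ?c'"
        if "scan (work ?c x) \<noteq> Bit True" "scan (work ?c f) = Bit True"
        using flip[of True] that unfolding sx sf by simp
    qed (use skip sx sf in simp_all)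
    then show "runs orc (Cond x (Bit True)
       (Cond f (Bit True) Skip (Instr (Write x (Bit False)) ;; set_flag f True))
       (Cond f (Bit True) (Instr (Write x (Bit True)) ;; set_flag f False) Skip)) ?c 6 ?c'"
      by simp
  qed (use assms WS in auto)
  moreover have "?C W 0 (?xs W) [] = conc (?a W)"
    using aligned1_0[OF assms(1), of "?a W" "nv a x"] by (simp add: aligned1_def mix_all bits_def k_def)
  moreover have "?C 0 0 (?xs 0) [] = conc (a\<lparr>nv := (nv a)(x := nv a x div 2), fl := (fl a)(f := odd (nv a x))\<rparr>)"
    using aligned1_0[OF assms(1), of "?a 0" "k div 2"]
    by (simp add: aligned1_def mix_0 bits_def k_def bit_0) (rule conc_cong; simp)
  ultimately have "runs orc (halve x f) (conc a) (1 + (W + 1) * (0 + 6 + 18))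
      (conc (a\<lparr>nv := (nv a)(x := nv a x div 2), fl := (fl a)(f := odd (nv a x))\<rparr>))"
    unfolding halve_def by (intro runs_Seq) auto
  then show ?thesis by (rule runs_mono) (simp add: tick_def)
qed

lemma wp_halve:
  assumes "x < 32" "34 \<le> f" "f < 40" "nv a x < 2 ^ W"
    and "Q (a\<lparr>nv := (nv a)(x := nv a x div 2), fl := (fl a)(f := odd (nv a x)), clk := clk a + 1\<rparr>)"
  shows "wp (halve x f) Q a"
  by (rule wp_prim[where t = tick and Q = Q, OF _ _ _ assms(5)]) (use runs_halve[OF assms(1-4)] in simp_all)

text \<open>Numbers from queries and from the input come without leading zeros, whereas the sweeps
  rely on exactly W digits.\<close>

definition pad :: "nat \<Rightarrow> com" where
  "pad x = sweep x dummy (Cond x Blank (Instr (Write x (Bit False))) Skip) Skip"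

lemma runs_pad:
  assumes "x < 32" "length bs \<le> W"
  shows "runs orc (pad x) (aligned S W x dummy c 0 bs []) (21 * (W + 1))
    (aligned S W x dummy c 0 (bs @ replicate (W - length bs) False) [])"
proof -
  let ?xs = "\<lambda>j. bs @ replicate (min j W - length bs) False"
  have "runs orc (sweep x dummy (Cond x Blank (Instr (Write x (Bit False))) Skip) Skip)
     (aligned S W x dummy c 0 (?xs 0) []) ((W + 1) * (3 + 0 + 18)) (aligned S W x dummy c 0 (?xs W) [])"
  proof (rule runs_sweep[where xs = ?xs and xs' = "\<lambda>_. ?xs W" and c = "\<lambda>_. c" and c' = "\<lambda>_. c"])
    fix j assume j: "j < W"
    let ?C = "\<lambda>j'. aligned S W x dummy c (Suc j) (?xs j') []"
    have len: "length (?xs j) = max j (length bs)" using j by simp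
    have w: "work (?C j) x = ptape S (?xs j) (Suc j)"
      using assms by (auto simp: aligned_def)
    have "runs orc (Cond x Blank (Instr (Write x (Bit False))) Skip) (?C j) (1 + 2) (?C (Suc j))"
    proof (rule runs_Cond)
      assume "scan (work (?C j) x) = Blank"
      then have le: "length bs \<le> j"
        using j WS assms(2) unfolding w by (simp add: scan_ptape_Suc len split: if_splits)
      then have xs: "?xs (Suc j) = ?xs j @ [False]"
        using j by (simp add: Suc_diff_le replicate_append_same)
      have "put (Bit False) (work (?C j) x) = ptape S (?xs (Suc j)) (Suc j)"
        unfolding w xs using put_ptape_end[of "?xs j" S False] le j WS len by (simp add: max_def)
      then show "runs orc (Instr (Write x (Bit False))) (?C j) 1 (?C (Suc j))"
        using assms(1) by (intro runs_Write) (simp add: aligned_def fun_upd_twist)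
    next
      assume "scan (work (?C j) x) \<noteq> Blank"
      then have "j < length bs"
        using j WS assms(2) unfolding w by (simp add: scan_ptape_Suc len split: if_splits)
      then show "runs orc Skip (?C j) 1 (?C (Suc j))"
        using runs_mono[OF runs_Skip] by simp
    qed
    then show "runs orc (Cond x Blank (Instr (Write x (Bit False))) Skip) (?C j) 3 (?C (Suc j))"
      by (rule runs_mono) simp
  qed (use assms WS in auto)
  then show ?thesis
    unfolding pad_def using assms(2) by (simp add: mult.commute)
qed

lemma runs_query:
  assumes "b < 32" "k < 2 ^ W" "length (bin k) \<le> W"
    and "runs orc I (conc a) 1 ((conc a)\<lparr>work := (work (conc a))(b := ptape S (bin k) 0)\<rparr>)"
  shows "runs orc (I ;; pad b) (conc a) tick (conc (a\<lparr>nv := (nv a)(b := k)\<rparr>))"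
proof -
  have eq: "(conc a)\<lparr>work := (work (conc a))(b := ptape S (bin k) 0)\<rparr> = aligned S W b dummy (conc a) 0 (bin k) []"
    using assms(1) by (auto simp: aligned_def conc_def fun_eq_iff)
  have "aligned S W b dummy (conc a) 0 (bin k @ replicate (W - length (bin k)) False) []
      = conc (a\<lparr>nv := (nv a)(b := k)\<rparr>)"
    using aligned1_0[OF assms(1), of a k] bin_padded[OF assms(2)] by (simp add: aligned1_def)
  then have "runs orc (I ;; pad b) (conc a) (1 + 21 * (W + 1)) (conc (a\<lparr>nv := (nv a)(b := k)\<rparr>))"
    using runs_Seq[OF assms(4)[unfolded eq] runs_pad[OF assms(1,3)]] by simp
  then show ?thesis by (rule runs_mono) (simp add: tick_def)
qed

definition in_degree :: "nat \<Rightarrow> nat \<Rightarrow> com" where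
  "in_degree x b = Instr (InDegree x b) ;; pad b"

lemma wp_in_degree:
  assumes "x < 32" "b < 32" "nv a x < 2 ^ W" "length (in_nbrs orc (nv a x)) < 2 ^ W"
    and "Q (a\<lparr>nv := (nv a)(b := length (in_nbrs orc (nv a x))), clk := clk a + 1\<rparr>)"
  shows "wp (in_degree x b) Q a"
proof (rule wp_prim[where t = tick and Q = Q, OF _ _ _ assms(5)])
  have "length (bin (length (in_nbrs orc (nv a x)))) \<le> W"
    using assms(4) by (rule length_bin_le)
  then show "runs orc (in_degree x b) (conc a) tick
      (conc (a\<lparr>nv := (nv a)(b := length (in_nbrs orc (nv a x))), clk := clk a + 1\<rparr>))"
    unfolding in_degree_def conc_clk using assms(1-4) WS
    by (intro runs_query[OF assms(2)] runs_InDegree[OF _ refl])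
       (simp_all add: number_conc, simp add: work_num store_ptape)
qed simp_all

definition in_neighbor :: "nat \<Rightarrow> nat \<Rightarrow> nat \<Rightarrow> com" where
  "in_neighbor x i b = Instr (InNeighbor x i b) ;; pad b"

lemma wp_in_neighbor:
  assumes "x < 32" "i < 32" "b < 32" "nv a x < 2 ^ W" "nv a i < 2 ^ W"
    and "nv a i < length (in_nbrs orc (nv a x))" "in_nbrs orc (nv a x) ! nv a i < 2 ^ W"
    and "Q (a\<lparr>nv := (nv a)(b := in_nbrs orc (nv a x) ! nv a i), clk := clk a + 1\<rparr>)"
  shows "wp (in_neighbor x i b) Q a"
proof (rule wp_prim[where t = tick and Q = Q, OF _ _ _ assms(8)])
  have "length (bin (in_nbrs orc (nv a x) ! nv a i)) \<le> W"
    using assms(7) by (rule length_bin_le)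
  then show "runs orc (in_neighbor x i b) (conc a) tick
      (conc (a\<lparr>nv := (nv a)(b := in_nbrs orc (nv a x) ! nv a i), clk := clk a + 1\<rparr>))"
    unfolding in_neighbor_def conc_clk using assms(1-7) WS
    by (intro runs_query[OF assms(3)] runs_InNeighbor[OF _ _ refl])
       (simp_all add: number_conc, simp add: work_num store_ptape)
qed simp_all

end

section \<open>Derived operations\<close>

text \<open>
  Tapes 1 to 6 hold the input and tape 7 holds 0.  The names of the others:
  \<open>vr\<close> is \<open>2 ^ l mod q\<close>, \<open>vd\<close> is \<open>1 mod q\<close>, \<open>vbx\<close> and \<open>vby\<close> are the addresses of the target and
  source register, \<open>vax\<close> and \<open>vay\<close> run through them bit by bit, and \<open>vw\<close> receives the value of a
  register modulo \<open>q\<close>.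
\<close>

abbreviation (input) "vn \<equiv> 1 :: nat"
abbreviation (input) "vl \<equiv> 2 :: nat"
abbreviation (input) "vq \<equiv> 3 :: nat"
abbreviation (input) "vT \<equiv> 4 :: nat"
abbreviation (input) "vs \<equiv> 5 :: nat"
abbreviation (input) "vt \<equiv> 6 :: nat"
abbreviation (input) "v0 \<equiv> 7 :: nat"
abbreviation (input) "tmp \<equiv> 8 :: nat"
abbreviation (input) "vr \<equiv> 9 :: nat"
abbreviation (input) "vd \<equiv> 10 :: nat"
abbreviation (input) "vbx \<equiv> 11 :: nat"
abbreviation (input) "vby \<equiv> 12 :: nat"
abbreviation (input) "vi \<equiv> 13 :: nat"
abbreviation (input) "vax \<equiv> 14 :: nat"
abbreviation (input) "vay \<equiv> 15 :: nat"
abbreviation (input) "vrr \<equiv> 16 :: nat"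
abbreviation (input) "vk \<equiv> 17 :: nat"
abbreviation (input) "vv \<equiv> 18 :: nat"
abbreviation (input) "vj \<equiv> 19 :: nat"
abbreviation (input) "vdeg \<equiv> 20 :: nat"
abbreviation (input) "vu \<equiv> 21 :: nat"
abbreviation (input) "vpow \<equiv> 22 :: nat"
abbreviation (input) "vw \<equiv> 23 :: nat"

abbreviation (input) "fx \<equiv> 35 :: nat"
abbreviation (input) "fy \<equiv> 36 :: nat"
abbreviation (input) "fg \<equiv> 37 :: nat"
abbreviation (input) "layer \<equiv> 38 :: nat"
abbreviation (input) "backward \<equiv> 39 :: nat"

definition agree :: "'a set \<Rightarrow> ('a \<Rightarrow> 'b) \<Rightarrow> ('a \<Rightarrow> 'b) \<Rightarrow> bool" where
  "agree V f g \<longleftrightarrow> (\<forall>x. x \<notin> V \<longrightarrow> g x = f x)"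

lemma agree_refl [simp]: "agree V f f"
  by (simp add: agree_def)

lemma agree_update [simp]: "x \<in> V \<Longrightarrow> agree V f (g(x := k)) \<longleftrightarrow> agree V f g"
  by (auto simp: agree_def)

text \<open>Says nothing about \<open>ct\<close> and \<open>clk\<close>: these are specified
  separately for each operation.\<close>

definition frame :: "nat set \<Rightarrow> nat set \<Rightarrow> astate \<Rightarrow> astate \<Rightarrow> bool" where
  "frame V F a a' \<longleftrightarrow> agree V (nv a) (nv a') \<and> agree F (fl a) (fl a')"

lemma frame_refl: "frame V F a a"
  by (simp add: frame_def)

lemma frame_trans: "frame V F a b \<Longrightarrow> frame V' F' b c \<Longrightarrow> V' \<subseteq> V \<Longrightarrow> F' \<subseteq> F \<Longrightarrow> frame V F a c"
  unfolding frame_def agree_def by (metis subsetD)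

lemma frame_nv: "frame V F a a' \<Longrightarrow> x \<notin> V \<Longrightarrow> nv a' x = nv a x"
  by (simp add: frame_def agree_def)

lemma frame_fl: "frame V F a a' \<Longrightarrow> f \<notin> F \<Longrightarrow> fl a' f = fl a f"
  by (simp add: frame_def agree_def)

text \<open>Normal form of updates: first \<open>nv\<close>, then \<open>fl\<close>,
  \<open>ct\<close> and \<open>clk\<close>.\<close>

lemma astate_update_order [simp]:
  "a\<lparr>fl := F, nv := V\<rparr> = a\<lparr>nv := V, fl := F\<rparr>"
  "a\<lparr>ct := C, nv := V\<rparr> = a\<lparr>nv := V, ct := C\<rparr>"
  "a\<lparr>clk := k, nv := V\<rparr> = a\<lparr>nv := V, clk := k\<rparr>"
  "a\<lparr>ct := C, fl := F\<rparr> = a\<lparr>fl := F, ct := C\<rparr>"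
  "a\<lparr>clk := k, fl := F\<rparr> = a\<lparr>fl := F, clk := k\<rparr>"
  "a\<lparr>clk := k, ct := C\<rparr> = a\<lparr>ct := C, clk := k\<rparr>"
  by simp_all

context machine
begin

definition copy :: "nat \<Rightarrow> nat \<Rightarrow> com" where
  "copy x y = zero x ;; set_flag carry_flag False ;; add_carry x y"

text \<open>Demanding \<open>Q\<close> for every clock value up to a bound hides the exact cost, so
  that costs can be rounded up wherever operations are combined.\<close>

lemma wp_copy:
  assumes "x < 32" "y < 32" "x \<noteq> y" "nv a y < 2 ^ W"
    and "\<And>k. k \<le> clk a + 3 \<Longrightarrow> Q (a\<lparr>nv := (nv a)(x := nv a y), fl := (fl a)(carry_flag := False), clk := k\<rparr>)"
  shows "wp (copy x y) Q a"
  unfolding copy_def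
  by (intro wp_Seq wp_zero wp_set_flag wp_add_carry) (use assms in \<open>simp_all\<close>)

definition plus :: "nat \<Rightarrow> nat \<Rightarrow> com" where
  "plus x y = set_flag carry_flag False ;; add_carry x y"

lemma wp_plus:
  assumes "x < 32" "y < 32" "x \<noteq> y" "nv a x + nv a y < 2 ^ W"
    and "\<And>k. k \<le> clk a + 2 \<Longrightarrow> Q (a\<lparr>nv := (nv a)(x := nv a x + nv a y), fl := (fl a)(carry_flag := False), clk := k\<rparr>)"
  shows "wp (plus x y) Q a"
  unfolding plus_def
  by (intro wp_Seq wp_set_flag wp_add_carry) (use assms in \<open>simp_all\<close>)

definition inc :: "nat \<Rightarrow> com" where
  "inc x = set_flag carry_flag True ;; add_carry x v0"

lemma wp_inc:
  assumes "x < 32" "x \<noteq> v0" "nv a v0 = 0" "Suc (nv a x) < 2 ^ W"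
    and "\<And>k. k \<le> clk a + 2 \<Longrightarrow> Q (a\<lparr>nv := (nv a)(x := Suc (nv a x)), fl := (fl a)(carry_flag := False), clk := k\<rparr>)"
  shows "wp (inc x) Q a"
  unfolding inc_def
  by (intro wp_Seq wp_set_flag wp_add_carry) (use assms in \<open>simp_all\<close>)

text \<open>\<open>2 ^ W - 1 - x + y\<close> overflows W digits exactly when \<open>x < y\<close>,
  so the answer appears in the carry flag; working on \<open>tmp\<close> preserves both
  operands.\<close>

definition less :: "nat \<Rightarrow> nat \<Rightarrow> com" where
  "less x y = copy tmp x ;; complement tmp ;; set_flag carry_flag False ;; add_carry tmp y"

lemma wp_less:
  assumes "x < 32" "y < 32" "x \<noteq> tmp" "y \<noteq> tmp" "nv a x < 2 ^ W" "nv a y < 2 ^ W"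
    and "\<And>g k. k \<le> clk a + 6 \<Longrightarrow>
      Q (a\<lparr>nv := (nv a)(tmp := g), fl := (fl a)(carry_flag := nv a x < nv a y), clk := k\<rparr>)"
  shows "wp (less x y) Q a"
proof -
  have "2 ^ W \<le> 2 ^ W - 1 - nv a x + nv a y \<longleftrightarrow> nv a x < nv a y"
    using assms(5,6) by linarith
  then show ?thesis
    unfolding less_def using assms
    by (intro wp_Seq wp_copy wp_complement wp_set_flag wp_add_carry) simp_all
qed

text \<open>In two's complement style, \<open>x - y\<close> is the complement of \<open>(2 ^ W - 1 - x) + y\<close>.\<close>

definition minus :: "nat \<Rightarrow> nat \<Rightarrow> com" where
  "minus x y = complement x ;; plus x y ;; complement x"

lemma wp_minus:
  assumes "x < 32" "y < 32" "x \<noteq> y" "nv a x < 2 ^ W" "nv a y \<le> nv a x"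
    and "\<And>k. k \<le> clk a + 4 \<Longrightarrow> Q (a\<lparr>nv := (nv a)(x := nv a x - nv a y), fl := (fl a)(carry_flag := False), clk := k\<rparr>)"
  shows "wp (minus x y) Q a"
proof -
  have "2 ^ W - Suc (2 ^ W - Suc (nv a x) + nv a y) = nv a x - nv a y"
    "2 ^ W - Suc (nv a x) + nv a y < 2 ^ W"
    using assms(4,5) by linarith+
  then show ?thesis
    unfolding minus_def using assms
    by (intro wp_Seq wp_plus wp_complement) simp_all
qed

definition mod_reduce :: "nat \<Rightarrow> com" where
  "mod_reduce x = less x vq ;; If_flag carry_flag Skip (minus x vq)"

lemma wp_mod_reduce:
  assumes "x < 32" "x \<noteq> tmp" "x \<noteq> vq" "nv a x < 2 ^ W" "nv a vq < 2 ^ W" "nv a x < 2 * nv a vq"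
    and "\<And>g b k. k \<le> clk a + 11 \<Longrightarrow> Q (a\<lparr>nv := (nv a)(tmp := g, x := nv a x mod nv a vq), fl := (fl a)(carry_flag := b), clk := k\<rparr>)"
  shows "wp (mod_reduce x) Q a"
proof -
  have m: "nv a x mod nv a vq = (if nv a x < nv a vq then nv a x else nv a x - nv a vq)"
    using assms(6) by (auto simp: not_less le_mod_geq)
  have q: "Q (a\<lparr>nv := (nv a)(tmp := g, x := nv a x), fl := (fl a)(carry_flag := b), clk := k\<rparr>)"
    if "nv a x < nv a vq" "k \<le> clk a + 11" for g b k
    using assms(7)[where k = k and g = g and b = b] that by (simp add: m)
  have q': "Q (a\<lparr>nv := (nv a)(tmp := g, x := nv a x - nv a vq), fl := (fl a)(carry_flag := b), clk := k\<rparr>)"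
    if "\<not> nv a x < nv a vq" "k \<le> clk a + 11" for g b k
    using assms(7)[where k = k and g = g and b = b] that by (simp add: m)
  have u: "(nv a)(tmp := g, x := nv a x) = (nv a)(tmp := g)" for g
    using assms(2) by auto
  show ?thesis
    unfolding mod_reduce_def
    by (intro wp_Seq wp_less wp_If_flag wp_Skip wp_minus)
       (use assms(1-6) q q' in \<open>simp_all add: u\<close>)
qed

definition mod_plus :: "nat \<Rightarrow> nat \<Rightarrow> com" where
  "mod_plus x y = plus x y ;; mod_reduce x"

lemma wp_mod_plus:
  assumes "x < 32" "x \<noteq> tmp" "x \<noteq> vq" "y < 32" "x \<noteq> y" "nv a x < nv a vq" "nv a y < nv a vq" "2 * nv a vq < 2 ^ W"
    and "\<And>g b k. k \<le> clk a + 13 \<Longrightarrow> Q (a\<lparr>nv := (nv a)(tmp := g, x := (nv a x + nv a y) mod nv a vq),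
      fl := (fl a)(carry_flag := b), clk := k\<rparr>)"
  shows "wp (mod_plus x y) Q a"
proof -
  have u: "(nv a)(x := k, tmp := g, x := k') = (nv a)(tmp := g, x := k')" for g k k'
    using assms(2) by auto
  show ?thesis
    unfolding mod_plus_def
    by (intro wp_Seq wp_plus wp_mod_reduce) (use assms(1-8) in \<open>simp_all add: u assms(9)\<close>)
qed

definition for_loop :: "nat \<Rightarrow> nat \<Rightarrow> com \<Rightarrow> com" where
  "for_loop i bd A = zero i ;; less i bd ;; While_flag carry_flag (A ;; inc i ;; less i bd)"

text \<open>The cost of the body may depend on j, because it will depend on the degree of a vertex.
  An iteration adds 1 for the loop test, 2 for \<open>inc\<close> and 6 for \<open>less\<close>, in
  total 9; the constant 8 is 1 for \<open>zero\<close>, 6 for the first \<open>less\<close> and 1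
  for the exit. The invariant must tolerate changes by the loop control itself, which is the second
  closure condition on \<open>I\<close>.\<close>

lemma wp_for_loop:
  assumes ix: "i < 32" "bd < 32" "i \<noteq> bd" "i \<noteq> tmp" "bd \<noteq> tmp" "i \<noteq> v0" and N: "N < 2 ^ W"
    and inv: "\<And>j a. I j a \<Longrightarrow> nv a v0 = 0 \<and> nv a bd = N"
    and fr: "\<And>j a a'. I j a \<Longrightarrow> frame {tmp, i} {carry_flag} a a' \<Longrightarrow> ct a' = ct a \<Longrightarrow> I j a'"
    and start: "I 0 a"
    and step: "\<And>j a. j < N \<Longrightarrow> I j a \<Longrightarrow> nv a i = j \<Longrightarrow>
       wp A (\<lambda>a'. I (Suc j) a' \<and> nv a' i = j \<and> clk a' \<le> clk a + c j) a"
    and post: "\<And>a'. I N a' \<Longrightarrow> clk a' \<le> clk a + (\<Sum>j<N. c j + 9) + 8 \<Longrightarrow> Q a'"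
  shows "wp (for_loop i bd A) Q a"
proof -
  let ?L = "While_flag carry_flag (A ;; inc i ;; less i bd)"
  have loop: "wp ?L (\<lambda>a'. I N a' \<and> clk a' \<le> clk a + (\<Sum>j=N-d..<N. c j + 9) + 1) a"
    if "d \<le> N" "I (N - d) a" "nv a i = N - d" "fl a carry_flag = (0 < d)" for d a
    using that
  proof (induction d arbitrary: a)
    case 0
    then show ?case
      by (intro wp_While_flag_exit) (auto simp: frame_def intro: fr)
  next
    case (Suc d)
    let ?j = "N - Suc d"
    have j: "Suc ?j = N - d" "?j < N" using Suc.prems by auto
    let ?a = "a\<lparr>clk := clk a + 1\<rparr>"
    have I: "I ?j ?a" using Suc.prems by (auto simp: frame_def intro: fr)
    have sum: "(\<Sum>j=?j..<N. c j + 9) = c ?j + 9 + (\<Sum>j=N-d..<N. c j + 9)"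
      using j by (simp add: sum.atLeast_Suc_lessThan)
    have body: "wp (inc i ;; less i bd) (wp ?L (\<lambda>a'. I N a' \<and> clk a' \<le> clk a + (\<Sum>j=?j..<N. c j + 9) + 1)) b"
      if b: "I (Suc ?j) b" "nv b i = ?j" "clk b \<le> clk ?a + c ?j" for b
    proof -
      have "wp ?L (\<lambda>a'. I N a' \<and> clk a' \<le> clk a + (\<Sum>j=?j..<N. c j + 9) + 1)
          (b\<lparr>nv := (nv b)(i := Suc ?j, tmp := g), fl := (fl b)(carry_flag := Suc ?j < N), clk := k\<rparr>)"
        if "k \<le> clk b + 8" for g k
      proof (rule wp_mono[OF Suc.IH])
        show "I (N - d) (b\<lparr>nv := (nv b)(i := Suc ?j, tmp := g), fl := (fl b)(carry_flag := Suc ?j < N), clk := k\<rparr>)"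
          using b(1) unfolding j(1) by (rule fr) (auto simp: frame_def)
      qed (use Suc.prems b(3) ix that in \<open>auto simp: sum\<close>)
      then show ?thesis
        using inv[OF b(1)] ix N b(2) j(2)
        by (intro wp_Seq wp_inc wp_less) (simp_all add: j(1))
    qed
    have "wp (A ;; inc i ;; less i bd) (wp ?L (\<lambda>a'. I N a' \<and> clk a' \<le> clk a + (\<Sum>j=?j..<N. c j + 9) + 1)) ?a"
      by (rule wp_Seq, rule wp_mono[OF step[OF j(2) I]]) (use Suc.prems body in auto)
    then show ?case using Suc.prems by (intro wp_While_flag_step) auto
  qed
  have "wp ?L Q (a\<lparr>nv := (nv a)(i := 0, tmp := g), fl := (fl a)(carry_flag := 0 < N), clk := k\<rparr>)"
    if "k \<le> clk a + 7" for g k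
  proof (rule wp_mono[OF loop[of N]])
    show "I (N - N) (a\<lparr>nv := (nv a)(i := 0, tmp := g), fl := (fl a)(carry_flag := 0 < N), clk := k\<rparr>)"
      using start by (auto intro: fr simp: frame_def)
  qed (use ix post that in \<open>auto simp: atLeast0LessThan\<close>)
  then show ?thesis
    unfolding for_loop_def using ix N inv[OF start]
    by (intro wp_Seq wp_zero wp_less) simp_all
qed

end

section \<open>Register arithmetic modulo powers of two\<close>

text \<open>Registers are given digit by digit, not as numbers, because in the middle of an
  operation a register consists of new and old digits. Register R(c, v) has index
  \<open>g = c * n + v\<close>; cells behind the registers keep their values.\<close>

definition regs :: "nat \<Rightarrow> nat \<Rightarrow> bool list \<Rightarrow> (nat \<Rightarrow> nat \<Rightarrow> bool) \<Rightarrow> bool list" where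
  "regs n l cat B = map (\<lambda>k. if k < 2 * n * l then B (k div l) (k mod l) else cat ! k) [0..<length cat]"

lemma length_regs [simp]: "length (regs n l cat B) = length cat"
  by (simp add: regs_def)

lemma regs_cong: "(\<And>g i. g < 2 * n \<Longrightarrow> i < l \<Longrightarrow> B g i = B' g i) \<Longrightarrow> regs n l cat B = regs n l cat B'"
  by (cases "l = 0") (auto simp: regs_def less_mult_imp_div_less)

lemma register_address: "g < 2 * n \<Longrightarrow> i < l \<Longrightarrow> g * l + i < 2 * n * l" for g n l :: nat
proof -
  assume "g < 2 * n" "i < l"
  then have "g * l + i < (g + 1) * l" by simp
  also have "\<dots> \<le> 2 * n * l" using \<open>g < 2 * n\<close> by (intro mult_right_mono) auto
  finally show ?thesis .
qed

lemma nth_regs: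
  "g < 2 * n \<Longrightarrow> i < l \<Longrightarrow> 2 * n * l \<le> length cat \<Longrightarrow> regs n l cat B ! (g * l + i) = B g i"
  using register_address[of g n i l] by (simp add: regs_def)

lemma regs_update:
  assumes "g < 2 * n" "i < l" "2 * n * l \<le> length cat"
  shows "(regs n l cat B)[g * l + i := z] = regs n l cat (B(g := (B g)(i := z)))"
proof (rule nth_equalityI)
  fix k assume k: "k < length ((regs n l cat B)[g * l + i := z])"
  have "k div l = g \<and> k mod l = i \<longleftrightarrow> k = g * l + i"
    using assms(2) by (metis add.commute div_mult_self1 div_less less_nat_zero_code mod_mult_self1
        mod_less add_0 div_mult_mod_eq)
  then show "(regs n l cat B)[g * l + i := z] ! k = regs n l cat (B(g := (B g)(i := z))) ! k"
    using k register_address[OF assms(1,2)] by (auto simp: regs_def nth_list_update)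
qed simp

text \<open>\<open>capacity\<close> covers everything that work tapes have to hold: addresses of
  registers, counters up to n, l and T, and sums of two residues modulo q.\<close>

locale problem = machine +
  fixes n l q T s t :: nat and cat :: "bool list"
  assumes n_pos: "0 < n" and q_pos: "0 < q"
    and capacity: "2 * n * l + n + 2 * q + l + T + 2 \<le> 2 ^ W"
    and length_cat: "2 * n * l \<le> length cat"
    and st: "s < n" "t < n"
    and in_nbrs_less: "\<And>v. v < n \<Longrightarrow> length (in_nbrs orc v) \<le> n \<and> set (in_nbrs orc v) \<subseteq> {..<n}"
    and q_le: "q \<le> 2 ^ l"
begin

definition glob :: "astate \<Rightarrow> bool" where
  "glob a \<longleftrightarrow> nv a vn = n \<and> nv a vl = l \<and> nv a vq = q \<and> nv a vT = T \<and> nv a vs = s \<and> nv a vt = t \<and>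
     nv a v0 = 0"

lemma globD:
  assumes "glob a"
  shows "nv a vn = n" "nv a vl = l" "nv a vq = q" "nv a vT = T" "nv a vs = s" "nv a vt = t" "nv a v0 = 0"
  using assms by (simp_all add: glob_def)

lemma glob_frame: "glob a \<Longrightarrow> frame V F a a' \<Longrightarrow> V \<inter> {1..7} = {} \<Longrightarrow> glob a'"
proof -
  assume "glob a" "frame V F a a'" "V \<inter> {1..7} = {}"
  then have "nv a' x = nv a x" if "x \<in> {1..7}" for x
    using that frame_nv[of V F a a' x] by blast
  then show ?thesis using \<open>glob a\<close> by (simp add: glob_def)
qed

definition stored :: "(nat \<Rightarrow> nat) \<Rightarrow> bool list" where
  "stored X = regs n l cat (\<lambda>g. bit (X g))"

lemma address_less: "g < 2 * n \<Longrightarrow> i < l \<Longrightarrow> g * l + i + 1 < 2 ^ W"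
  using register_address[of g n i l] capacity by linarith

lemma address_le: "g < 2 * n \<Longrightarrow> i \<le> l \<Longrightarrow> g * l + i < 2 ^ W"
proof -
  assume "g < 2 * n" "i \<le> l"
  then have "g * l + i \<le> (g + 1) * l" by simp
  also have "\<dots> \<le> 2 * n * l" using \<open>g < 2 * n\<close> by (intro mult_right_mono) auto
  finally show ?thesis using capacity by linarith
qed

lemma small: "n < 2 ^ W" "l < 2 ^ W" "Suc l < 2 ^ W" "q < 2 ^ W" "2 * q < 2 ^ W" "T < 2 ^ W"
  "v < n \<Longrightarrow> v < 2 ^ W"
  using capacity n_pos by auto

text \<open>The product with l is formed by l repeated additions; these O(l) operations match the
  cost of one pass through a register.\<close>

definition address :: "nat \<Rightarrow> nat \<Rightarrow> nat \<Rightarrow> com" where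
  "address x v f = zero x ;; for_loop vi vl (plus x v ;; If_flag f (plus x vn) Skip)"

lemma wp_address:
  assumes "glob a" and x: "x < 32" "x \<notin> {1..8}" "x \<noteq> vi" and v: "v < 32" "v \<noteq> tmp" "v \<noteq> vi" "v \<noteq> x"
    and f: "35 \<le> f" "f < 40" and u: "nv a v < n"
    and post: "\<And>a'. frame {tmp, vi, x} {carry_flag} a a' \<Longrightarrow> ct a' = ct a \<Longrightarrow>
       nv a' x = ((if fl a f then n else 0) + nv a v) * l \<Longrightarrow> clk a' \<le> clk a + 20 * l + 20 \<Longrightarrow> Q a'"
  shows "wp (address x v f) Q a"
proof -
  let ?g = "(if fl a f then n else 0) + nv a v"
  have g: "?g < 2 * n" using u by auto
  define I where "I j b \<longleftrightarrow> frame {tmp, vi, x} {carry_flag} a b \<and> ct b = ct a \<and> nv b x = j * ?g" for j b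
  have I_glob: "glob b" if "I j b" for j b
    using that x unfolding I_def by (auto intro: glob_frame[OF assms(1)])
  have start: "I 0 (a\<lparr>nv := (nv a)(x := 0), clk := k\<rparr>)" for k
    by (simp add: I_def frame_def)
  have "wp (for_loop vi vl (plus x v ;; If_flag f (plus x vn) Skip)) Q (a\<lparr>nv := (nv a)(x := 0), clk := clk a + 1\<rparr>)"
  proof (rule wp_for_loop[where I = I and N = l and c = "\<lambda>_. 5"])
    fix j b assume j: "j < l" and I: "I j b" "nv b vi = j"
    have nb: "nv b v = nv a v" "fl b f = fl a f" "nv b vn = n"
      using I v f I_glob[OF I(1)] by (auto simp: I_def frame_nv frame_fl glob_def)
    have "j * ?g + ?g \<le> l * (2 * n)"
      using mult_le_mono[of "Suc j" l "?g" "2 * n"] j g by simp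
    then have bound: "j * ?g + ?g < 2 ^ W" using capacity by (simp add: mult_ac)
    have Ib: "nv b x = j * ?g" "frame {tmp, vi, x} {carry_flag} a b" "ct b = ct a"
      using I by (simp_all add: I_def)
    show "wp (plus x v ;; If_flag f (plus x vn) Skip) (\<lambda>a'. I (Suc j) a' \<and> nv a' vi = j \<and> clk a' \<le> clk b + 5) b"
      using x v f nb bound I(2) Ib
      by (intro wp_Seq wp_plus wp_If_flag wp_Skip)
         (auto simp: I_def frame_def split: if_splits)
  next
    show "I j b \<Longrightarrow> frame {tmp, vi} {carry_flag} b b' \<Longrightarrow> ct b' = ct b \<Longrightarrow> I j b'" for j b b'
      using x unfolding I_def by (auto intro: frame_trans simp: frame_nv)
  next
    fix b assume "I l b" "clk b \<le> clk (a\<lparr>nv := (nv a)(x := 0), clk := clk a + 1\<rparr>) + (\<Sum>j<l. 5 + 9) + 8"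
    then show "Q b" by (intro post) (auto simp: I_def mult.commute)
  qed (use x small start I_glob globD in auto)
  then show ?thesis
    unfolding address_def using x by (intro wp_Seq wp_zero) auto
qed

definition reg_not :: com where
  "reg_not = copy vax vbx ;; for_loop vi vl (Instr (CatRead vax fx) ;;
     If_flag fx (set_flag fx False) (set_flag fx True) ;; Instr (CatWrite vax fx) ;; inc vax)"

lemma wp_reg_not:
  assumes "glob a" and g: "nv a vbx = g * l" "g < 2 * n" and X: "ct a = stored X" "X g < 2 ^ l"
    and post: "\<And>a'. frame {tmp, vi, vax} {carry_flag, fx} a a' \<Longrightarrow>
       ct a' = stored (X(g := 2 ^ l - 1 - X g)) \<Longrightarrow> clk a' \<le> clk a + 20 * l + 20 \<Longrightarrow> Q a'"
  shows "wp reg_not Q a"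
proof -
  let ?b = "bit (2 ^ l - 1 - X g)"
  let ?B = "\<lambda>j. (\<lambda>h. bit (X h))(g := \<lambda>i. if i < j then ?b i else bit (X g) i)"
  define I where "I j b \<longleftrightarrow> frame {tmp, vi, vax} {carry_flag, fx} a b \<and> ct b = regs n l cat (?B j) \<and>
      nv b vax = g * l + j" for j b
  have B0: "regs n l cat (?B 0) = stored X"
    by (auto simp: stored_def intro!: regs_cong split: if_splits)
  have I_glob: "glob b" if "I j b" for j b
    using that unfolding I_def by (auto intro: glob_frame[OF assms(1)])
  have "wp (for_loop vi vl (Instr (CatRead vax fx) ;;
     If_flag fx (set_flag fx False) (set_flag fx True) ;; Instr (CatWrite vax fx) ;; inc vax)) Q
     (a\<lparr>nv := (nv a)(vax := g * l), fl := (fl a)(carry_flag := False), clk := k\<rparr>)" if k: "k \<le> clk a + 3" for k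
  proof (rule wp_for_loop[where I = I and N = l and c = "\<lambda>_. 6"])
    fix j b assume j: "j < l" and I: "I j b" "nv b vi = j"
    have Ib: "frame {tmp, vi, vax} {carry_flag, fx} a b" "ct b = regs n l cat (?B j)" "nv b vax = g * l + j"
      using I by (simp_all add: I_def)
    have rd: "ct b ! (g * l + j) = bit (X g) j"
      unfolding Ib(2) using g(2) j length_cat by (simp add: nth_regs)
    have wr: "(regs n l cat (?B j))[g * l + j := z] = regs n l cat (?B (Suc j))" if "z = ?b j" for z
      unfolding regs_update[OF g(2) j length_cat] that
      by (rule arg_cong[where f = "regs n l cat"]) (auto simp: fun_eq_iff less_Suc_eq)
    have bj: "?b j = (\<not> bit (X g) j)" using bit_complement[OF X(2)] j by simp
    have bounds: "g * l + j < length cat" "g * l + j < 2 ^ W" "Suc (g * l + j) < 2 ^ W"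
      using register_address[OF g(2) j] length_cat address_less[OF g(2) j] by auto
    show "wp (Instr (CatRead vax fx) ;; If_flag fx (set_flag fx False) (set_flag fx True) ;;
        Instr (CatWrite vax fx) ;; inc vax) (\<lambda>a'. I (Suc j) a' \<and> nv a' vi = j \<and> clk a' \<le> clk b + 6) b"
      using bounds I(2) Ib rd wr[of True] wr[of False] bj globD[OF I_glob[OF I(1)]]
      by (intro wp_Seq wp_CatRead wp_CatWrite wp_inc wp_If_flag wp_set_flag)
         (simp_all add: I_def frame_def)
  next
    show "I j b \<Longrightarrow> frame {tmp, vi} {carry_flag} b b' \<Longrightarrow> ct b' = ct b \<Longrightarrow> I j b'" for j b b'
      unfolding I_def by (auto intro: frame_trans simp: frame_nv)
  next
    show "I 0 (a\<lparr>nv := (nv a)(vax := g * l), fl := (fl a)(carry_flag := False), clk := k\<rparr>)"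
      using X(1) B0 by (simp add: I_def frame_def)
  next
    fix b assume b: "I l b" "clk b \<le> clk (a\<lparr>nv := (nv a)(vax := g * l), fl := (fl a)(carry_flag := False), clk := k\<rparr>)
      + (\<Sum>j<l. 6 + 9) + 8"
    have "regs n l cat (?B l) = stored (X(g := 2 ^ l - 1 - X g))"
      unfolding stored_def by (rule regs_cong) auto
    then have "ct b = stored (X(g := 2 ^ l - 1 - X g))"
      using b(1) unfolding I_def by (simp only:)
    then show "Q b" using b k by (intro post) (auto simp: I_def)
  qed (use small I_glob globD in auto)
  then show ?thesis
    unfolding reg_not_def using g address_le[OF g(2), of 0]
    by (intro wp_Seq wp_copy) auto
qed

text \<open>Both registers stream through two flags and the carry stays in \<open>fg\<close>, which
  finally shows the overflow; no work tape ever holds a register.\<close>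

definition reg_add :: com where
  "reg_add = copy vax vbx ;; copy vay vby ;; set_flag fg False ;; for_loop vi vl (
     Instr (CatRead vax fx) ;; Instr (CatRead vay fy) ;; full_adder fx fy fg ;;
     Instr (CatWrite vax fx) ;; inc vax ;; inc vay)"

lemma wp_reg_add:
  assumes "glob a" and g: "nv a vbx = g * l" "g < 2 * n" and h: "nv a vby = h * l" "h < 2 * n" "g \<noteq> h"
    and X: "ct a = stored X" "X g < 2 ^ l" "X h < 2 ^ l"
    and post: "\<And>a'. frame {tmp, vi, vax, vay, vrr} {carry_flag, fx, fy, fg} a a' \<Longrightarrow>
       ct a' = stored (X(g := (X g + X h) mod 2 ^ l)) \<Longrightarrow> (fl a' fg \<longleftrightarrow> 2 ^ l \<le> X g + X h) \<Longrightarrow>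
       clk a' \<le> clk a + 20 * l + 20 \<Longrightarrow> Q a'"
  shows "wp reg_add Q a"
proof -
  let ?B = "\<lambda>j. (\<lambda>h. bit (X h))(g := \<lambda>i. if i < j then bit (X g + X h) i else bit (X g) i)"
  let ?c = "carry (X g) (X h) False"
  let ?V = "{tmp, vi, vax, vay, vrr}" and ?F = "{carry_flag, fx, fy, fg}"
  define I where "I j b \<longleftrightarrow> frame ?V ?F a b \<and> ct b = regs n l cat (?B j) \<and>
      nv b vax = g * l + j \<and> nv b vay = h * l + j \<and> fl b fg = ?c j" for j b
  have B0: "regs n l cat (?B 0) = stored X"
    by (auto simp: stored_def intro!: regs_cong split: if_splits)
  have I_glob: "glob b" if "I j b" for j b
    using that unfolding I_def by (auto intro: glob_frame[OF assms(1)])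
  let ?a = "\<lambda>k. a\<lparr>nv := (nv a)(vax := g * l, vay := h * l), fl := (fl a)(carry_flag := False, fg := False), clk := k\<rparr>"
  have "wp (for_loop vi vl (
     Instr (CatRead vax fx) ;; Instr (CatRead vay fy) ;; full_adder fx fy fg ;;
     Instr (CatWrite vax fx) ;; inc vax ;; inc vay)) Q (?a k)" if k: "k \<le> clk a + 7" for k
  proof (rule wp_for_loop[where I = I and N = l and c = "\<lambda>_. 8"])
    fix j b assume j: "j < l" and I: "I j b" "nv b vi = j"
    have Ib: "frame ?V ?F a b" "ct b = regs n l cat (?B j)" "nv b vax = g * l + j" "nv b vay = h * l + j" "fl b fg = ?c j"
      using I by (simp_all add: I_def)
    have rd: "ct b ! (g * l + j) = bit (X g) j" "ct b ! (h * l + j) = bit (X h) j"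
      unfolding Ib(2) using g(2) h j length_cat by (simp_all add: nth_regs)
    have bj: "(bit (X g) j \<noteq> (bit (X h) j \<noteq> ?c j)) = bit (X g + X h) j"
      using bit_add_carry[of "X g" "X h" False j] by simp
    have wr: "(ct b)[g * l + j := bit (X g) j \<noteq> (bit (X h) j \<noteq> ?c j)] = regs n l cat (?B (Suc j))"
      unfolding Ib(2) regs_update[OF g(2) j length_cat] bj
      by (rule arg_cong[where f = "regs n l cat"]) (auto simp: fun_eq_iff less_Suc_eq)
    have length_ct: "length (ct b) = length cat" by (simp add: Ib(2))
    have cj: "(bit (X g) j \<and> bit (X h) j \<or> bit (X g) j \<and> ?c j \<or> bit (X h) j \<and> ?c j) = ?c (Suc j)"
      unfolding carry_Suc by blast
    have bounds: "g * l + j < length cat" "g * l + j < 2 ^ W" "Suc (g * l + j) < 2 ^ W"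
      "h * l + j < length cat" "h * l + j < 2 ^ W" "Suc (h * l + j) < 2 ^ W"
      using register_address[OF g(2) j] register_address[OF h(2) j] length_cat
        address_less[OF g(2) j] address_less[OF h(2) j] by auto
    show "wp (Instr (CatRead vax fx) ;; Instr (CatRead vay fy) ;; full_adder fx fy fg ;;
       Instr (CatWrite vax fx) ;; inc vax ;; inc vay) (\<lambda>a'. I (Suc j) a' \<and> nv a' vi = j \<and> clk a' \<le> clk b + 8) b"
      using bounds I(2) Ib(1,3-5) rd cj wr globD[OF I_glob[OF I(1)]] length_ct
      by (intro wp_Seq wp_CatRead wp_CatWrite wp_inc wp_full_adder) (simp_all add: I_def frame_def)
  next
    show "I j b \<Longrightarrow> frame {tmp, vi} {carry_flag} b b' \<Longrightarrow> ct b' = ct b \<Longrightarrow> I j b'" for j b b'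
      unfolding I_def by (auto intro: frame_trans simp: frame_nv frame_fl)
  next
    show "I 0 (?a k)"
      using X(1) B0 by (simp add: I_def frame_def)
  next
    fix b assume b: "I l b" "clk b \<le> clk (?a k) + (\<Sum>j<l. 8 + 9) + 8"
    have "regs n l cat (?B l) = stored (X(g := (X g + X h) mod 2 ^ l))"
      unfolding stored_def by (rule regs_cong) (auto simp: bit_take_bit_iff simp flip: take_bit_eq_mod)
    then have "ct b = stored (X(g := (X g + X h) mod 2 ^ l))"
      using b(1) unfolding I_def by (simp only:)
    moreover have "fl b fg \<longleftrightarrow> 2 ^ l \<le> X g + X h"
      using b(1) carry_whole[OF X(2,3), of False] by (simp add: I_def)
    ultimately show "Q b" using b k by (intro post) (auto simp: I_def)
  qed (use small I_glob globD in auto)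
  then show ?thesis
    unfolding reg_add_def using g h address_le[OF g(2), of 0] address_le[OF h(2), of 0]
    by (intro wp_Seq wp_copy wp_set_flag) auto
qed

text \<open>The summand is consumed from the copy \<open>vrr\<close>: each halving delivers its next
  digit, in the order in which the addition needs them.\<close>

definition reg_add_tape :: "nat \<Rightarrow> com" where
  "reg_add_tape y = copy vax vbx ;; copy vrr y ;; set_flag fg False ;; for_loop vi vl (
     Instr (CatRead vax fx) ;; halve vrr fy ;; full_adder fx fy fg ;;
     Instr (CatWrite vax fx) ;; inc vax)"

lemma wp_reg_add_tape:
  assumes "glob a" and g: "nv a vbx = g * l" "g < 2 * n" and y: "y < 32" "y \<noteq> vrr" "y \<noteq> vax" "nv a y < 2 ^ W"
    and X: "ct a = stored X" "X g < 2 ^ l" "nv a y < 2 ^ l"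
    and post: "\<And>a'. frame {tmp, vi, vax, vay, vrr} {carry_flag, fx, fy, fg} a a' \<Longrightarrow>
       ct a' = stored (X(g := (X g + nv a y) mod 2 ^ l)) \<Longrightarrow> (fl a' fg \<longleftrightarrow> 2 ^ l \<le> X g + nv a y) \<Longrightarrow>
       clk a' \<le> clk a + 20 * l + 20 \<Longrightarrow> Q a'"
  shows "wp (reg_add_tape y) Q a"
proof -
  define z where "z = nv a y"
  let ?B = "\<lambda>j. (\<lambda>h. bit (X h))(g := \<lambda>i. if i < j then bit (X g + z) i else bit (X g) i)"
  let ?c = "carry (X g) z False"
  let ?V = "{tmp, vi, vax, vay, vrr}" and ?F = "{carry_flag, fx, fy, fg}"
  define I where "I j b \<longleftrightarrow> frame ?V ?F a b \<and> ct b = regs n l cat (?B j) \<and>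
      nv b vax = g * l + j \<and> nv b vrr = z div 2 ^ j \<and> fl b fg = ?c j" for j b
  have B0: "regs n l cat (?B 0) = stored X"
    by (auto simp: stored_def intro!: regs_cong split: if_splits)
  have I_glob: "glob b" if "I j b" for j b
    using that unfolding I_def by (auto intro: glob_frame[OF assms(1)])
  let ?a = "\<lambda>k. a\<lparr>nv := (nv a)(vax := g * l, vrr := z), fl := (fl a)(carry_flag := False, fg := False), clk := k\<rparr>"
  have "wp (for_loop vi vl (
     Instr (CatRead vax fx) ;; halve vrr fy ;; full_adder fx fy fg ;;
     Instr (CatWrite vax fx) ;; inc vax)) Q (?a k)" if k: "k \<le> clk a + 7" for k
  proof (rule wp_for_loop[where I = I and N = l and c = "\<lambda>_. 8"])
    fix j b assume j: "j < l" and I: "I j b" "nv b vi = j"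
    have Ib: "frame ?V ?F a b" "ct b = regs n l cat (?B j)" "nv b vax = g * l + j" "nv b vrr = z div 2 ^ j" "fl b fg = ?c j"
      using I by (simp_all add: I_def)
    have rd: "ct b ! (g * l + j) = bit (X g) j"
      unfolding Ib(2) using g(2) j length_cat by (simp_all add: nth_regs)
    have bj: "(bit (X g) j \<noteq> (bit z j \<noteq> ?c j)) = bit (X g + z) j"
      using bit_add_carry[of "X g" z False j] by simp
    have wr: "(ct b)[g * l + j := bit (X g) j \<noteq> (bit z j \<noteq> ?c j)] = regs n l cat (?B (Suc j))"
      unfolding Ib(2) regs_update[OF g(2) j length_cat] bj
      by (rule arg_cong[where f = "regs n l cat"]) (auto simp: fun_eq_iff less_Suc_eq)
    have length_ct: "length (ct b) = length cat" by (simp add: Ib(2))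
    have cj: "(bit (X g) j \<and> bit z j \<or> bit (X g) j \<and> ?c j \<or> bit z j \<and> ?c j) = ?c (Suc j)"
      unfolding carry_Suc by blast
    have half: "odd (z div 2 ^ j) = bit z j" "z div 2 ^ j div 2 = z div 2 ^ Suc j"
      by (simp_all only: bit_iff_odd power_Suc2 div_mult2_eq)
    have "z div 2 ^ j \<le> z" by simp
    then have bounds: "g * l + j < length cat" "g * l + j < 2 ^ W" "Suc (g * l + j) < 2 ^ W" "z div 2 ^ j < 2 ^ W"
      using register_address[OF g(2) j] length_cat address_less[OF g(2) j] y(4) unfolding z_def by linarith+
    show "wp (Instr (CatRead vax fx) ;; halve vrr fy ;; full_adder fx fy fg ;;
     Instr (CatWrite vax fx) ;; inc vax) (\<lambda>a'. I (Suc j) a' \<and> nv a' vi = j \<and> clk a' \<le> clk b + 8) b"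
      using bounds I(2) Ib(1,3-5) rd cj wr half globD[OF I_glob[OF I(1)]] length_ct
      by (intro wp_Seq wp_CatRead wp_CatWrite wp_inc wp_full_adder wp_halve) (simp_all add: I_def frame_def)
  next
    show "I j b \<Longrightarrow> frame {tmp, vi} {carry_flag} b b' \<Longrightarrow> ct b' = ct b \<Longrightarrow> I j b'" for j b b'
      unfolding I_def by (auto intro: frame_trans simp: frame_nv frame_fl)
  next
    show "I 0 (?a k)"
      using X(1) B0 by (simp add: I_def frame_def)
  next
    fix b assume b: "I l b" "clk b \<le> clk (?a k) + (\<Sum>j<l. 8 + 9) + 8"
    have "regs n l cat (?B l) = stored (X(g := (X g + z) mod 2 ^ l))"
      unfolding stored_def by (rule regs_cong) (auto simp: bit_take_bit_iff simp flip: take_bit_eq_mod)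
    then have "ct b = stored (X(g := (X g + z) mod 2 ^ l))"
      using b(1) unfolding I_def by (simp only:)
    moreover have "fl b fg \<longleftrightarrow> 2 ^ l \<le> X g + z"
      using b(1) carry_whole[OF X(2,3), of False] by (simp add: I_def z_def)
    ultimately show "Q b" using b k by (intro post) (auto simp: I_def z_def)
  qed (use small I_glob globD in auto)
  then show ?thesis
    unfolding reg_add_tape_def using g y address_le[OF g(2), of 0]
    by (intro wp_Seq wp_copy wp_set_flag) (auto simp: z_def)
qed

end

section \<open>Register arithmetic modulo \<open>N\<close>\<close>

context problem
begin

definition r :: nat where
  "r = 2 ^ l mod q"

text \<open>
  The largest multiple of \<open>q\<close> that does not exceed \<open>2 ^ l\<close>; a register is valid iff it is less than \<open>N\<close>.
  Work tapes can hold \<open>r\<close> but not \<open>N\<close>, so all reductions modulo \<open>N\<close> go through \<open>r\<close>.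
\<close>

definition N :: nat where
  "N = 2 ^ l - r"

lemma r_less: "r < 2 ^ l" "r < q"
  using q_pos q_le less_le_trans[OF mod_less_divisor[of q "2 ^ l"]] by (auto simp: r_def)

lemma N_r: "N + r = 2 ^ l"
  using r_less by (simp add: N_def)

lemma q_dvd_N: "q dvd N"
  unfolding N_def r_def by (rule dvd_minus_mod)

lemma N_pos: "0 < N"
  using r_less(1) by (simp add: N_def)

lemma q_le_N: "q \<le> N"
  using q_dvd_N N_pos by (rule dvd_imp_le)

definition ready :: "astate \<Rightarrow> bool" where
  "ready a \<longleftrightarrow> glob a \<and> nv a vr = r \<and> nv a vd = 1 mod q"

lemma ready_frame: "ready a \<Longrightarrow> frame V F a a' \<Longrightarrow> V \<inter> {1..7} = {} \<Longrightarrow> vr \<notin> V \<Longrightarrow> vd \<notin> V \<Longrightarrow> ready a'"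
  unfolding ready_def using glob_frame frame_nv by metis

lemma ready_glob: "ready a \<Longrightarrow> glob a"
  by (simp add: ready_def)

abbreviation (input) "scratch \<equiv> {tmp, vi, vax, vay, vrr}"
abbreviation (input) "scratch_flags \<equiv> {carry_flag, fx, fy, fg}"

text \<open>The two origins of a summand y, another register or a work tape. Abstracting from them
  allows modular addition and subtraction to be verified once for both.\<close>

definition source :: "com \<Rightarrow> nat \<Rightarrow> nat \<Rightarrow> astate \<Rightarrow> (nat \<Rightarrow> nat) \<Rightarrow> bool" where
  "source A g y a X \<longleftrightarrow>
     A = reg_add \<and> (\<exists>h<2 * n. nv a vby = h * l \<and> g \<noteq> h \<and> X h = y) \<or>
     (\<exists>v\<in>{vr, vd}. A = reg_add_tape v \<and> nv a v = y)"

lemma source_frame: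
  "source A g y a X \<Longrightarrow> frame V F a a' \<Longrightarrow> V \<inter> {vby, vr, vd} = {} \<Longrightarrow> source A g y a' (X(g := z))"
  unfolding source_def by (auto simp: frame_nv)

lemma wp_source:
  assumes "ready a" and g: "nv a vbx = g * l" "g < 2 * n" and y: "source A g y a X" "y < 2 ^ l" "\<And>g. g < 2 * n \<Longrightarrow> X g < 2 ^ l"
    and X: "ct a = stored X"
    and post: "\<And>a'. frame scratch scratch_flags a a' \<Longrightarrow>
       ct a' = stored (X(g := (X g + y) mod 2 ^ l)) \<Longrightarrow> (fl a' fg \<longleftrightarrow> 2 ^ l \<le> X g + y) \<Longrightarrow>
       clk a' \<le> clk a + 20 * l + 20 \<Longrightarrow> Q a'"
  shows "wp A Q a"
proof -
  have "nv a vr < q" "nv a vd < q"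
    using assms(1) r_less q_pos by (simp_all add: ready_def)
  then have "nv a vr < 2 ^ W" "nv a vd < 2 ^ W"
    using small by auto
  moreover have "nv a vr < 2 ^ l" "nv a vd < 2 ^ l"
    using \<open>nv a vr < q\<close> \<open>nv a vd < q\<close> q_le by simp_all
  ultimately show ?thesis
    using y(1) assms(1) unfolding source_def
    by (auto intro!: wp_reg_add wp_reg_add_tape ready_glob g X y(2,3) intro: post simp: y(2)[simplified])
qed

lemma wp_add_r:
  assumes "ready a" "nv a vbx = g * l" "g < 2 * n" "ct a = stored X" "\<And>g. g < 2 * n \<Longrightarrow> X g < 2 ^ l"
    and "X g + r < 2 ^ l"
    and post: "\<And>a'. frame scratch scratch_flags a a' \<Longrightarrow>
       ct a' = stored (X(g := X g + r)) \<Longrightarrow> clk a' \<le> clk a + 20 * l + 20 \<Longrightarrow> Q a'"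
  shows "wp (reg_add_tape vr) Q a"
proof (rule wp_source[where y = r])
  show "source (reg_add_tape vr) g r a X" using assms(1) by (simp add: source_def ready_def)
qed (use assms r_less in auto)

lemma wp_reg_complement:
  assumes "ready a" "nv a vbx = g * l" "g < 2 * n" "ct a = stored X" "\<And>g. g < 2 * n \<Longrightarrow> X g < 2 ^ l"
    and post: "\<And>a'. frame scratch scratch_flags a a' \<Longrightarrow> (fl a' fg \<longleftrightarrow> fl a fg) \<Longrightarrow>
       ct a' = stored (X(g := 2 ^ l - 1 - X g)) \<Longrightarrow> clk a' \<le> clk a + 20 * l + 20 \<Longrightarrow> Q a'"
  shows "wp reg_not Q a"
  using assms(1-5)
  by (intro wp_reg_not[where X = X and g = g] ready_glob post)
     (auto simp: frame_fl intro: frame_trans[OF frame_refl])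

text \<open>Once \<open>r\<close> has been added to the register, adding \<open>y\<close> overflows \<open>l\<close> bits iff \<open>N \<le> X g + y\<close>.\<close>

definition add_mod :: "com \<Rightarrow> com" where
  "add_mod A = reg_add_tape vr ;; A ;; If_flag fg Skip (reg_not ;; reg_add_tape vr ;; reg_not)"

text \<open>The longer branch has five register operations of \<open>20 * l + 20\<close> ticks and
  one test, hence the factor 101.\<close>

lemma wp_add_mod:
  assumes a: "ready a" "nv a vbx = g * l" "g < 2 * n" "ct a = stored X"
    and X: "\<And>g. g < 2 * n \<Longrightarrow> X g < N" and y: "source A g y a X" "y < N"
    and post: "\<And>a'. frame scratch scratch_flags a a' \<Longrightarrow>
       ct a' = stored (X(g := (X g + y) mod N)) \<Longrightarrow> clk a' \<le> clk a + 101 * (l + 1) \<Longrightarrow> Q a'"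
  shows "wp (add_mod A) Q a"
proof -
  have fr: "ready b \<and> nv b vbx = g * l" if "frame scratch scratch_flags a b" for b
    using that a ready_frame[OF a(1) that] by (simp add: frame_nv)
  have Xl: "h < 2 * n \<Longrightarrow> X h < 2 ^ l" for h
    using X[of h] N_r by linarith
  have Xg: "X g < N" using X a(3) by blast
  show ?thesis
    unfolding add_mod_def
  proof (intro wp_Seq, rule wp_add_r[where g = g and X = X])
    fix b assume b: "frame scratch scratch_flags a b" "ct b = stored (X(g := X g + r))" "clk b \<le> clk a + 20 * l + 20"
    show "wp (A ;; If_flag fg Skip (reg_not ;; reg_add_tape vr ;; reg_not)) Q b"
    proof (rule wp_Seq, rule wp_source[where g = g and y = y and X = "X(g := X g + r)"])
      fix c assume c: "frame scratch scratch_flags b c" "fl c fg \<longleftrightarrow> 2 ^ l \<le> (X(g := X g + r)) g + y"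
        "ct c = stored (X(g := X g + r, g := ((X(g := X g + r)) g + y) mod 2 ^ l))" "clk c \<le> clk b + 20 * l + 20"
      have ac: "frame scratch scratch_flags a c"
        using b(1) c(1) by (rule frame_trans) auto
      show "wp (If_flag fg Skip (reg_not ;; reg_add_tape vr ;; reg_not)) Q c"
      proof (rule wp_If_flag)
        assume "fl c fg"
        then have ge: "N \<le> X g + y" using c(2) N_r by simp
        \<comment> \<open>Losing \<open>2 ^ l = N + r\<close> removes the r added in advance
          together with one N.\<close>
        then have "(X g + r + y) mod 2 ^ l = X g + y - N"
          using Xg y(2) N_r by (subst le_mod_geq) auto
        moreover have "(X g + y) mod N = X g + y - N"
          using ge Xg y(2) by (subst le_mod_geq) auto
        ultimately show "wp Skip Q (c\<lparr>clk := clk c + 1\<rparr>)"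
          using ac b c by (intro wp_Skip post) (auto simp: frame_def)
      next
        assume "\<not> fl c fg"
        then have lt: "X g + r + y < 2 ^ l" using c(2) by simp
        then have ct: "ct c = stored (X(g := X g + r + y))" using c(3) by simp
        have sum: "(X g + y) mod N = X g + y" using lt N_r by simp
        have len: "h < 2 * n \<Longrightarrow> (X(g := z)) h < 2 ^ l" if "z < 2 ^ l" for h z
          using that Xl by simp
        \<comment> \<open>No reduction is due, so r has to be taken back: adding between two
          complements subtracts.\<close>
        show "wp (reg_not ;; reg_add_tape vr ;; reg_not) Q (c\<lparr>clk := clk c + 1\<rparr>)"
        proof (intro wp_Seq, rule wp_reg_complement[where g = g and X = "X(g := X g + r + y)"])
          fix d assume d: "frame scratch scratch_flags (c\<lparr>clk := clk c + 1\<rparr>) d"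
            "ct d = stored (X(g := X g + r + y, g := 2 ^ l - 1 - (X(g := X g + r + y)) g))"
            "clk d \<le> clk (c\<lparr>clk := clk c + 1\<rparr>) + 20 * l + 20"
          have ad: "frame scratch scratch_flags a d"
            using ac d(1) by (auto simp: frame_def agree_def)
          show "wp (reg_add_tape vr ;; reg_not) Q d"
          proof (rule wp_Seq, rule wp_add_r[where g = g and X = "X(g := 2 ^ l - 1 - (X g + r + y))"])
            fix e assume e: "frame scratch scratch_flags d e" "clk e \<le> clk d + 20 * l + 20"
              "ct e = stored (X(g := 2 ^ l - 1 - (X g + r + y), g := (X(g := 2 ^ l - 1 - (X g + r + y))) g + r))"
            have ae: "frame scratch scratch_flags a e"
              using ad e(1) by (rule frame_trans) auto
            show "wp reg_not Q e"
            proof (rule wp_reg_complement[where g = g and X = "X(g := 2 ^ l - 1 - (X g + r + y) + r)"])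
              fix h assume h: "frame scratch scratch_flags e h" "clk h \<le> clk e + 20 * l + 20"
                "ct h = stored (X(g := 2 ^ l - 1 - (X g + r + y) + r,
                    g := 2 ^ l - 1 - (X(g := 2 ^ l - 1 - (X g + r + y) + r)) g))"
              have "frame scratch scratch_flags a h"
                using ae h(1) by (rule frame_trans) auto
              moreover have "2 ^ l - 1 - (2 ^ l - 1 - (X g + r + y) + r) = X g + y"
                using lt by linarith
              ultimately show "Q h"
                using h b(3) c(4) d(3) e(2) by (intro post) (auto simp: sum)
            qed (use a(3) fr[OF ae] e lt len in auto)
          qed (use a(3) fr[OF ad] d lt len in auto)
        qed (use a(3) fr[OF ac] ct lt len in \<open>auto simp: ready_def glob_def\<close>)
      qed auto
    qed (use a(3) fr[OF b(1)] b Xl Xg N_r y source_frame[OF y(1) b(1)] in auto)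
  qed (use a Xl Xg N_r in auto)
qed

text \<open>
  Adding \<open>y\<close> to the complement of the register overflows iff \<open>X g < y\<close>.  Losing the overflow subtracts
  \<open>2 ^ l\<close> instead of \<open>N\<close>; adding \<open>r\<close> makes up for it.
\<close>

definition sub_mod :: "com \<Rightarrow> com" where
  "sub_mod A = reg_not ;; A ;; If_flag fg (reg_add_tape vr) Skip ;; reg_not"

lemma wp_sub_mod:
  assumes a: "ready a" "nv a vbx = g * l" "g < 2 * n" "ct a = stored X"
    and X: "\<And>g. g < 2 * n \<Longrightarrow> X g < N" and y: "source A g y a X" "y < N"
    and post: "\<And>a'. frame scratch scratch_flags a a' \<Longrightarrow>
       ct a' = stored (X(g := (X g + (N - y)) mod N)) \<Longrightarrow> clk a' \<le> clk a + 101 * (l + 1) \<Longrightarrow> Q a'"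
  shows "wp (sub_mod A) Q a"
proof -
  have fr: "ready b \<and> nv b vbx = g * l" if "frame scratch scratch_flags a b" for b
    using that a ready_frame[OF a(1) that] by (simp add: frame_nv)
  have Xl: "h < 2 * n \<Longrightarrow> X h < 2 ^ l" for h
    using X[of h] N_r by linarith
  have Xg: "X g < N" using X a(3) by blast
  have len: "h < 2 * n \<Longrightarrow> (X(g := z)) h < 2 ^ l" if "z < 2 ^ l" for h z
    using that Xl by simp
  \<comment> \<open>Both branches finish with the same complement; z is the complement of the
    desired result.\<close>
  have fin: "wp reg_not Q c" if c: "frame scratch scratch_flags a c" "ct c = stored (X(g := z))"
      "z < 2 ^ l" "2 ^ l - 1 - z = (X g + (N - y)) mod N" "clk c \<le> clk a + 61 * (l + 1)" for c z
  proof (rule wp_reg_complement[where g = g and X = "X(g := z)"])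
    fix d assume d: "frame scratch scratch_flags c d" "ct d = stored (X(g := z, g := 2 ^ l - 1 - (X(g := z)) g))"
      "clk d \<le> clk c + 20 * l + 20"
    have "frame scratch scratch_flags a d"
      using c(1) d(1) by (rule frame_trans) auto
    then show "Q d" using d c(4,5) by (intro post) auto
  qed (use a(3) fr[OF c(1)] c len in auto)
  show ?thesis
    unfolding sub_mod_def
  proof (intro wp_Seq, rule wp_reg_complement[where g = g and X = X])
    fix b assume b: "frame scratch scratch_flags a b" "ct b = stored (X(g := 2 ^ l - 1 - X g))" "clk b \<le> clk a + 20 * l + 20"
    show "wp (A ;; If_flag fg (reg_add_tape vr) Skip ;; reg_not) Q b"
    proof (rule wp_Seq, rule wp_source[where g = g and y = y and X = "X(g := 2 ^ l - 1 - X g)"])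
      fix c assume c: "frame scratch scratch_flags b c" "fl c fg \<longleftrightarrow> 2 ^ l \<le> (X(g := 2 ^ l - 1 - X g)) g + y"
        "ct c = stored (X(g := 2 ^ l - 1 - X g, g := ((X(g := 2 ^ l - 1 - X g)) g + y) mod 2 ^ l))"
        "clk c \<le> clk b + 20 * l + 20"
      have ac: "frame scratch scratch_flags a c"
        using b(1) c(1) by (rule frame_trans) auto
      have flag: "fl c fg \<longleftrightarrow> X g < y" using c(2) Xl[OF a(3)] by auto
      show "wp (If_flag fg (reg_add_tape vr) Skip ;; reg_not) Q c"
      proof (rule wp_Seq, rule wp_If_flag)
        assume "fl c fg"
        then have lt: "X g < y" using flag by simp
        \<comment> \<open>As \<open>X g < y\<close>, the truncated difference is exact; it is what
          remains after the overflow is lost.\<close>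
        have "2 ^ l - 1 - X g + y = (y - 1 - X g) + 2 ^ l" using lt Xl[OF a(3)] by linarith
        then have "(2 ^ l - 1 - X g + y) mod 2 ^ l = (y - 1 - X g) mod 2 ^ l" by simp
        also have "\<dots> = y - 1 - X g" using y(2) N_r by (intro mod_less) linarith
        finally have ct: "ct c = stored (X(g := y - 1 - X g))" using c(3) by simp
        have ct': "ct (c\<lparr>clk := clk c + 1\<rparr>) = stored (X(g := y - 1 - X g))" using ct by simp
        have small: "y - 1 - X g + r < 2 ^ l" using y(2) N_r by linarith
        have ac': "frame scratch scratch_flags a (c\<lparr>clk := clk c + 1\<rparr>)" using ac by (simp add: frame_def)
        have val: "2 ^ l - 1 - (y - 1 - X g + r) = (X g + (N - y)) mod N"
          using lt y(2) N_r by (subst mod_less) linarith+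
        show "wp (reg_add_tape vr) (wp reg_not Q) (c\<lparr>clk := clk c + 1\<rparr>)"
        proof (rule wp_add_r[where g = g and X = "X(g := y - 1 - X g)"])
          fix d assume d: "frame scratch scratch_flags (c\<lparr>clk := clk c + 1\<rparr>) d"
            "ct d = stored (X(g := y - 1 - X g, g := (X(g := y - 1 - X g)) g + r))"
            "clk d \<le> clk (c\<lparr>clk := clk c + 1\<rparr>) + 20 * l + 20"
          have "frame scratch scratch_flags a d"
            using ac' d(1) by (rule frame_trans) auto
          then show "wp reg_not Q d"
            using d small val b(3) c(4) by (intro fin[where z = "y - 1 - X g + r"]) auto
        qed (use a(3) fr[OF ac'] ct' small len in auto)
      next
        assume "\<not> fl c fg"
        then have le: "y \<le> X g" using flag by simp
        have z: "2 ^ l - 1 - X g + y < 2 ^ l" using le Xl[OF a(3)] by linarith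
        have "X g + (N - y) = X g - y + N" using le y(2) by linarith
        then have "(X g + (N - y)) mod N = X g - y" using Xg by (simp only: mod_add_self2) simp
        then have val: "2 ^ l - 1 - (2 ^ l - 1 - X g + y) = (X g + (N - y)) mod N"
          using le Xl[OF a(3)] by linarith
        have "ct c = stored (X(g := 2 ^ l - 1 - X g + y))" using c(3) z by simp
        then show "wp Skip (wp reg_not Q) (c\<lparr>clk := clk c + 1\<rparr>)"
          using ac z val b(3) c(4)
          by (intro wp_Skip fin[where z = "2 ^ l - 1 - X g + y"]) (auto simp: frame_def)
      qed auto
    qed (use a(3) fr[OF b(1)] b Xl Xg N_r y source_frame[OF y(1) b(1)] in auto)
  qed (use a Xl Xg N_r in auto)
qed

end

section \<open>Adding the adjacency matrix times one layer to the other layer\<close>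

context problem
begin

definition valid :: "(nat \<Rightarrow> nat) \<Rightarrow> bool" where
  "valid X \<longleftrightarrow> (\<forall>g<2 * n. X g < N)"

definition acc :: "bool \<Rightarrow> (nat \<Rightarrow> nat) \<Rightarrow> nat \<Rightarrow> nat \<Rightarrow> nat \<Rightarrow> nat" where
  "acc b X g y = X(g := (X g + (if b then N - y else y)) mod N)"

lemma valid_acc: "valid X \<Longrightarrow> valid (acc b X g y)"
  using N_pos by (simp add: valid_def acc_def)

text \<open>Register \<open>R(\<sigma>, v)\<close> has number \<open>idx \<sigma> v\<close> on the tape.\<close>

definition idx :: "bool \<Rightarrow> nat \<Rightarrow> nat" where
  "idx c v = (if c then n else 0) + v"

lemma idx_less: "v < n \<Longrightarrow> idx c v < 2 * n"
  by (simp add: idx_def)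

lemma idx_neq: "v < n \<Longrightarrow> u < n \<Longrightarrow> idx c v \<noteq> idx (\<not> c) u"
  by (simp add: idx_def)

definition edge :: com where
  "edge = If_flag backward (sub_mod reg_add) (add_mod reg_add)"

lemma wp_edge:
  assumes a: "ready a" "nv a vbx = g * l" "g < 2 * n" "nv a vby = h * l" "h < 2 * n" "g \<noteq> h" "ct a = stored X" "valid X"
    and post: "\<And>a'. frame scratch scratch_flags a a' \<Longrightarrow>
       ct a' = stored (acc (fl a backward) X g (X h)) \<Longrightarrow> clk a' \<le> clk a + 102 * (l + 1) \<Longrightarrow> Q a'"
  shows "wp edge Q a"
proof -
  let ?a = "a\<lparr>clk := clk a + 1\<rparr>"
  have s: "source reg_add g (X h) ?a X" "X h < N" "\<And>g. g < 2 * n \<Longrightarrow> X g < N"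
    using a by (auto simp: source_def valid_def)
  have R: "ready ?a" using a(1) by (simp add: ready_def glob_def)
  have P: "Q b" if "frame scratch scratch_flags ?a b" "ct b = stored (acc (fl a backward) X g (X h))"
    "clk b \<le> clk ?a + 101 * (l + 1)" for b
    using that by (intro post) (auto simp: frame_def)
  show ?thesis
    unfolding edge_def
  proof (rule wp_If_flag)
    assume "fl a backward"
    then show "wp (sub_mod reg_add) Q ?a"
      using a s R P by (intro wp_sub_mod[where X = X and y = "X h" and g = g]) (auto simp: acc_def)
  next
    assume "\<not> fl a backward"
    then show "wp (add_mod reg_add) Q ?a"
      using a s R P by (intro wp_add_mod[where X = X and y = "X h" and g = g]) (auto simp: acc_def)
  qed auto
qed

definition flip :: "nat \<Rightarrow> com" where
  "flip f = If_flag f (set_flag f False) (set_flag f True)"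

lemma wp_flip:
  assumes "34 \<le> f" "f < 40"
    "\<And>k. k \<le> clk a + 2 \<Longrightarrow> Q (a\<lparr>fl := (fl a)(f := \<not> fl a f), clk := k\<rparr>)"
  shows "wp (flip f) Q a"
  unfolding flip_def
  by (intro wp_If_flag wp_set_flag) (use assms in simp_all)

text \<open>The source register belongs to the other layer, so the flag is inverted just for the
  computation of its address.\<close>

definition neighbor :: com where
  "neighbor = in_neighbor vv vj vu ;; flip layer ;; address vby vu layer ;; flip layer ;; edge"

lemma wp_neighbor:
  assumes a: "ready a" "nv a vv = v" "v < n" "nv a vj = j" "j < length (in_nbrs orc v)"
      "nv a vbx = idx (fl a layer) v * l" "ct a = stored X" "valid X"
    and post: "\<And>a'. frame {tmp, vi, vax, vay, vrr, vu, vby} scratch_flags a a' \<Longrightarrow>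
       ct a' = stored (acc (fl a backward) X (idx (fl a layer) v) (X (idx (\<not> fl a layer) (in_nbrs orc v ! j)))) \<Longrightarrow>
       clk a' \<le> clk a + 130 * (l + 1) \<Longrightarrow> Q a'"
  shows "wp neighbor Q a"
proof -
  let ?u = "in_nbrs orc v ! j"
  have u: "?u < n" using in_nbrs_less[OF a(3)] a(5) by (meson lessThan_iff nth_mem subsetD)
  have j: "j < n" using in_nbrs_less[OF a(3)] a(5) by simp
  let ?b = "\<lambda>k. a\<lparr>nv := (nv a)(vu := ?u), fl := (fl a)(layer := \<not> fl a layer), clk := k\<rparr>"
  have "wp (address vby vu layer) (wp (flip layer ;; edge) Q) (?b k)" if k: "k \<le> clk a + 3" for k
  proof (rule wp_address)
    fix c assume c: "frame {tmp, vi, vby} {carry_flag} (?b k) c" "ct c = ct (?b k)"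
      "nv c vby = ((if fl (?b k) layer then n else 0) + nv (?b k) vu) * l" "clk c \<le> clk (?b k) + 20 * l + 20"
    have frc: "frame {tmp, vi, vu, vby} {carry_flag, layer} a c"
      using c(1) by (auto simp: frame_def agree_def)
    have flc: "fl c layer = (\<not> fl a layer)" "fl c backward = fl a backward"
      using frame_fl[OF c(1)] by simp_all
    show "wp (flip layer ;; edge) Q c"
    proof (intro wp_Seq wp_flip)
      fix k' assume k': "k' \<le> clk c + 2"
      let ?d = "c\<lparr>fl := (fl c)(layer := \<not> fl c layer), clk := k'\<rparr>"
      have "(\<not> fl c layer) = fl a layer" using flc by simp
      then have frd: "frame {tmp, vi, vu, vby} {carry_flag} a ?d"
        using frc by (auto simp: frame_def agree_def)
      show "wp edge Q ?d"
      proof (rule wp_edge[where g = "idx (fl a layer) v" and h = "idx (\<not> fl a layer) ?u" and X = X])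
        fix e assume e: "frame scratch scratch_flags ?d e" "clk e \<le> clk ?d + 102 * (l + 1)"
          "ct e = stored (acc (fl ?d backward) X (idx (fl a layer) v) (X (idx (\<not> fl a layer) ?u)))"
        have "frame {tmp, vi, vax, vay, vrr, vu, vby} scratch_flags a e"
          using frd e(1) by (auto simp: frame_def agree_def)
        then show "Q e"
          using e k k' c(4) flc by (intro post) auto
      qed (use a c frd frame_nv[OF frd] u idx_less idx_neq ready_frame[OF a(1) frd] in \<open>auto simp: idx_def\<close>)
    qed auto
  qed (use a u in \<open>auto simp: ready_def glob_def\<close>)
  then show ?thesis
    unfolding neighbor_def using a u j small
    by (intro wp_Seq wp_in_neighbor wp_flip) auto
qed

definition vertex :: com where
  "vertex = in_degree vv vdeg ;; address vbx vv layer ;; for_loop vj vdeg neighbor"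

definition vertex_step :: "bool \<Rightarrow> bool \<Rightarrow> nat \<Rightarrow> nat list \<Rightarrow> (nat \<Rightarrow> nat) \<Rightarrow> nat \<Rightarrow> nat" where
  "vertex_step c b v us X = foldl (\<lambda>X u. acc b X (idx c v) (X (idx (\<not> c) u))) X us"

lemma valid_vertex_step: "valid X \<Longrightarrow> valid (vertex_step c b v us X)"
  unfolding vertex_step_def by (induction us arbitrary: X) (auto simp: valid_acc)

abbreviation (input) "vertex_vars \<equiv> {tmp, vi, vax, vay, vrr, vu, vby, vj, vdeg, vbx}"

abbreviation deg :: "nat \<Rightarrow> nat" where
  "deg v \<equiv> length (in_nbrs orc v)"

lemma wp_vertex:
  assumes a: "ready a" "nv a vv = v" "v < n" "ct a = stored X" "valid X"
    and post: "\<And>a'. frame vertex_vars scratch_flags a a' \<Longrightarrow>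
       ct a' = stored (vertex_step (fl a layer) (fl a backward) v (in_nbrs orc v) X) \<Longrightarrow>
       clk a' \<le> clk a + (l + 1) * (139 * deg v + 30) \<Longrightarrow> Q a'"
  shows "wp vertex Q a"
proof -
  let ?b = "a\<lparr>nv := (nv a)(vdeg := deg v), clk := clk a + 1\<rparr>"
  have deg: "deg v \<le> n" using in_nbrs_less[OF a(3)] by simp
  have "wp (address vbx vv layer) (wp (for_loop vj vdeg neighbor) Q) ?b"
  proof (rule wp_address)
    fix c assume c: "frame {tmp, vi, vbx} {carry_flag} ?b c" "ct c = ct ?b"
      "nv c vbx = ((if fl ?b layer then n else 0) + nv ?b vv) * l" "clk c \<le> clk ?b + 20 * l + 20"
    define I where "I j d \<longleftrightarrow> frame vertex_vars scratch_flags a d \<and> nv d vdeg = deg v \<and>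
      nv d vbx = idx (fl a layer) v * l \<and>
      ct d = stored (vertex_step (fl a layer) (fl a backward) v (take j (in_nbrs orc v)) X)" for j d
    have I_ready: "ready d" if "I j d" for j d
      using that unfolding I_def by (auto intro: ready_frame[OF a(1)])
    show "wp (for_loop vj vdeg neighbor) Q c"
    proof (rule wp_for_loop[where I = I and N = "deg v" and c = "\<lambda>_. 130 * (l + 1)"])
      show "I 0 c"
        using frame_nv[OF c(1)] c a unfolding I_def
        by (auto simp: frame_def agree_def vertex_step_def idx_def)
    next
      fix j d assume j: "j < deg v" and I: "I j d" "nv d vj = j"
      have Id: "frame vertex_vars scratch_flags a d" "nv d vdeg = deg v" "nv d vbx = idx (fl a layer) v * l"
        "ct d = stored (vertex_step (fl a layer) (fl a backward) v (take j (in_nbrs orc v)) X)"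
        using I by (simp_all add: I_def)
      have fld: "fl d layer = fl a layer" "fl d backward = fl a backward" "nv d vv = v"
        using frame_fl[OF Id(1)] frame_nv[OF Id(1)] a by simp_all
      show "wp neighbor (\<lambda>a'. I (Suc j) a' \<and> nv a' vj = j \<and> clk a' \<le> clk d + 130 * (l + 1)) d"
      proof (rule wp_neighbor[where v = v and j = j and
            X = "vertex_step (fl a layer) (fl a backward) v (take j (in_nbrs orc v)) X"])
        fix e assume e: "frame {tmp, vi, vax, vay, vrr, vu, vby} scratch_flags d e" "clk e \<le> clk d + 130 * (l + 1)"
         "ct e = stored (acc (fl d backward) (vertex_step (fl a layer) (fl a backward) v (take j (in_nbrs orc v)) X)
           (idx (fl d layer) v) (vertex_step (fl a layer) (fl a backward) v (take j (in_nbrs orc v)) X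
             (idx (\<not> fl d layer) (in_nbrs orc v ! j))))"
        have "frame vertex_vars scratch_flags a e"
          using Id(1) e(1) by (rule frame_trans) auto
        then show "I (Suc j) e \<and> nv e vj = j \<and> clk e \<le> clk d + 130 * (l + 1)"
          using e frame_nv[OF e(1)] Id I(2) j
          by (simp add: I_def fld take_Suc_conv_app_nth vertex_step_def)
      qed (use a I_ready[OF I(1)] fld j I Id valid_vertex_step in auto)
    next
      show "I j d \<Longrightarrow> frame {tmp, vj} {carry_flag} d e \<Longrightarrow> ct e = ct d \<Longrightarrow> I j e" for j d e
        unfolding I_def by (auto intro: frame_trans simp: frame_nv)
    next
      fix d assume d: "I (deg v) d" "clk d \<le> clk c + (\<Sum>j<deg v. 130 * (l + 1) + 9) + 8"
      \<comment> \<open>The loop overhead 9 per neighbour is absorbed: 139 = 130 + 9.\<close>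
      have "deg v * (130 * (l + 1) + 9) \<le> deg v * (139 * (l + 1))"
        by (intro mult_left_mono) auto
      then show "Q d"
        using d c(4) by (intro post) (auto simp: I_def algebra_simps)
    qed (use small deg I_ready in \<open>auto simp: I_def dest!: ready_glob globD\<close>)
  qed (use a in \<open>auto simp: ready_def glob_def\<close>)
  then show ?thesis
    unfolding vertex_def using a deg small by (intro wp_Seq wp_in_degree) auto
qed

definition layer_pass :: com where
  "layer_pass = for_loop vv vn vertex"

definition layer_upto :: "bool \<Rightarrow> bool \<Rightarrow> nat \<Rightarrow> (nat \<Rightarrow> nat) \<Rightarrow> nat \<Rightarrow> nat" where
  "layer_upto c b k X = foldl (\<lambda>X v. vertex_step c b v (in_nbrs orc v) X) X [0..<k]"

lemma layer_upto_simps [simp]: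
  "layer_upto c b 0 X = X"
  "layer_upto c b (Suc k) X = vertex_step c b k (in_nbrs orc k) (layer_upto c b k X)"
  by (simp_all add: layer_upto_def)

lemma valid_layer_upto: "valid X \<Longrightarrow> valid (layer_upto c b k X)"
  by (induction k) (auto simp: valid_vertex_step)

definition arcs :: nat where
  "arcs = (\<Sum>v<n. deg v)"

abbreviation (input) "pass_vars \<equiv> {tmp, vi, vax, vay, vrr, vu, vby, vj, vdeg, vbx, vv, vk}"

lemma wp_layer_pass:
  assumes a: "ready a" "ct a = stored X" "valid X"
    and post: "\<And>a'. frame (pass_vars - {vk}) scratch_flags a a' \<Longrightarrow>
       ct a' = stored (layer_upto (fl a layer) (fl a backward) n X) \<Longrightarrow>
       clk a' \<le> clk a + (l + 1) * (139 * arcs + 39 * n) + 8 \<Longrightarrow> Q a'"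
  shows "wp layer_pass Q a"
proof -
  define I where "I j d \<longleftrightarrow> frame (pass_vars - {vk}) scratch_flags a d \<and>
    ct d = stored (layer_upto (fl a layer) (fl a backward) j X)" for j d
  have I_ready: "ready d" if "I j d" for j d
    using that unfolding I_def by (auto intro: ready_frame[OF a(1)])
  have I_glob: "nv d v0 = 0 \<and> nv d vn = n \<and> nv d vT = T" if "I j d" for j d
    using globD[OF ready_glob[OF I_ready[OF that]]] by simp
  show ?thesis
    unfolding layer_pass_def
  proof (rule wp_for_loop[where I = I and N = n and c = "\<lambda>v. (l + 1) * (139 * deg v + 30)"])
    fix j d assume j: "j < n" and I: "I j d" "nv d vv = j"
    have Id: "frame (pass_vars - {vk}) scratch_flags a d" "ct d = stored (layer_upto (fl a layer) (fl a backward) j X)"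
      using I by (simp_all add: I_def)
    have fld: "fl d layer = fl a layer" "fl d backward = fl a backward"
      using frame_fl[OF Id(1)] by simp_all
    show "wp vertex (\<lambda>a'. I (Suc j) a' \<and> nv a' vv = j \<and> clk a' \<le> clk d + (l + 1) * (139 * deg j + 30)) d"
    proof (rule wp_vertex[where v = j and X = "layer_upto (fl a layer) (fl a backward) j X"])
      fix e assume e: "frame vertex_vars scratch_flags d e" "clk e \<le> clk d + (l + 1) * (139 * deg j + 30)"
        "ct e = stored (vertex_step (fl d layer) (fl d backward) j (in_nbrs orc j) (layer_upto (fl a layer) (fl a backward) j X))"
      have "frame (pass_vars - {vk}) scratch_flags a e"
        using Id(1) e(1) by (rule frame_trans) auto
      then show "I (Suc j) e \<and> nv e vv = j \<and> clk e \<le> clk d + (l + 1) * (139 * deg j + 30)"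
        using e frame_nv[OF e(1)] I(2) by (simp add: I_def fld)
    qed (use a I_ready[OF I(1)] j I Id valid_layer_upto in auto)
  next
    show "I j d \<Longrightarrow> frame {tmp, vv} {carry_flag} d e \<Longrightarrow> ct e = ct d \<Longrightarrow> I j e" for j d e
      unfolding I_def by (auto intro: frame_trans)
  next
    fix d assume d: "I n d" "clk d \<le> clk a + (\<Sum>j<n. (l + 1) * (139 * deg j + 30) + 9) + 8"
    have "(\<Sum>j<n. (l + 1) * (139 * deg j + 30) + 9) \<le> (\<Sum>j<n. (l + 1) * (139 * deg j + 39))"
      by (intro sum_mono) auto
    also have "\<dots> = (l + 1) * (139 * arcs + 39 * n)"
      unfolding sum_distrib_left[symmetric] by (simp add: arcs_def sum.distrib flip: sum_distrib_left)
    finally show "Q d"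
      using d by (intro post) (auto simp: I_def)
  qed (use a small I_glob in \<open>auto simp: I_def frame_refl\<close>)
qed

end

section \<open>The algorithm\<close>

context problem
begin

text \<open>\<open>layer\<close> names the layer whose turn is next. The most recent update, which
  must be undone first, concerned the other one, hence the flip in advance when running
  backwards.\<close>

definition pass_body :: com where
  "pass_body = If_flag backward (flip layer) Skip ;; layer_pass ;; If_flag backward Skip (flip layer)"

lemma wp_pass_body:
  assumes d: "ready d" "ct d = stored X" "valid X"
    and post: "\<And>e. frame (pass_vars - {vk}) {carry_flag, fx, fy, fg, layer} d e \<Longrightarrow> fl e layer = (\<not> fl d layer) \<Longrightarrow>
       ct e = stored (layer_upto (fl d layer \<noteq> fl d backward) (fl d backward) n X) \<Longrightarrow>
       clk e \<le> clk d + ((l + 1) * (139 * arcs + 39 * n) + 14) \<Longrightarrow> Q e"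
  shows "wp pass_body Q d"
proof (cases "fl d backward")
  case True
  have "wp layer_pass (wp (If_flag backward Skip (flip layer)) Q) (d\<lparr>fl := (fl d)(layer := \<not> fl d layer), clk := k\<rparr>)"
    if k: "k \<le> clk d + 3" for k
  proof (rule wp_layer_pass[where X = X])
    let ?d = "d\<lparr>fl := (fl d)(layer := \<not> fl d layer), clk := k\<rparr>"
    fix e assume e: "frame (pass_vars - {vk}) scratch_flags ?d e" "ct e = stored (layer_upto (fl ?d layer) (fl ?d backward) n X)"
      "clk e \<le> clk ?d + (l + 1) * (139 * arcs + 39 * n) + 8"
    have fle: "fl e layer = (\<not> fl d layer)" "fl e backward"
      using frame_fl[OF e(1)] True by simp_all
    have "frame (pass_vars - {vk}) {carry_flag, fx, fy, fg, layer} d (e\<lparr>clk := clk e + 1\<rparr>)"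
      using e(1) by (auto simp: frame_def agree_def)
    then show "wp (If_flag backward Skip (flip layer)) Q e"
      using fle e(2,3) k True by (intro wp_If_flag wp_Skip post) auto
  qed (use d in \<open>auto simp: ready_def glob_def\<close>)
  then show ?thesis
    unfolding pass_body_def using True
    by (intro wp_Seq wp_If_flag wp_flip wp_Skip) auto
next
  case False
  have "wp layer_pass (wp (If_flag backward Skip (flip layer)) Q) (d\<lparr>clk := clk d + 1\<rparr>)"
  proof (rule wp_layer_pass[where X = X])
    let ?d = "d\<lparr>clk := clk d + 1\<rparr>"
    fix e assume e: "frame (pass_vars - {vk}) scratch_flags ?d e" "ct e = stored (layer_upto (fl ?d layer) (fl ?d backward) n X)"
      "clk e \<le> clk ?d + (l + 1) * (139 * arcs + 39 * n) + 8"
    have fle: "fl e layer = fl d layer" "\<not> fl e backward"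
      using frame_fl[OF e(1)] False by simp_all
    have "frame (pass_vars - {vk}) {carry_flag, fx, fy, fg, layer} d (e\<lparr>fl := (fl e)(layer := \<not> fl e layer), clk := k\<rparr>)" for k
      using e(1) by (auto simp: frame_def agree_def)
    then show "wp (If_flag backward Skip (flip layer)) Q e"
      using fle e(2,3) False by (intro wp_If_flag wp_Skip wp_flip post) auto
  qed (use d in \<open>auto simp: ready_def glob_def\<close>)
  then show ?thesis
    unfolding pass_body_def using False
    by (intro wp_Seq wp_If_flag wp_Skip) auto
qed

definition pass :: com where
  "pass = for_loop vk vT pass_body"

text \<open>
  The Boolean component is the flag \<open>layer\<close>, the layer that is updated next by a forward pass.  A backward
  pass flips it before, a forward pass after the update.
\<close>

definition pass_step :: "bool \<Rightarrow> bool \<times> (nat \<Rightarrow> nat) \<Rightarrow> bool \<times> (nat \<Rightarrow> nat)" where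
  "pass_step b cX = (\<not> fst cX, layer_upto (fst cX \<noteq> b) b n (snd cX))"

lemma valid_pass: "valid X \<Longrightarrow> valid (snd ((pass_step b ^^ k) (c, X)))"
  by (induction k) (auto simp: pass_step_def valid_layer_upto)

definition pass_cost :: nat where
  "pass_cost = T * ((l + 1) * (139 * arcs + 39 * n) + 23) + 8"

lemma wp_pass:
  assumes a: "ready a" "ct a = stored X" "valid X"
    and post: "\<And>a'. frame pass_vars {carry_flag, fx, fy, fg, layer} a a' \<Longrightarrow>
       fl a' layer = fst ((pass_step (fl a backward) ^^ T) (fl a layer, X)) \<Longrightarrow>
       ct a' = stored (snd ((pass_step (fl a backward) ^^ T) (fl a layer, X))) \<Longrightarrow>
       clk a' \<le> clk a + pass_cost \<Longrightarrow> Q a'"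
  shows "wp pass Q a"
proof -
  let ?F = "{carry_flag, fx, fy, fg, layer}"
  define P where "P j = (pass_step (fl a backward) ^^ j) (fl a layer, X)" for j
  let ?c = "(l + 1) * (139 * arcs + 39 * n) + 14"
  define I where "I j d \<longleftrightarrow> frame pass_vars ?F a d \<and> fl d layer = fst (P j) \<and> ct d = stored (snd (P j))" for j d
  have I_ready: "ready d" if "I j d" for j d
    using that unfolding I_def by (auto intro: ready_frame[OF a(1)])
  have I_glob: "nv d v0 = 0 \<and> nv d vn = n \<and> nv d vT = T" if "I j d" for j d
    using globD[OF ready_glob[OF I_ready[OF that]]] by simp
  show ?thesis
    unfolding pass_def
  proof (rule wp_for_loop[where I = I and N = T and c = "\<lambda>_. ?c"])
    fix j d assume j: "j < T" and I: "I j d" "nv d vk = j"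
    have Id: "frame pass_vars ?F a d" "fl d layer = fst (P j)" "ct d = stored (snd (P j))"
      using I by (simp_all add: I_def)
    have bd: "fl d backward = fl a backward"
      using frame_fl[OF Id(1)] by simp
    show "wp pass_body (\<lambda>a'. I (Suc j) a' \<and> nv a' vk = j \<and> clk a' \<le> clk d + ?c) d"
    proof (rule wp_pass_body[where X = "snd (P j)"])
      fix e assume e: "frame (pass_vars - {vk}) ?F d e" "fl e layer = (\<not> fl d layer)"
        "ct e = stored (layer_upto (fl d layer \<noteq> fl d backward) (fl d backward) n (snd (P j)))"
        "clk e \<le> clk d + ?c"
      have P: "P (Suc j) = (\<not> fst (P j), layer_upto (fst (P j) \<noteq> fl a backward) (fl a backward) n (snd (P j)))"
        by (simp add: P_def pass_step_def)
      have "frame pass_vars ?F a e"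
        using Id(1) e(1) by (rule frame_trans) auto
      moreover have "nv e vk = j" using frame_nv[OF e(1)] I(2) by simp
      ultimately show "I (Suc j) e \<and> nv e vk = j \<and> clk e \<le> clk d + ?c"
        using e(2-4) Id(2) bd unfolding I_def P by simp
    qed (use Id I_ready[OF I(1)] valid_pass[OF a(3)] in \<open>auto simp: P_def\<close>)
  next
    show "I j d \<Longrightarrow> frame {tmp, vk} {carry_flag} d e \<Longrightarrow> ct e = ct d \<Longrightarrow> I j e" for j d e
      unfolding I_def by (auto intro: frame_trans simp: frame_fl)
  next
    fix d assume d: "I T d" "clk d \<le> clk a + (\<Sum>j<T. ?c + 9) + 8"
    then have "clk d \<le> clk a + pass_cost"
      by (simp add: pass_cost_def add_ac)
    then show "Q d"
      using d(1) unfolding I_def P_def by (intro post) blast+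
  qed (use a small I_glob in \<open>auto simp: I_def P_def frame_refl\<close>)
qed

text \<open>The layer opposite to \<open>layer\<close> is the one that corresponds to
  \<open>F(T)\<close>. Its register may be too long for a work tape, so its residue modulo q is
  accumulated from the residues of the powers of two. Doubling needs a copy in \<open>vrr\<close>,
  because addition requires two distinct tapes.\<close>

definition read_value :: com where
  "read_value = flip layer ;; address vbx vt layer ;; flip layer ;; copy vpow vd ;; zero vw ;; copy vax vbx ;;
     for_loop vi vl (Instr (CatRead vax fx) ;; If_flag fx (mod_plus vw vpow) Skip ;;
       copy vrr vpow ;; mod_plus vpow vrr ;; inc vax)"

abbreviation (input) "read_vars \<equiv> {tmp, vi, vbx, vpow, vw, vax, vrr}"

lemma wp_read_value:
  assumes a: "ready a" "ct a = stored X" "valid X"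
    and post: "\<And>a'. frame read_vars {carry_flag, fx} a a' \<Longrightarrow> ct a' = ct a \<Longrightarrow>
       nv a' vw = X (idx (\<not> fl a layer) t) mod q \<Longrightarrow> clk a' \<le> clk a + 62 * (l + 1) \<Longrightarrow> Q a'"
  shows "wp read_value Q a"
proof -
  define g where "g = idx (\<not> fl a layer) t"
  have g: "g < 2 * n" using idx_less st by (simp add: g_def)
  have Xg: "X g < 2 ^ l" using a(3) g N_r unfolding valid_def by (metis add_leD1 order_less_le_trans order_refl)
  let ?loop = "for_loop vi vl (Instr (CatRead vax fx) ;; If_flag fx (mod_plus vw vpow) Skip ;;
       copy vrr vpow ;; mod_plus vpow vrr ;; inc vax)"
  define I where "I j d \<longleftrightarrow> frame read_vars {carry_flag, fx} a d \<and> ct d = ct a \<and> nv d vax = g * l + j \<and>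
     nv d vpow = 2 ^ j mod q \<and> nv d vw = (X g mod 2 ^ j) mod q" for j d
  have I_ready: "ready d" if "I j d" for j d
    using that unfolding I_def by (auto intro: ready_frame[OF a(1)])
  have I_glob: "nv d v0 = 0 \<and> nv d vl = l \<and> nv d vq = q" if "I j d" for j d
    using globD[OF ready_glob[OF I_ready[OF that]]] by simp
  have loop: "wp ?loop Q c" if c: "I 0 c" "clk c \<le> clk a + 20 * l + 31" for c
  proof (rule wp_for_loop[where I = I and N = l and c = "\<lambda>_. 33"])
    fix j d assume j: "j < l" and I: "I j d" "nv d vi = j"
    have Id: "frame read_vars {carry_flag, fx} a d" "ct d = ct a" "nv d vax = g * l + j"
     "nv d vpow = 2 ^ j mod q" "nv d vw = (X g mod 2 ^ j) mod q"
      using I by (simp_all add: I_def)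
    have rd: "ct d ! (g * l + j) = bit (X g) j"
      unfolding Id(2) a(2) stored_def using g j length_cat by (simp add: nth_regs)
    have ln: "g * l + j < length (ct d)" "g * l + j < 2 ^ W" "Suc (g * l + j) < 2 ^ W"
      using register_address[OF g j] address_less[OF g j] length_cat by (auto simp: Id(2) a(2) stored_def)
    have pow: "(2 ^ j mod q + 2 ^ j mod q) mod q = 2 ^ Suc j mod q"
      by (simp add: mod_simps flip: mult_2)
    have w: "(X g mod 2 ^ Suc j) mod q = (if bit (X g) j then ((X g mod 2 ^ j) mod q + 2 ^ j mod q) mod q else (X g mod 2 ^ j) mod q)"
      unfolding mod_power_Suc by (simp add: mod_simps)
    have lt: "nv d vpow < q" "nv d vw < q"
      using q_pos by (simp_all add: Id)
    let ?R = "\<lambda>a'. I (Suc j) a' \<and> nv a' vi = j \<and> clk a' \<le> clk d + 33"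
    have tail: "wp (copy vrr vpow ;; mod_plus vpow vrr ;; inc vax) ?R e"
      if e: "frame read_vars {carry_flag, fx} a e" "ct e = ct a" "nv e vax = g * l + j" "nv e vi = j"
       "nv e vpow = 2 ^ j mod q" "nv e vw = (X g mod 2 ^ Suc j) mod q" "clk e \<le> clk d + 15" for e
    proof -
      have re: "nv e v0 = 0" "nv e vq = q"
        using globD[OF ready_glob[OF ready_frame[OF a(1) e(1)]]] by simp_all
      have "2 ^ j mod q < q" "2 ^ j mod q < 2 ^ W"
        using q_pos small less_trans[of "2 ^ j mod q" q] by simp_all
      then show ?thesis
        using e re small ln pow
        by (intro wp_Seq wp_copy wp_mod_plus wp_inc) (auto simp: I_def frame_def)
    qed
    show "wp (Instr (CatRead vax fx) ;; If_flag fx (mod_plus vw vpow) Skip ;;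
       copy vrr vpow ;; mod_plus vpow vrr ;; inc vax) ?R d"
    proof (intro wp_Seq[of "Instr (CatRead vax fx)"] wp_CatRead wp_Seq[of "If_flag fx (mod_plus vw vpow) Skip"])
      let ?d = "d\<lparr>fl := (fl d)(fx := ct d ! nv d vax), clk := clk d + 1\<rparr>"
      have d': "frame read_vars {carry_flag, fx} a ?d"
        using Id(1) by (simp add: frame_def)
      show "wp (If_flag fx (mod_plus vw vpow) Skip) (wp (copy vrr vpow ;; mod_plus vpow vrr ;; inc vax) ?R) ?d"
      proof (intro wp_If_flag wp_mod_plus wp_Skip)
        fix ga b k
        assume "fl ?d fx" "k \<le> clk (?d\<lparr>clk := clk ?d + 1\<rparr>) + 13"
        then show "wp (copy vrr vpow ;; mod_plus vpow vrr ;; inc vax) ?R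
           (?d\<lparr>clk := clk ?d + 1, nv := (nv (?d\<lparr>clk := clk ?d + 1\<rparr>))(tmp := ga,
             vw := (nv (?d\<lparr>clk := clk ?d + 1\<rparr>) vw + nv (?d\<lparr>clk := clk ?d + 1\<rparr>) vpow) mod nv (?d\<lparr>clk := clk ?d + 1\<rparr>) vq),
             fl := (fl (?d\<lparr>clk := clk ?d + 1\<rparr>))(carry_flag := b), clk := k\<rparr>)"
          using d' Id I rd w I_glob[OF I(1)] by (intro tail) (auto simp: frame_def)
      next
        assume "\<not> fl ?d fx"
        then show "wp (copy vrr vpow ;; mod_plus vpow vrr ;; inc vax) ?R (?d\<lparr>clk := clk ?d + 1\<rparr>)"
          using d' Id I rd w by (intro tail) (auto simp: frame_def)
      qed (use lt I_glob[OF I(1)] small in auto)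
    qed (use ln Id in auto)
  next
    show "I j d \<Longrightarrow> frame {tmp, vi} {carry_flag} d e \<Longrightarrow> ct e = ct d \<Longrightarrow> I j e" for j d e
      unfolding I_def by (auto intro: frame_trans simp: frame_nv)
  next
    fix d assume d: "I l d" "clk d \<le> clk c + (\<Sum>j<l. 33 + 9) + 8"
    then show "Q d"
      using c(2) Xg unfolding I_def by (intro post) (auto simp: g_def)
  qed (use c(1) small I_glob in auto)
  let ?b = "\<lambda>k. a\<lparr>fl := (fl a)(layer := \<not> fl a layer), clk := k\<rparr>"
  have "wp (address vbx vt layer) (wp (flip layer ;; copy vpow vd ;; zero vw ;; copy vax vbx ;; ?loop) Q) (?b k)"
    if k: "k \<le> clk a + 2" for k
  proof (rule wp_address)
    fix c assume c: "frame {tmp, vi, vbx} {carry_flag} (?b k) c" "ct c = ct (?b k)"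
      "nv c vbx = ((if fl (?b k) layer then n else 0) + nv (?b k) vt) * l" "clk c \<le> clk (?b k) + 20 * l + 20"
    let ?c = "c\<lparr>fl := (fl c)(layer := \<not> fl c layer)\<rparr>"
    have frc: "frame {tmp, vi, vbx} {carry_flag} a ?c"
      using c(1) by (auto simp: frame_def agree_def)
    have nvc: "nv c vbx = g * l" "nv c vd = 1 mod q"
      using c(3) a(1) frame_nv[OF frc] by (simp_all add: g_def idx_def ready_def glob_def)
    have "(1::nat) mod q \<le> 1" by simp
    moreover have "(1::nat) < 2 ^ W" using small(3) by linarith
    ultimately have d1: "1 mod q < (2::nat) ^ W" by linarith
    have I0: "I 0 (c\<lparr>nv := (nv c)(vpow := 1 mod q, vw := 0, vax := g * l),
        fl := (fl c)(layer := \<not> fl c layer, carry_flag := False), clk := k'\<rparr>)" for k'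
      using frc c(2) by (simp add: I_def frame_def) (simp add: agree_def)
    show "wp (flip layer ;; copy vpow vd ;; zero vw ;; copy vax vbx ;; ?loop) Q c"
      using I0 nvc d1 c(4) k address_le[OF g, of 0]
      by (intro wp_Seq wp_flip wp_copy wp_zero loop) (simp_all add: fun_upd_twist)
  qed (use a st in \<open>auto simp: ready_def glob_def\<close>)
  then show ?thesis
    unfolding read_value_def by (intro wp_Seq wp_flip) auto
qed

definition phase :: com where
  "phase = set_flag backward False ;; pass ;; read_value ;; set_flag backward True ;; pass"

abbreviation (input) "phase_vars \<equiv>
  {tmp, vi, vax, vay, vrr, vu, vby, vj, vdeg, vbx, vv, vk, vpow, vw}"

text \<open>A pass may alter \<open>layer\<close>, but the backward run restores its value, and the
  next phase relies on that.\<close>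

lemma frame_remove: "frame V (insert f F) a b \<Longrightarrow> fl b f = fl a f \<Longrightarrow> frame V F a b"
proof -
  assume *: "frame V (insert f F) a b" "fl b f = fl a f"
  then have "fl b g = fl a g" if "g \<notin> F" for g
    using that frame_fl[OF *(1), of g] by (cases "g = f") auto
  then show ?thesis using * by (simp add: frame_def agree_def)
qed

definition phase_cost :: nat where
  "phase_cost = 2 * pass_cost + 62 * (l + 1) + 2"

text \<open>The flag starts as \<open>True\<close>: layer 1 plays the role of \<open>F(-1)\<close>
  and is updated first, layer 0 that of \<open>F(0)\<close>.\<close>

definition walked :: "(nat \<Rightarrow> nat) \<Rightarrow> nat" where
  "walked X = (case (pass_step False ^^ T) (True, X) of (c, Y) \<Rightarrow> Y (idx (\<not> c) t))"

text \<open>That backward passes undo forward ones is a purely algebraic fact about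
  \<open>pass_step\<close>; it enters as a hypothesis, keeping the program reasoning apart from
  it.\<close>

lemma wp_phase:
  assumes a: "ready a" "ct a = stored X" "valid X" "fl a layer"
    and inverse: "(pass_step True ^^ T) ((pass_step False ^^ T) (True, X)) = (True, X)"
    and post: "\<And>a'. frame phase_vars {carry_flag, fx, fy, fg, backward} a a' \<Longrightarrow> ct a' = stored X \<Longrightarrow>
       nv a' vw = walked X mod q \<Longrightarrow> clk a' \<le> clk a + phase_cost \<Longrightarrow> Q a'"
  shows "wp phase Q a"
proof -
  let ?F = "{carry_flag, fx, fy, fg, layer}"
  obtain c Y where P: "(pass_step False ^^ T) (True, X) = (c, Y)" by fastforce
  have Y: "valid Y" using valid_pass[OF a(3), where b = False and k = T and c = True] by (simp add: P)
  let ?b = "a\<lparr>fl := (fl a)(backward := False), clk := clk a + 1\<rparr>"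
  have "wp pass (wp (read_value ;; set_flag backward True ;; pass) Q) ?b"
  proof (rule wp_pass[where X = X])
    fix d assume d: "frame pass_vars ?F ?b d" "fl d layer = fst ((pass_step (fl ?b backward) ^^ T) (fl ?b layer, X))"
      "ct d = stored (snd ((pass_step (fl ?b backward) ^^ T) (fl ?b layer, X)))" "clk d \<le> clk ?b + pass_cost"
    have d': "fl d layer = c" "ct d = stored Y"
      using d(2,3) a(4) P by simp_all
    have frd: "frame phase_vars {carry_flag, fx, fy, fg, backward, layer} a d"
      using d(1) by (auto simp: frame_def agree_def)
    have rd: "ready d" using frd by (rule ready_frame[OF a(1)]) auto
    show "wp (read_value ;; set_flag backward True ;; pass) Q d"
    proof (rule wp_Seq, rule wp_read_value[where X = Y])
      fix e assume e: "frame read_vars {carry_flag, fx} d e" "ct e = ct d"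
       "nv e vw = Y (idx (\<not> fl d layer) t) mod q" "clk e \<le> clk d + 62 * (l + 1)"
      let ?e = "e\<lparr>fl := (fl e)(backward := True), clk := clk e + 1\<rparr>"
      have fre: "frame phase_vars {carry_flag, fx, fy, fg, backward, layer} a ?e"
        using frd e(1) by (auto simp: frame_def agree_def)
      have "wp pass Q ?e"
      proof (rule wp_pass[where X = Y])
        fix h assume h: "frame pass_vars ?F ?e h" "fl h layer = fst ((pass_step (fl ?e backward) ^^ T) (fl ?e layer, Y))"
          "ct h = stored (snd ((pass_step (fl ?e backward) ^^ T) (fl ?e layer, Y)))" "clk h \<le> clk ?e + pass_cost"
        have le: "fl ?e layer = c" using frame_fl[OF e(1)] d' by simp
        have "fl h layer" and cth: "ct h = stored X"
          using h(2,3) inverse P le by simp_all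
        moreover have "frame phase_vars {carry_flag, fx, fy, fg, backward, layer} a h"
          using fre h(1) by (rule frame_trans) auto
        ultimately have "frame phase_vars {carry_flag, fx, fy, fg, backward} a h"
          using a(4) frame_remove[of phase_vars layer "{carry_flag, fx, fy, fg, backward}" a h]
          by (simp add: insert_commute)
        moreover have "nv h vw = walked X mod q"
          using frame_nv[OF h(1)] e(3) d'(1) by (simp add: walked_def P)
        ultimately show "Q h"
          using cth h(4) e(4) d(4) by (intro post) (auto simp: phase_cost_def)
      next
        show "ready ?e" using fre by (rule ready_frame[OF a(1)]) auto
      qed (use e(2) d' Y in simp_all)
      then show "wp (set_flag backward True ;; pass) Q e"
        by (intro wp_Seq wp_set_flag) auto
    qed (use rd d' Y in simp_all)
  qed (use a in \<open>auto simp: ready_def glob_def\<close>)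
  then show ?thesis
    unfolding phase_def by (intro wp_Seq wp_set_flag) auto
qed

text \<open>\<open>fx\<close> is borrowed as the layer argument of \<open>address\<close>, since the
  layer is a constant here and independent of the flag \<open>layer\<close>.\<close>

definition half_bump :: "(com \<Rightarrow> com) \<Rightarrow> bool \<Rightarrow> com" where
  "half_bump A c = set_flag fx c ;; address vbx vs fx ;; A (reg_add_tape vd)"

text \<open>For q = 1 the bump is 0, which stays below N even if N = 1; otherwise it is 1, and
  \<open>1 < q \<le> N\<close>.\<close>

lemma one_mod_q: "1 mod q < N" "1 mod q < q"
proof -
  show "1 mod q < q" using q_pos by (rule mod_less_divisor)
  then show "1 mod q < N" using q_le_N by linarith
qed

lemma wp_half_bump:
  assumes a: "ready a" "ct a = stored X" "valid X"
    and A: "A = add_mod \<and> \<not> b \<or> A = sub_mod \<and> b"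
    and post: "\<And>a'. frame (scratch \<union> {vbx}) scratch_flags a a' \<Longrightarrow>
       ct a' = stored (acc b X (idx c s) (1 mod q)) \<Longrightarrow> clk a' \<le> clk a + 122 * (l + 1) \<Longrightarrow> Q a'"
  shows "wp (half_bump A c) Q a"
proof -
  let ?b = "a\<lparr>fl := (fl a)(fx := c), clk := clk a + 1\<rparr>"
  have "wp (address vbx vs fx) (wp (A (reg_add_tape vd)) Q) ?b"
  proof (rule wp_address)
    fix d assume d: "frame {tmp, vi, vbx} {carry_flag} ?b d" "ct d = ct ?b"
      "nv d vbx = ((if fl ?b fx then n else 0) + nv ?b vs) * l" "clk d \<le> clk ?b + 20 * l + 20"
    have frd: "frame (scratch \<union> {vbx}) scratch_flags a d"
      using d(1) by (auto simp: frame_def agree_def)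
    have rd: "ready d" using frd by (rule ready_frame[OF a(1)]) auto
    have base: "nv d vbx = idx c s * l" using d(3) a(1) by (simp add: idx_def ready_def glob_def)
    have src: "source (reg_add_tape vd) (idx c s) (1 mod q) d X"
      using rd by (simp add: source_def ready_def)
    have P: "Q e" if e: "frame scratch scratch_flags d e" "ct e = stored (acc b X (idx c s) (1 mod q))"
      "clk e \<le> clk d + 101 * (l + 1)" for e
    proof (rule post)
      show "frame (scratch \<union> {vbx}) scratch_flags a e"
        using frd e(1) by (rule frame_trans) auto
    qed (use e d(4) in auto)
    show "wp (A (reg_add_tape vd)) Q d"
    proof (cases b)
      case True
      then show ?thesis
        using A rd base src P a d(2) one_mod_q idx_less st
        by (auto intro!: wp_sub_mod[where X = X and y = "1 mod q" and g = "idx c s"] simp: acc_def valid_def)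
    next
      case False
      then show ?thesis
        using A rd base src P a d(2) one_mod_q idx_less st
        by (auto intro!: wp_add_mod[where X = X and y = "1 mod q" and g = "idx c s"] simp: acc_def valid_def)
    qed
  qed (use a st in \<open>auto simp: ready_def glob_def\<close>)
  then show ?thesis
    unfolding half_bump_def by (intro wp_Seq wp_set_flag) auto
qed

end

section \<open>Correctness of the algorithm\<close>

text \<open>
  \<open>walk_count G s (k + 1)\<close> satisfies the recurrence \<open>F (k + 1) = A F k + F (k - 1)\<close>, where \<open>A\<close> is
  the adjacency matrix and the two initial vectors \<open>F (-1)\<close> and \<open>F 0\<close> are both the unit vector at \<open>s\<close>.
\<close>

fun walk_count :: "'a pair_pre_digraph \<Rightarrow> 'a \<Rightarrow> nat \<Rightarrow> 'a \<Rightarrow> nat" where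
  "walk_count G s 0 v = of_bool (v = s)"
| "walk_count G s (Suc 0) v = of_bool (v = s)"
| "walk_count G s (Suc (Suc k)) v =
     walk_count G s k v + (\<Sum>u | (u, v) \<in> parcs G. walk_count G s (Suc k) u)"

context problem
begin

definition weight :: "bool \<Rightarrow> nat \<Rightarrow> nat" where
  "weight b y = (if b then N - y else y)"

text \<open>The summands are read from the layer that is not written, so no step of the fold
  disturbs a later one, and sequential accumulation becomes a single sum.\<close>

lemma vertex_step_eq:
  assumes "v < n" "set us \<subseteq> {..<n}" "X (idx c v) < N"
  shows "vertex_step c b v us X =
    X(idx c v := (X (idx c v) + (\<Sum>u\<leftarrow>us. weight b (X (idx (\<not> c) u)))) mod N)"
  using assms(2,3)
proof (induction us arbitrary: X)
  case Nil
  then show ?case by (simp add: vertex_step_def)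
next
  case (Cons u us)
  let ?X = "acc b X (idx c v) (X (idx (\<not> c) u))"
  have other: "?X (idx (\<not> c) w) = X (idx (\<not> c) w)" if "w < n" for w
    using idx_neq[OF assms(1) that, of c] by (simp add: acc_def)
  have "(\<Sum>u\<leftarrow>us. weight b (?X (idx (\<not> c) u))) = (\<Sum>u\<leftarrow>us. weight b (X (idx (\<not> c) u)))"
    using Cons.prems(1) other by (intro arg_cong[where f = sum_list] map_cong) auto
  moreover have "vertex_step c b v (u # us) X = vertex_step c b v us ?X"
    by (simp add: vertex_step_def)
  moreover have "?X (idx c v) < N" using N_pos by (simp add: acc_def)
  ultimately have "vertex_step c b v (u # us) X =
      ?X(idx c v := (?X (idx c v) + (\<Sum>u\<leftarrow>us. weight b (X (idx (\<not> c) u)))) mod N)"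
    using Cons.IH[of ?X] Cons.prems(1) by (simp only: list.set insert_subset)
  also have "?X (idx c v) = (X (idx c v) + weight b (X (idx (\<not> c) u))) mod N"
    by (simp add: acc_def weight_def)
  finally show ?case
    by (simp only: acc_def fun_upd_upd mod_add_left_eq add.assoc list.map sum_list.Cons)
qed

lemma idx_inj: "v < n \<Longrightarrow> w < n \<Longrightarrow> idx c v = idx d w \<longleftrightarrow> c = d \<and> v = w"
  by (auto simp: idx_def)

text \<open>Vertex k writes only its own register in layer c and reads only that one and the other
  layer. The order of the vertices is therefore immaterial, and the in-place update equals a
  simultaneous one.\<close>

lemma layer_upto_cases:
  assumes "valid X" "k \<le> n"
  shows "(\<forall>v<n. layer_upto c b k X (idx c v) =
      (if v < k then (X (idx c v) + (\<Sum>u\<leftarrow>in_nbrs orc v. weight b (X (idx (\<not> c) u)))) mod N else X (idx c v))) \<and>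
    (\<forall>g. (\<forall>v<n. g \<noteq> idx c v) \<longrightarrow> layer_upto c b k X g = X g)"
  using assms(2)
proof (induction k)
  case (Suc k)
  let ?Y = "layer_upto c b k X"
  have k: "k < n" "k \<le> n" using Suc.prems by auto
  have IH: "v < n \<Longrightarrow> ?Y (idx c v) =
      (if v < k then (X (idx c v) + (\<Sum>u\<leftarrow>in_nbrs orc v. weight b (X (idx (\<not> c) u)))) mod N else X (idx c v))"
    "(\<And>v. v < n \<Longrightarrow> g \<noteq> idx c v) \<Longrightarrow> ?Y g = X g" for v g
    using Suc.IH[OF k(2)] by blast+
  have nb: "set (in_nbrs orc k) \<subseteq> {..<n}" using in_nbrs_less k by blast
  have val: "?Y (idx c k) < N"
    using valid_layer_upto[OF assms(1), of c b k] idx_less[OF k(1)] by (auto simp: valid_def)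
  have other: "?Y (idx (\<not> c) u) = X (idx (\<not> c) u)" if "u < n" for u
    using that k by (intro IH(2)) (auto simp: idx_inj)
  have "(\<Sum>u\<leftarrow>in_nbrs orc k. weight b (?Y (idx (\<not> c) u))) = (\<Sum>u\<leftarrow>in_nbrs orc k. weight b (X (idx (\<not> c) u)))"
    using nb other by (intro arg_cong[where f = sum_list] map_cong) auto
  then have eq: "layer_upto c b (Suc k) X =
      ?Y(idx c k := (X (idx c k) + (\<Sum>u\<leftarrow>in_nbrs orc k. weight b (X (idx (\<not> c) u)))) mod N)"
    unfolding layer_upto_simps vertex_step_eq[where X = ?Y and c = c, OF k(1) nb val] using IH(1)[OF k(1)] by simp
  show ?case
    unfolding eq using IH k by (auto simp: idx_inj less_Suc_eq)
qed simp

lemma layer_upto_eq: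
  assumes "valid X"
  shows "v < n \<Longrightarrow> layer_upto c b n X (idx c v) =
      (X (idx c v) + (\<Sum>u\<leftarrow>in_nbrs orc v. weight b (X (idx (\<not> c) u)))) mod N"
    and "(\<And>v. v < n \<Longrightarrow> g \<noteq> idx c v) \<Longrightarrow> layer_upto c b n X g = X g"
  using layer_upto_cases[OF assms order_refl] by simp_all

lemma sum_list_complement:
  assumes "\<forall>u\<in>set us. f u \<le> N"
  shows "(\<Sum>u\<leftarrow>us. f u) + (\<Sum>u\<leftarrow>us. N - f u) = length us * N"
  using assms by (induction us) auto

text \<open>The source layer is the same in both passes, so each summand y of the forward pass meets
  \<open>N - y\<close> in the backward pass; in total a multiple of N is added.\<close>

lemma pass_step_inverse:
  assumes "valid X"
  shows "pass_step True (pass_step False (c, X)) = (c, X)"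
proof -
  let ?Y = "layer_upto c False n X"
  have Y: "valid ?Y" using assms by (rule valid_layer_upto)
  have "layer_upto c True n ?Y g = X g" for g
  proof (cases "\<exists>v<n. g = idx c v")
    case True
    then obtain v where v: "v < n" "g = idx c v" by blast
    have nb: "u < n" if "u \<in> set (in_nbrs orc v)" for u
      using that in_nbrs_less[OF v(1)] by blast
    have other: "?Y (idx (\<not> c) u) = X (idx (\<not> c) u)" if "u < n" for u
      using that assms by (intro layer_upto_eq(2)) (auto simp: idx_inj)
    have "(\<Sum>u\<leftarrow>in_nbrs orc v. weight True (?Y (idx (\<not> c) u))) = (\<Sum>u\<leftarrow>in_nbrs orc v. N - X (idx (\<not> c) u))"
      using nb other by (intro arg_cong[where f = sum_list] map_cong) (auto simp: weight_def)
    then have "layer_upto c True n ?Y g = (?Y (idx c v) + (\<Sum>u\<leftarrow>in_nbrs orc v. N - X (idx (\<not> c) u))) mod N"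
      unfolding v(2) layer_upto_eq(1)[OF Y v(1)] by simp
    also have "?Y (idx c v) = (X g + (\<Sum>u\<leftarrow>in_nbrs orc v. X (idx (\<not> c) u))) mod N"
      using layer_upto_eq(1)[OF assms, of v c False] v by (simp add: weight_def)
    also have "((X g + (\<Sum>u\<leftarrow>in_nbrs orc v. X (idx (\<not> c) u))) mod N + (\<Sum>u\<leftarrow>in_nbrs orc v. N - X (idx (\<not> c) u))) mod N
      = (X g + ((\<Sum>u\<leftarrow>in_nbrs orc v. X (idx (\<not> c) u)) + (\<Sum>u\<leftarrow>in_nbrs orc v. N - X (idx (\<not> c) u)))) mod N"
      by (simp add: mod_simps add.assoc)
    also have "(\<Sum>u\<leftarrow>in_nbrs orc v. X (idx (\<not> c) u)) + (\<Sum>u\<leftarrow>in_nbrs orc v. N - X (idx (\<not> c) u)) = deg v * N"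
      using assms nb idx_less by (intro sum_list_complement) (auto simp: valid_def intro: less_imp_le)
    also have "(X g + deg v * N) mod N = X g"
      using assms v idx_less by (simp add: valid_def)
    finally show ?thesis .
  next
    case False
    then show ?thesis
      using layer_upto_eq(2)[OF Y, of g c True] layer_upto_eq(2)[OF assms, of g c False] by auto
  qed
  then show ?thesis by (auto simp: pass_step_def)
qed

lemma pass_inverse:
  "valid X \<Longrightarrow> (pass_step True ^^ k) ((pass_step False ^^ k) (c, X)) = (c, X)"
proof (induction k)
  case (Suc k)
  obtain d Y where P: "(pass_step False ^^ k) (c, X) = (d, Y)" by fastforce
  have "valid Y" using valid_pass[OF Suc.prems, where b = False and k = k and c = c] by (simp add: P)
  then show ?case
    \<comment> \<open>Swapping the powers puts the first backward pass right behind the last forward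
      pass.\<close>
    using Suc by (simp add: funpow_swap1 P pass_step_inverse)
qed simp

definition bumped :: "(nat \<Rightarrow> nat) \<Rightarrow> nat \<Rightarrow> nat" where
  "bumped X = acc False (acc False X (idx False s) (1 mod q)) (idx True s) (1 mod q)"

lemma valid_bumped: "valid X \<Longrightarrow> valid (bumped X)"
  by (simp add: bumped_def valid_acc)

text \<open>The two bumps concern different registers, so undoing them in the original order is
  correct.\<close>

lemma bumped_inverse:
  assumes "valid X"
  shows "acc True (acc True (bumped X) (idx False s) (1 mod q)) (idx True s) (1 mod q) = X"
proof -
  have "((x + y) mod N + (N - y)) mod N = x" if "x < N" "y < N" for x y
  proof -
    have "((x + y) mod N + (N - y)) mod N = (x + y + (N - y)) mod N" by (rule mod_add_left_eq)
    also have "x + y + (N - y) = x + N" using that by simp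
    finally show ?thesis using that by simp
  qed
  then have "((X g + 1 mod q) mod N + (N - 1 mod q)) mod N = X g" if "g < 2 * n" for g
    using assms that one_mod_q(1) by (auto simp only: valid_def)
  moreover have "idx False s \<noteq> idx True s" using st by (simp add: idx_inj)
  ultimately show ?thesis
    using idx_less[OF st(1)] by (auto simp: bumped_def acc_def fun_eq_iff)
qed

lemma bumped_idx: "v < n \<Longrightarrow> valid X \<Longrightarrow> bumped X (idx c v) = (X (idx c v) + 1 mod q * of_bool (v = s)) mod N"
  using st idx_less[of v c] by (cases c) (auto simp: bumped_def acc_def idx_inj valid_def)

text \<open>The difference between the bumped and the original run obeys the recurrence whatever X
  is. The invariant needs two consecutive vectors: the layer to be updated next carries index k, the
  other one index k + 1.\<close>

lemma pass_step_linear: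
  assumes nbrs: "\<And>v. v < n \<Longrightarrow> distinct (in_nbrs orc v) \<and> set (in_nbrs orc v) = {u. (u, v) \<in> parcs G}"
    and X: "valid X"
  defines "P \<equiv> \<lambda>k. (pass_step False ^^ k) (True, X)" and "P' \<equiv> \<lambda>k. (pass_step False ^^ k) (True, bumped X)"
  shows "fst (P' k) = fst (P k) \<and> (\<forall>v<n.
    snd (P' k) (idx (\<not> fst (P k)) v) = (snd (P k) (idx (\<not> fst (P k)) v) + 1 mod q * walk_count G s (Suc k) v) mod N \<and>
    snd (P' k) (idx (fst (P k)) v) = (snd (P k) (idx (fst (P k)) v) + 1 mod q * walk_count G s k v) mod N)"
proof (induction k)
  case 0
  then show ?case using bumped_idx X by (simp add: P_def P'_def)
next
  case (Suc k)
  obtain c Y where P: "P k = (c, Y)" by fastforce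
  define Y' where "Y' = snd (P' k)"
  have P': "P' k = (c, Y')" unfolding Y'_def using Suc.IH by (simp add: P prod_eq_iff)
  have Y: "valid Y" using valid_pass[OF X, where b = False and k = k and c = True] P by (simp add: P_def)
  have Y': "valid Y'"
    using valid_pass[OF valid_bumped[OF X], where b = False and k = k and c = True] P' by (simp add: P'_def)
  have S: "P (Suc k) = (\<not> c, layer_upto c False n Y)" "P' (Suc k) = (\<not> c, layer_upto c False n Y')"
    using P P' by (simp_all add: P_def P'_def pass_step_def)
  let ?d = "1 mod q"
  have IH: "Y' (idx (\<not> c) v) = (Y (idx (\<not> c) v) + ?d * walk_count G s (Suc k) v) mod N"
    "Y' (idx c v) = (Y (idx c v) + ?d * walk_count G s k v) mod N" if "v < n" for v
    using Suc.IH[unfolded P P' fst_conv snd_conv] that by blast+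
  have other: "layer_upto c False n Z (idx (\<not> c) v) = Z (idx (\<not> c) v)" if "v < n" "valid Z" for v Z
    using that by (intro layer_upto_eq(2)) (auto simp: idx_inj)
  have upd: "layer_upto c False n Z (idx c v) = (Z (idx c v) + (\<Sum>u | (u, v) \<in> parcs G. Z (idx (\<not> c) u))) mod N"
    if "v < n" "valid Z" for v Z
    using layer_upto_eq(1)[OF that(2), of v c False] nbrs[OF that(1)] that(1)
    by (simp add: weight_def sum_list_distinct_conv_sum_set)
  have "layer_upto c False n Y' (idx c v) =
      (layer_upto c False n Y (idx c v) + ?d * walk_count G s (Suc (Suc k)) v) mod N" if v: "v < n" for v
  proof -
    have nb: "u < n" if "(u, v) \<in> parcs G" for u
      using that nbrs[OF v] in_nbrs_less[OF v] by auto
    have sum: "(\<Sum>u | (u, v) \<in> parcs G. Y' (idx (\<not> c) u)) =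
        (\<Sum>u | (u, v) \<in> parcs G. (Y (idx (\<not> c) u) + ?d * walk_count G s (Suc k) u) mod N)"
      using nb IH(1) by (intro sum.cong) auto
    \<comment> \<open>The inner reductions modulo N are collected into one, so that the recurrence
      can be applied to unreduced sums.\<close>
    have "layer_upto c False n Y' (idx c v) = ((Y (idx c v) + ?d * walk_count G s k v) mod N +
        (\<Sum>u | (u, v) \<in> parcs G. (Y (idx (\<not> c) u) + ?d * walk_count G s (Suc k) u) mod N) mod N) mod N"
      unfolding upd[OF v Y'] IH(2)[OF v] sum by (simp only: mod_add_right_eq)
    also have "\<dots> = (Y (idx c v) + ?d * walk_count G s k v +
        (\<Sum>u | (u, v) \<in> parcs G. Y (idx (\<not> c) u) + ?d * walk_count G s (Suc k) u)) mod N"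
      by (simp only: mod_sum_eq mod_add_eq)
    also have "Y (idx c v) + ?d * walk_count G s k v +
        (\<Sum>u | (u, v) \<in> parcs G. Y (idx (\<not> c) u) + ?d * walk_count G s (Suc k) u) =
        (Y (idx c v) + (\<Sum>u | (u, v) \<in> parcs G. Y (idx (\<not> c) u))) + ?d * walk_count G s (Suc (Suc k)) v"
      by (simp add: sum.distrib sum_distrib_left distrib_left)
    also have "\<dots> mod N = (layer_upto c False n Y (idx c v) + ?d * walk_count G s (Suc (Suc k)) v) mod N"
      unfolding upd[OF v Y] by (simp only: mod_add_left_eq)
    finally show ?thesis .
  qed
  then show ?case
    unfolding S using other Y Y' IH(1) by simp
qed

text \<open>Since q divides N, the congruence modulo N descends to q, where the factor
  \<open>1 mod q\<close> acts as 1.\<close>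

lemma walked_bumped:
  assumes nbrs: "\<And>v. v < n \<Longrightarrow> distinct (in_nbrs orc v) \<and> set (in_nbrs orc v) = {u. (u, v) \<in> parcs G}"
    and X: "valid X"
  shows "walked (bumped X) mod q = (walked X + walk_count G s (Suc T) t) mod q"
proof -
  let ?P = "(pass_step False ^^ T) (True, X)" and ?P' = "(pass_step False ^^ T) (True, bumped X)"
  have "fst ?P' = fst ?P" "snd ?P' (idx (\<not> fst ?P) t) = (snd ?P (idx (\<not> fst ?P) t) + 1 mod q * walk_count G s (Suc T) t) mod N"
    using pass_step_linear[OF nbrs X, of T] st(2) by auto
  then have "walked (bumped X) = (walked X + 1 mod q * walk_count G s (Suc T) t) mod N"
    unfolding walked_def by (simp add: case_prod_beta)
  then show ?thesis
    using q_dvd_N by (simp add: mod_mod_cancel mod_simps)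
qed

text \<open>\<open>2 ^ l\<close> does not fit on a work tape in general, so r is found by l
  doublings modulo q, starting from \<open>1 mod q\<close>.\<close>

definition prepare :: com where
  "prepare = set_flag layer True ;; zero vd ;; inc vd ;; mod_reduce vd ;; copy vr vd ;;
     for_loop vi vl (copy vrr vr ;; mod_plus vr vrr)"

lemma wp_prepare:
  assumes a: "glob a"
    and post: "\<And>b. ready b \<Longrightarrow> fl b layer \<Longrightarrow> ct b = ct a \<Longrightarrow> clk b \<le> clk a + 26 * (l + 1) \<Longrightarrow> Q b"
  shows "wp prepare Q a"
proof -
  let ?V = "{tmp, vi, vrr, vr, vd}"
  define I where "I j d \<longleftrightarrow> frame ?V {carry_flag, layer} a d \<and> ct d = ct a \<and> fl d layer \<and>
    nv d vd = 1 mod q \<and> nv d vr = 2 ^ j mod q" for j d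
  have I_glob: "glob d" if "I j d" for j d
    using that unfolding I_def by (auto intro: glob_frame[OF a])
  have loop: "wp (for_loop vi vl (copy vrr vr ;; mod_plus vr vrr)) Q c" if c: "I 0 c" "clk c \<le> clk a + 18" for c
  proof (rule wp_for_loop[where I = I and N = l and c = "\<lambda>_. 16"])
    fix j d assume j: "j < l" and I: "I j d" "nv d vi = j"
    have Id: "frame ?V {carry_flag, layer} a d" "ct d = ct a" "fl d layer" "nv d vd = 1 mod q" "nv d vr = 2 ^ j mod q"
      using I by (simp_all add: I_def)
    have "2 ^ j mod q < q" using q_pos by simp
    then have lt: "2 ^ j mod q < q" "2 ^ j mod q < 2 ^ W" using small by linarith+
    have pow: "(2 ^ j mod q + 2 ^ j mod q) mod q = 2 ^ Suc j mod q"
      by (simp add: mod_simps flip: mult_2)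
    show "wp (copy vrr vr ;; mod_plus vr vrr) (\<lambda>a'. I (Suc j) a' \<and> nv a' vi = j \<and> clk a' \<le> clk d + 16) d"
      using Id I(2) lt pow small globD[OF I_glob[OF I(1)]]
      by (intro wp_Seq wp_copy wp_mod_plus) (simp_all add: I_def frame_def)
  next
    show "I j d \<Longrightarrow> frame {tmp, vi} {carry_flag} d e \<Longrightarrow> ct e = ct d \<Longrightarrow> I j e" for j d e
      unfolding I_def by (auto intro: frame_trans simp: frame_nv frame_fl)
  next
    fix d assume d: "I l d" "clk d \<le> clk c + (\<Sum>j<l. 16 + 9) + 8"
    then show "Q d"
      using c(2) I_glob[OF d(1)] by (intro post) (auto simp: I_def ready_def r_def)
  qed (use c(1) small globD[OF I_glob] in auto)
  have w: "Suc 0 < 2 ^ W" "q < 2 ^ W" using small by linarith+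
  have "(1::nat) mod q < 2 ^ W" using w(2) one_mod_q(2) by linarith
  then show ?thesis
    unfolding prepare_def using globD[OF a] w q_pos
    by (intro wp_Seq wp_set_flag wp_zero wp_inc wp_mod_reduce wp_copy loop) (simp_all add: I_def frame_def)
qed

text \<open>Subtraction of residues: q is added beforehand if the difference would be
  negative.\<close>

definition finish :: com where
  "finish = less vw 0 ;; If_flag carry_flag (plus vw vq) Skip ;; minus vw 0 ;; copy 0 vw"

lemma wp_finish:
  assumes "nv a vw < q" "nv a 0 < q" "nv a vq = q"
    and post: "\<And>b. nv b 0 = (nv a vw + (q - nv a 0)) mod q \<Longrightarrow> ct b = ct a \<Longrightarrow> clk b \<le> clk a + 16 \<Longrightarrow> Q b"
  shows "wp finish Q a"
proof -
  have r: "(nv a vw + (q - nv a 0)) mod q = (if nv a vw < nv a 0 then nv a vw + q - nv a 0 else nv a vw - nv a 0)"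
  proof (cases "nv a vw < nv a 0")
    case False
    then have "nv a vw + (q - nv a 0) = nv a vw - nv a 0 + q" using assms(2) by simp
    then show ?thesis using False assms(1) by (simp only: mod_add_self2) simp
  qed (use assms(2) in auto)
  have "nv a vw < 2 ^ W" "nv a 0 < 2 ^ W" "nv a vw + q < 2 ^ W" "q < 2 ^ W"
    using assms(1,2) small by linarith+
  then show ?thesis
    unfolding finish_def using assms(1-3) r
    by (intro wp_Seq wp_less wp_If_flag wp_plus wp_Skip wp_minus wp_copy) (auto intro!: post)
qed

definition main :: com where
  "main = prepare ;; phase ;; copy 0 vw ;; half_bump add_mod False ;; half_bump add_mod True ;;
     phase ;; half_bump sub_mod False ;; half_bump sub_mod True ;; finish"

text \<open>514 = 26 + 4 * 122 stands for the preparation and the four half bumps, 19 = 3 + 16 for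
  saving the first value and for the final subtraction.\<close>

definition main_cost :: nat where
  "main_cost = 2 * phase_cost + 514 * (l + 1) + 19"

lemma wp_main:
  assumes nbrs: "\<And>v. v < n \<Longrightarrow> distinct (in_nbrs orc v) \<and> set (in_nbrs orc v) = {u. (u, v) \<in> parcs G}"
    and a: "glob a" "ct a = stored X" "valid X"
    and post: "\<And>b. nv b 0 = walk_count G s (Suc T) t mod q \<Longrightarrow> ct b = stored X \<Longrightarrow> clk b \<le> clk a + main_cost \<Longrightarrow> Q b"
  shows "wp main Q a"
  unfolding main_def
proof (rule wp_Seq, rule wp_prepare[OF a(1)])
  fix b1 assume b1: "ready b1" "fl b1 layer" "ct b1 = ct a" "clk b1 \<le> clk a + 26 * (l + 1)"
  note pf = pass_inverse[of _ T True]
  let ?rest4 = "phase ;; half_bump sub_mod False ;; half_bump sub_mod True ;; finish"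
  let ?rest3 = "half_bump add_mod False ;; half_bump add_mod True ;; ?rest4"
  show "wp (phase ;; copy 0 vw ;; ?rest3) Q b1"
  proof (rule wp_Seq, rule wp_phase[where X = X])
    fix b2 assume b2: "frame phase_vars {carry_flag, fx, fy, fg, backward} b1 b2" "ct b2 = stored X"
      "nv b2 vw = walked X mod q" "clk b2 \<le> clk b1 + phase_cost"
    have w1: "walked X mod q < q" using q_pos by simp
    have b3: "wp ?rest3 Q b3" if b3: "frame (phase_vars \<union> {0}) {carry_flag, fx, fy, fg, backward} b1 b3"
       "ct b3 = stored X" "nv b3 0 = walked X mod q" "clk b3 \<le> clk b2 + 3" for b3
    proof -
      have r3: "ready b3" using b3(1) by (rule ready_frame[OF b1(1)]) auto
      let ?X1 = "acc False X (idx False s) (1 mod q)"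
      show ?thesis
      proof (rule wp_Seq, rule wp_half_bump[where b = False and X = X])
        fix b4 assume b4: "frame (scratch \<union> {vbx}) scratch_flags b3 b4" "ct b4 = stored ?X1" "clk b4 \<le> clk b3 + 122 * (l + 1)"
        have r4: "ready b4" using b4(1) by (rule ready_frame[OF r3]) auto
        show "wp (half_bump add_mod True ;; ?rest4) Q b4"
        proof (rule wp_Seq, rule wp_half_bump[where b = False and X = ?X1])
          fix b5 assume b5: "frame (scratch \<union> {vbx}) scratch_flags b4 b5"
            "ct b5 = stored (acc False ?X1 (idx True s) (1 mod q))" "clk b5 \<le> clk b4 + 122 * (l + 1)"
          have r5: "ready b5" using b5(1) by (rule ready_frame[OF r4]) auto
          have l5: "fl b5 layer" "nv b5 0 = walked X mod q"
            using b1(2) frame_fl[OF b3(1)] frame_fl[OF b4(1)] frame_fl[OF b5(1)]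
              frame_nv[OF b4(1)] frame_nv[OF b5(1)] b3(3) by simp_all
          have c5: "ct b5 = stored (bumped X)" using b5(2) by (simp add: bumped_def)
          show "wp ?rest4 Q b5"
          proof (rule wp_Seq, rule wp_phase[where X = "bumped X"])
            fix b6 assume b6: "frame phase_vars {carry_flag, fx, fy, fg, backward} b5 b6" "ct b6 = stored (bumped X)"
              "nv b6 vw = walked (bumped X) mod q" "clk b6 \<le> clk b5 + phase_cost"
            have r6: "ready b6" using b6(1) by (rule ready_frame[OF r5]) auto
            let ?X2 = "acc True (bumped X) (idx False s) (1 mod q)"
            show "wp (half_bump sub_mod False ;; half_bump sub_mod True ;; finish) Q b6"
            proof (rule wp_Seq, rule wp_half_bump[where b = True and X = "bumped X"])
              fix b7 assume b7: "frame (scratch \<union> {vbx}) scratch_flags b6 b7" "ct b7 = stored ?X2"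
                "clk b7 \<le> clk b6 + 122 * (l + 1)"
              have r7: "ready b7" using b7(1) by (rule ready_frame[OF r6]) auto
              show "wp (half_bump sub_mod True ;; finish) Q b7"
              proof (rule wp_Seq, rule wp_half_bump[where b = True and X = ?X2])
                fix b8 assume b8: "frame (scratch \<union> {vbx}) scratch_flags b7 b8"
                  "ct b8 = stored (acc True ?X2 (idx True s) (1 mod q))" "clk b8 \<le> clk b7 + 122 * (l + 1)"
                have r8: "ready b8" using b8(1) by (rule ready_frame[OF r7]) auto
                have v8: "nv b8 vw = walked (bumped X) mod q" "nv b8 0 = walked X mod q"
                  using frame_nv[OF b8(1)] frame_nv[OF b7(1)] frame_nv[OF b6(1)] b6(3) l5(2) by simp_all
                have c8: "ct b8 = stored X" using b8(2) bumped_inverse[OF a(3)] by simp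
                let ?z = "walk_count G s (Suc T) t"
                have "(walked (bumped X) mod q + (q - walked X mod q)) mod q =
                    ((walked X + ?z) mod q + (q - walked X mod q)) mod q"
                  by (simp only: walked_bumped[OF nbrs a(3)])
                also have "\<dots> = ((walked X mod q + ?z) + (q - walked X mod q)) mod q"
                  by (simp only: mod_add_left_eq add.assoc)
                also have "(walked X mod q + ?z) + (q - walked X mod q) = ?z + q" using w1 by simp
                finally have res: "(walked (bumped X) mod q + (q - walked X mod q)) mod q = ?z mod q" by simp
                show "wp finish Q b8"
                proof (rule wp_finish)
                  fix b9 :: astate assume "nv b9 0 = (nv b8 vw + (q - nv b8 0)) mod q" "ct b9 = ct b8" "clk b9 \<le> clk b8 + 16"
                  then show "Q b9"
                    using res v8 c8 b8(3) b7(3) b6(4) b5(3) b4(3) b3(4) b2(4) b1(4)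
                    by (intro post) (auto simp: main_cost_def)
                qed (use v8 q_pos r8 in \<open>auto simp: ready_def glob_def\<close>)
              qed (use r7 b7 valid_acc valid_bumped a(3) in auto)
            qed (use r6 b6 valid_bumped a(3) in auto)
          qed (use r5 c5 valid_bumped a(3) l5 pf in auto)
        qed (use r4 b4 valid_acc a(3) in auto)
      qed (use r3 b3 a(3) in auto)
    qed
    have "nv b2 vw < 2 ^ W" using w1 b2(3) small by linarith
    moreover have "frame (phase_vars \<union> {0}) {carry_flag, fx, fy, fg, backward} b1
        (b2\<lparr>nv := (nv b2)(0 := nv b2 vw), fl := (fl b2)(carry_flag := False), clk := k\<rparr>)" for k
      using b2(1) by (simp add: frame_def) (simp add: agree_def)
    ultimately show "wp (copy 0 vw ;; ?rest3) Q b2"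
      using b2 by (intro wp_Seq[of "copy 0 vw"] wp_copy b3) simp_all
  qed (use b1 a pf in auto)
qed

end

section \<open>Walk counts\<close>

text \<open>The recurrence counts walks, while the claim is about paths; cutting out cycles never
  lengthens a walk.\<close>

lemma (in wf_digraph) apath_of_awalk:
  assumes "awalk u p v"
  shows "\<exists>p'. apath u p' v \<and> length p' \<le> length p"
  using assms
proof (induct rule: awalk_to_apath_induct)
  case (path p)
  then show ?case by (auto simp: apath_def)
next
  case (decomp p q r s)
  have "p = q @ r @ s"
    using awalk_cyc_decomp_has_prop[OF decomp(1,3)] decomp(2) by auto
  then show ?case using decomp(4) by fastforce
qed

text \<open>The term two indices back keeps s positive forever, provided that both initial vectors
  are positive there.\<close>

lemma walk_count_start: "0 < walk_count G s k s"
  by (induction G s k s rule: walk_count.induct) auto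

context pair_fin_digraph
begin

lemma finite_in_nbrs: "finite {u. (u, v) \<in> parcs G}"
  by (rule finite_subset[OF _ pair_finite_verts]) (auto dest: in_arcsD1)

text \<open>Induction step: in-degrees are at most the number c of vertices, and
  \<open>c * (c + 1) ^ k + (c + 1) ^ k = (c + 1) ^ (k + 1)\<close>. The truncated exponent yields
  the bound 1 for both initial vectors.\<close>

lemma walk_count_le: "walk_count G s k v \<le> (card (pverts G) + 1) ^ (k - 1)"
proof -
  \<comment> \<open>The graph is an argument of the recursion, so its induction rule needs a
    variable in that place.\<close>
  have "walk_count H s k v \<le> (card (pverts G) + 1) ^ (k - 1)" if "H = G" for H
    using that
  proof (induction H s k v rule: walk_count.induct)
    case (3 H s k v)
    let ?c = "card (pverts G)"
    have "(\<Sum>u | (u, v) \<in> parcs G. walk_count G s (Suc k) u) \<le> card {u. (u, v) \<in> parcs G} * (?c + 1) ^ k"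
      using 3 sum_bounded_above[of "{u. (u, v) \<in> parcs G}" "walk_count G s (Suc k)" "(?c + 1) ^ k"] by simp
    also have "card {u. (u, v) \<in> parcs G} \<le> ?c"
      by (rule card_mono[OF pair_finite_verts]) (auto dest: in_arcsD1)
    finally have "(\<Sum>u | (u, v) \<in> parcs G. walk_count G s (Suc k) u) \<le> ?c * (?c + 1) ^ k"
      by simp
    moreover have "walk_count G s k v \<le> (?c + 1) ^ (k - 1)" using 3 by simp
    moreover have "(?c + 1) ^ (k - 1) \<le> (?c + 1) ^ k" by (rule power_increasing) auto
    ultimately show ?case using 3(3) by simp
  qed auto
  then show ?thesis by simp
qed

text \<open>A positive value comes either from two indices back, with the same walk, or from an
  in-neighbour, whose walk is extended by one arc. The first case calls for strong
  induction.\<close>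

lemma walk_of_count:
  "walk_count G s k v \<noteq> 0 \<Longrightarrow> s \<in> pverts G \<Longrightarrow> \<exists>p. awalk s p v \<and> length p \<le> k - 1"
proof (induction k arbitrary: v rule: less_induct)
  case (less k)
  consider "k \<le> 1" | k' where "k = Suc (Suc k')" by (cases k; cases "k - 1") auto
  then show ?case
  proof cases
    case 1
    then have "v = s" using less.prems by (cases k) (auto split: if_splits)
    then show ?thesis using less.prems by (intro exI[of _ "[]"]) (auto simp: awalk_Nil_iff)
  next
    case 2
    then consider "walk_count G s k' v \<noteq> 0" | u where "(u, v) \<in> parcs G" "walk_count G s (Suc k') u \<noteq> 0"
      using less.prems(1) finite_in_nbrs by auto
    then show ?thesis
    proof cases
      case 1
      then show ?thesis using less.IH[of k' v] less.prems 2 by fastforce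
    next
      case (2 u)
      then obtain p where "awalk s p u" "length p \<le> k'"
        using less.IH[of "Suc k'" u] less.prems \<open>k = _\<close> by auto
      then show ?thesis
        using 2 \<open>k = _\<close> by (intro exI[of _ "p @ [(u, v)]"]) (auto simp: awalk_simps dest: in_arcsD2)
    qed
  qed
qed

text \<open>Arcs are removed from the end of the walk; any slack between its length and k is
  absorbed at s, where all indices have positive counts.\<close>

lemma count_of_walk:
  "awalk s p v \<Longrightarrow> length p \<le> k \<Longrightarrow> walk_count G s (Suc k) v \<noteq> 0"
proof (induction p arbitrary: v k rule: rev_induct)
  case Nil
  then show ?case using walk_count_start[of G s "Suc k"] by (simp add: awalk_Nil_iff)
next
  case (snoc e p)
  obtain k' where k: "k = Suc k'" using snoc.prems(2) by (cases k) auto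
  have e: "e \<in> parcs G" "v = snd e" "awalk s p (fst e)"
    using snoc.prems(1) by (auto simp: awalk_simps)
  then have "walk_count G s (Suc k') (fst e) \<noteq> 0"
    using snoc.IH[of "fst e" k'] snoc.prems(2) k by simp
  then have "(\<Sum>u | (u, v) \<in> parcs G. walk_count G s (Suc k') u) \<noteq> 0"
    using e(1,2) finite_in_nbrs[of v] by (cases e) (auto simp: sum_eq_0_iff)
  then show ?case by (simp add: k)
qed

lemma walk_count_neq_0_iff:
  assumes "s \<in> pverts G"
  shows "walk_count G s (Suc T) t \<noteq> 0 \<longleftrightarrow> (\<exists>p. apath s p t \<and> length p \<le> T)"
  using walk_of_count[of s "Suc T" t] count_of_walk[of s _ t T] apath_of_awalk[of s _ t] assms awalkI_apath
  by (metis diff_Suc_1 order_trans)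

end

section \<open>Reading the input\<close>

definition mark :: com where
  "mark = Instr (MoveRight ruler) ;; Instr (Write ruler (Bit True))"

text \<open>
  One mark is put on the ruler for every cell of the input, separators included; a ruler of that
  length gives tapes enough room for all intermediate results.
\<close>

definition read_number :: "nat \<Rightarrow> com" where
  "read_number i = Instr InputRight ;;
     UntilInput Blank (Instr (MoveRight i) ;;
       CondInput (Bit True) (Instr (Write i (Bit True))) (Instr (Write i (Bit False))) ;;
       mark ;; Instr InputRight) ;;
     mark ;; Until i Start (Instr (MoveLeft i))"

definition reading :: "nat \<Rightarrow> symbol list \<Rightarrow> bool list \<Rightarrow> (nat \<Rightarrow> bool list) \<Rightarrow> (nat \<Rightarrow> nat) \<Rightarrow> nat \<Rightarrow> nat \<Rightarrow> config" where
  "reading S ics cat ws ps P R = \<lparr>pc = 0, input = \<lparr>pos = P, cells = ics\<rparr>,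
     work = (\<lambda>i. if i = ruler then ptape S (replicate R True) R else ptape S (ws i) (ps i)), catalytic = cat\<rparr>"

lemma runs_mark:
  assumes "R < S"
  shows "runs orc mark (reading S ics cat ws ps P R) 2 (reading S ics cat ws ps P (Suc R))"
proof -
  have "ptape S (replicate R True @ [True]) (Suc R) = ptape S (replicate (Suc R) True) (Suc R)"
    by (simp only: replicate_append_same replicate_Suc)
  then have p: "put (Bit True) (ptape S (replicate R True) (Suc R)) = ptape S (replicate (Suc R) True) (Suc R)"
    using put_ptape_end[of "replicate R True" S True] assms by simp
  have "runs orc mark (reading S ics cat ws ps P R) (1 + 1) (reading S ics cat ws ps P (Suc R))"
    unfolding mark_def
  proof (rule runs_Seq[OF runs_MoveRight[OF _ refl] runs_Write])
    show "move_right (work (reading S ics cat ws ps P R) ruler) = Some (ptape S (replicate R True) (Suc R))"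
      using assms by (simp add: reading_def move_right_ptape)
  qed (use p in \<open>auto simp: reading_def fun_eq_iff\<close>)
  then show ?thesis by (simp add: numeral_2_eq_2)
qed

lemma runs_InputRight_reading:
  "Suc P < length ics \<Longrightarrow> runs orc (Instr InputRight) (reading S ics cat ws ps P R) 1 (reading S ics cat ws ps (Suc P) R)"
  by (rule runs_InputRight) (auto simp: reading_def move_right_def)

lemma runs_rewind:
  assumes "work c i = ptape S bs (length bs)" "length bs \<le> S"
  shows "runs orc (Until i Start (Instr (MoveLeft i))) c (length bs * 3 + 1)
    (c\<lparr>work := (work c)(i := ptape S bs 0)\<rparr>)"
proof -
  let ?k = "length bs"
  let ?\<sigma> = "\<lambda>j. c\<lparr>work := (work c)(i := ptape S bs (?k - j))\<rparr>"
  have "runs orc (Until i Start (Instr (MoveLeft i))) (?\<sigma> 0) (?k * (1 + 2) + 1) (?\<sigma> ?k)"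
  proof (rule runs_Until_iterate)
    fix j assume j: "j < ?k"
    then obtain p where p: "?k - j = Suc p" "?k - Suc j = p" "p < ?k" by (cases "?k - j") auto
    show "scan (work (?\<sigma> j) i) \<noteq> Start"
      unfolding p using assms p(3) by (simp add: scan_ptape_Suc)
    show "runs orc (Instr (MoveLeft i)) (?\<sigma> j) 1 (?\<sigma> (Suc j))"
      unfolding p using assms by (intro runs_MoveLeft) (simp add: move_left_ptape)
  qed simp
  moreover have "?\<sigma> 0 = c"
    using assms by (simp add: fun_upd_idem)
  ultimately have "runs orc (Until i Start (Instr (MoveLeft i))) c (?k * (1 + 2) + 1) (c\<lparr>work := (work c)(i := ptape S bs 0)\<rparr>)"
    by (simp only: diff_self_eq_0)
  then show ?thesis by (rule runs_mono) simp
qed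

lemma runs_read_number:
  assumes i: "i \<noteq> ruler" "ws i = []" "ps i = 0"
    and bs: "\<And>j. j < length bs \<Longrightarrow> ics ! (Suc P + j) = Bit (bs ! j)" "ics ! (Suc P + length bs) = Blank"
    and len: "Suc P + length bs < length ics" "R + length bs < S"
  shows "runs orc (read_number i) (reading S ics cat ws ps P R) (12 * (length bs + 1))
    (reading S ics cat (ws(i := bs)) ps (Suc P + length bs) (Suc R + length bs))"
proof -
  let ?k = "length bs"
  let ?B = "Instr (MoveRight i) ;;
       CondInput (Bit True) (Instr (Write i (Bit True))) (Instr (Write i (Bit False))) ;;
       mark ;; Instr InputRight"
  let ?\<sigma> = "\<lambda>j. reading S ics cat (ws(i := take j bs)) (ps(i := j)) (Suc P + j) (R + j)"
  have 1: "runs orc (Instr InputRight) (reading S ics cat ws ps P R) 1 (?\<sigma> 0)"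
    using runs_InputRight_reading[of P ics] len i by (simp add: fun_upd_idem)
  have 2: "runs orc (UntilInput Blank ?B) (?\<sigma> 0) (?k * (7 + 2) + 1) (?\<sigma> ?k)"
  proof (rule runs_UntilInput_iterate)
    fix j assume j: "j < ?k"
    have sc: "scan (input (reading S ics cat ws' ps' (Suc P + j) R')) = Bit (bs ! j)" for ws' ps' R'
      using bs(1)[OF j] by (simp add: reading_def scan_def)
    then show "scan (input (?\<sigma> j)) \<noteq> Blank" by simp
    let ?a = "reading S ics cat (ws(i := take j bs)) (ps(i := Suc j)) (Suc P + j) (R + j)"
    let ?b = "reading S ics cat (ws(i := take (Suc j) bs)) (ps(i := Suc j)) (Suc P + j) (R + j)"
    have a: "runs orc (Instr (MoveRight i)) (?\<sigma> j) 1 ?a"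
    proof (rule runs_MoveRight)
      show "move_right (work (?\<sigma> j) i) = Some (ptape S (take j bs) (Suc j))"
        using i j len by (simp add: reading_def move_right_ptape)
    qed (use i in \<open>auto simp: reading_def fun_eq_iff\<close>)
    have "put (Bit (bs ! j)) (ptape S (take j bs) (Suc j)) = ptape S (take (Suc j) bs) (Suc j)"
      using put_ptape_end[of "take j bs" S "bs ! j"] j len by (simp add: take_Suc_conv_app_nth)
    then have w: "runs orc (Instr (Write i (Bit (bs ! j)))) ?a 1 ?b"
      using i by (intro runs_Write) (auto simp: reading_def fun_eq_iff)
    have b: "runs orc (CondInput (Bit True) (Instr (Write i (Bit True))) (Instr (Write i (Bit False)))) ?a (1 + 2) ?b"
    proof (rule runs_CondInput)
      show "runs orc (Instr (Write i (Bit True))) ?a 1 ?b" if "scan (input ?a) = Bit True"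
        using w that sc by simp
      show "runs orc (Instr (Write i (Bit False))) ?a 1 ?b" if "scan (input ?a) \<noteq> Bit True"
        using w that sc by simp
    qed
    have "runs orc ?B (?\<sigma> j) (1 + ((1 + 2) + (2 + 1))) (reading S ics cat (ws(i := take (Suc j) bs)) (ps(i := Suc j)) (Suc (Suc P + j)) (Suc (R + j)))"
      using j len by (intro runs_Seq[OF a runs_Seq[OF b runs_Seq[OF runs_mark runs_InputRight_reading]]]) auto
    then show "runs orc ?B (?\<sigma> j) 7 (?\<sigma> (Suc j))" by simp
  next
    show "scan (input (?\<sigma> ?k)) = Blank"
      using bs(2) by (simp add: reading_def scan_def)
  qed
  have 3: "runs orc mark (?\<sigma> ?k) 2 (reading S ics cat (ws(i := bs)) (ps(i := ?k)) (Suc P + ?k) (Suc R + ?k))"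
    using runs_mark[of "R + ?k" S] len by simp
  have 4: "runs orc (Until i Start (Instr (MoveLeft i)))
     (reading S ics cat (ws(i := bs)) (ps(i := ?k)) (Suc P + ?k) (Suc R + ?k)) (?k * 3 + 1)
     (reading S ics cat (ws(i := bs)) ps (Suc P + ?k) (Suc R + ?k))"
    by (rule runs_rewind[where bs = bs and S = S, THEN back_subst[where P = "runs _ _ _ _"]])
       (use i len in \<open>auto simp: reading_def fun_eq_iff\<close>)
  show ?thesis
    unfolding read_number_def
    by (rule runs_mono[OF runs_Seq[OF 1 runs_Seq[OF 2 runs_Seq[OF 3 4]]]]) simp
qed

primrec read_numbers :: "nat list \<Rightarrow> com" where
  "read_numbers [] = Skip"
| "read_numbers (i # is) = read_number i ;; read_numbers is"

text \<open>The position on the input and the number of marks on the ruler agree throughout: both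
  are the length of the part already read, \<open>pre\<close>.\<close>

lemma runs_read_numbers:
  assumes "distinct is" "ruler \<notin> set is" "length is = length xs" "\<And>i. i \<in> set is \<Longrightarrow> ws i = []"
    and "ics = Start # pre @ concat (map (\<lambda>x. map Bit (bin x) @ [Blank]) xs)" "length ics \<le> S"
  shows "runs orc (read_numbers is) (reading S ics cat ws (\<lambda>_. 0) (length pre) (length pre))
    (12 * (\<Sum>x\<leftarrow>xs. length (bin x) + 1))
    (reading S ics cat (\<lambda>i. case map_of (zip is xs) i of None \<Rightarrow> ws i | Some x \<Rightarrow> bin x) (\<lambda>_. 0)
      (length ics - 1) (length ics - 1))"
  using assms
proof (induction "is" arbitrary: xs pre ws)
  case Nil
  then show ?case by auto
next
  case (Cons i "is")
  obtain x ys where xs: "xs = x # ys" using Cons.prems(3) by (cases xs) auto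
  let ?pre = "pre @ map Bit (bin x) @ [Blank]"
  have ics: "ics = Start # pre @ map Bit (bin x) @ Blank # concat (map (\<lambda>x. map Bit (bin x) @ [Blank]) ys)"
    using Cons.prems(5) by (simp add: xs)
  have 1: "runs orc (read_number i) (reading S ics cat ws (\<lambda>_. 0) (length pre) (length pre)) (12 * (length (bin x) + 1))
    (reading S ics cat (ws(i := bin x)) (\<lambda>_. 0) (Suc (length pre) + length (bin x)) (Suc (length pre) + length (bin x)))"
  proof (rule runs_read_number)
    show "j < length (bin x) \<Longrightarrow> ics ! (Suc (length pre) + j) = Bit (bin x ! j)" for j
      by (simp add: ics nth_append)
    show "ics ! (Suc (length pre) + length (bin x)) = Blank"
      by (simp add: ics nth_append)
  qed (use Cons.prems(1,2,4,6) ics in auto)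
  have p: "length ?pre = Suc (length pre) + length (bin x)" by simp
  have 2: "runs orc (read_numbers is) (reading S ics cat (ws(i := bin x)) (\<lambda>_. 0) (length ?pre) (length ?pre))
    (12 * (\<Sum>x\<leftarrow>ys. length (bin x) + 1))
    (reading S ics cat (\<lambda>j. case map_of (zip is ys) j of None \<Rightarrow> (ws(i := bin x)) j | Some x \<Rightarrow> bin x) (\<lambda>_. 0)
      (length ics - 1) (length ics - 1))"
    using Cons.prems by (intro Cons.IH) (auto simp: xs)
  have "(\<lambda>j. case map_of (zip is ys) j of None \<Rightarrow> (ws(i := bin x)) j | Some x \<Rightarrow> bin x) =
      (\<lambda>j. case map_of (zip (i # is) xs) j of None \<Rightarrow> ws j | Some x \<Rightarrow> bin x)"
  proof
    fix j
    have "map_of (zip is ys) i = None"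
      using Cons.prems(1) by (auto simp: map_of_eq_None_iff dest: set_zip_leftD)
    then show "(case map_of (zip is ys) j of None \<Rightarrow> (ws(i := bin x)) j | Some x \<Rightarrow> bin x) =
      (case map_of (zip (i # is) xs) j of None \<Rightarrow> ws j | Some x \<Rightarrow> bin x)"
      by (auto simp: xs split: option.splits)
  qed
  then show ?case
    using runs_Seq[OF 1 2[unfolded p]] by (simp add: xs algebra_simps)
qed

primrec pad_all :: "nat list \<Rightarrow> com" where
  "pad_all [] = Skip"
| "pad_all (x # xs) = machine.pad x ;; pad_all xs"

primrec clear_flags :: "nat list \<Rightarrow> com" where
  "clear_flags [] = Skip"
| "clear_flags (f # fs) = Instr (Write f (Bit False)) ;; clear_flags fs"

text \<open>All number tapes are padded, not only those with input: an empty tape becomes the number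
  0, which is how \<open>v0\<close> gets its value.\<close>

definition init :: com where
  "init = read_numbers [vn, vl, vq, vT, vs, vt] ;; Until ruler Start (Instr (MoveLeft ruler)) ;;
     pad_all [0..<32] ;; clear_flags [34..<40]"


lemma put_start: "put (Bit b) (ptape S [] 0) = ftape S b"
  by (simp add: put_def ptape_def ftape_def)

lemma length_input_cells:
  "length (concat (map (\<lambda>x. map Bit (bin x) @ [Blank]) xs)) = (\<Sum>x\<leftarrow>xs. length (bin x) + 1)"
  by (induction xs) auto

context machine
begin

definition stage :: "(nat \<Rightarrow> bool list) \<Rightarrow> nat set \<Rightarrow> bool list \<Rightarrow> config" where
  "stage ws F cat = \<lparr>pc = 0, input = inp, work = (\<lambda>i. if i = ruler then ptape S (replicate W True) 0
     else if i \<in> F then ftape S False else ptape S (ws i) 0), catalytic = cat\<rparr>"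

lemma runs_pad_all:
  assumes "distinct xs" "\<And>x. x \<in> set xs \<Longrightarrow> x < 32 \<and> length (ws x) \<le> W" "ws dummy = []"
  shows "runs orc (pad_all xs) (stage ws {} cat) (length xs * (21 * (W + 1)))
    (stage (\<lambda>i. if i \<in> set xs then ws i @ replicate (W - length (ws i)) False else ws i) {} cat)"
  using assms
proof (induction xs arbitrary: ws)
  case Nil
  then show ?case by auto
next
  case (Cons x xs)
  let ?bs = "ws x @ replicate (W - length (ws x)) False"
  let ?ws = "ws(x := ?bs)"
  have x: "x < 32" "length (ws x) \<le> W" "x \<notin> set xs" using Cons.prems by auto
  then have dummy: "x \<noteq> dummy" by auto
  have "stage ws {} cat = aligned S W x dummy (stage ws {} cat) 0 (ws x) []"
    using x Cons.prems(3) by (auto simp: stage_def aligned_def fun_eq_iff)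
  moreover have "stage ?ws {} cat = aligned S W x dummy (stage ws {} cat) 0 ?bs []"
    using x Cons.prems(3) by (auto simp: stage_def aligned_def fun_eq_iff)
  ultimately have 1: "runs orc (pad x) (stage ws {} cat) (21 * (W + 1)) (stage ?ws {} cat)"
    using runs_pad[OF x(1,2), of "stage ws {} cat"] by simp
  have 2: "runs orc (pad_all xs) (stage ?ws {} cat) (length xs * (21 * (W + 1)))
    (stage (\<lambda>i. if i \<in> set xs then ?ws i @ replicate (W - length (?ws i)) False else ?ws i) {} cat)"
    using Cons.prems(1,3) Cons.prems(2) x dummy by (intro Cons.IH) auto
  have "(\<lambda>i. if i \<in> set xs then ?ws i @ replicate (W - length (?ws i)) False else ?ws i) =
    (\<lambda>i. if i \<in> set (x # xs) then ws i @ replicate (W - length (ws i)) False else ws i)"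
    using x by auto
  then show ?case
    using runs_Seq[OF 1 2] by (simp add: algebra_simps)
qed

lemma runs_clear_flags:
  assumes "\<And>f. f \<in> set fs \<Longrightarrow> f \<noteq> ruler \<and> ws f = []" "distinct fs" "F \<inter> set fs = {}"
  shows "runs orc (clear_flags fs) (stage ws F cat) (length fs) (stage ws (F \<union> set fs) cat)"
  using assms
proof (induction fs arbitrary: F)
  case Nil
  then show ?case by auto
next
  case (Cons f fs)
  have "runs orc (Instr (Write f (Bit False))) (stage ws F cat) 1 (stage ws (insert f F) cat)"
    using Cons.prems by (intro runs_Write) (auto simp: stage_def fun_eq_iff put_start)
  moreover have "runs orc (clear_flags fs) (stage ws (insert f F) cat) (length fs) (stage ws (insert f F \<union> set fs) cat)"
    using Cons.prems by (intro Cons.IH) auto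
  ultimately have "runs orc (clear_flags (f # fs)) (stage ws F cat) (1 + length fs) (stage ws (insert f F \<union> set fs) cat)"
    unfolding clear_flags.simps by (rule runs_Seq)
  then show ?case by simp
qed

definition start_state :: "nat list \<Rightarrow> bool list \<Rightarrow> astate" where
  "start_state xs cat = \<lparr>nv = (\<lambda>i. if 1 \<le> i \<and> i \<le> 6 then xs ! (i - 1) else 0), fl = (\<lambda>_. False), ct = cat, clk = 0\<rparr>"

lemma runs_init:
  assumes xs: "length xs = 6" and W: "W = (\<Sum>x\<leftarrow>xs. length (bin x) + 1)"
    and inp: "inp = (input_tape xs)\<lparr>pos := W\<rparr>"
  shows "runs orc init (initial S xs cat) (700 * (W + 1)) (conc (start_state xs cat))"
proof -
  define ics where "ics = Start # concat (map (\<lambda>x. map Bit (bin x) @ [Blank]) xs)"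
  let ?is = "[vn, vl, vq, vT, vs, vt]"
  let ?ws0 = "\<lambda>i. case map_of (zip ?is xs) i of None \<Rightarrow> [] | Some x \<Rightarrow> bin x"
  let ?nv = "nv (start_state xs cat)"
  define ws where "ws = (\<lambda>i. bin (?nv i))"
  have len: "length ics = W + 1"
    by (simp add: ics_def W length_input_cells)
  have le: "length (bin x) \<le> W" if "x \<in> set xs" for x
    using that unfolding W by (induction xs) auto
  have ws0: "?ws0 = ws"
    unfolding ws_def
  proof
    fix i :: nat
    obtain a b c d e f where abc: "xs = [a, b, c, d, e, f]"
      using xs by (auto simp: numeral_eq_Suc length_Suc_conv)
    have "i = 0 \<or> i = 1 \<or> i = 2 \<or> i = 3 \<or> i = 4 \<or> i = 5 \<or> i = 6 \<or> 6 < i" by arith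
    then show "?ws0 i = bin (?nv i)"
      by (elim disjE) (simp_all add: abc start_state_def)
  qed
  have nv_le: "length (bin (?nv i)) \<le> W" "?nv i < 2 ^ W" for i
  proof -
    show *: "length (bin (?nv i)) \<le> W"
      using le[OF nth_mem, of "i - 1"] xs by (auto simp: start_state_def)
    show "?nv i < 2 ^ W"
      by (rule less_le_trans[OF less_power_length_bin power_increasing[OF *]]) simp
  qed
  have "initial S xs cat = reading S ics cat (\<lambda>_. []) (\<lambda>_. 0) 0 0"
    by (auto simp: initial_def reading_def input_tape_def ics_def ptape_def fun_eq_iff)
  then have "runs orc (read_numbers ?is) (initial S xs cat) (12 * W) (reading S ics cat ?ws0 (\<lambda>_. 0) W W)"
    using runs_read_numbers[of ?is xs "\<lambda>_. []" ics "[]" S orc cat] xs len WS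
    by (simp add: ics_def W)
  note 1 = this[unfolded ws0]
  have inp': "inp = \<lparr>pos = W, cells = ics\<rparr>"
    by (simp add: inp input_tape_def ics_def)
  have stage0: "(reading S ics cat ws (\<lambda>_. 0) W W)\<lparr>work := (work (reading S ics cat ws (\<lambda>_. 0) W W))(ruler := ptape S (replicate W True) 0)\<rparr>
     = stage ws {} cat"
    by (auto simp: reading_def stage_def fun_eq_iff simp flip: inp')
  have 2: "runs orc (Until ruler Start (Instr (MoveLeft ruler))) (reading S ics cat ws (\<lambda>_. 0) W W) (W * 3 + 1) (stage ws {} cat)"
    using runs_rewind[of "reading S ics cat ws (\<lambda>_. 0) W W" ruler S "replicate W True" orc] WS
    unfolding stage0[symmetric] by (simp add: reading_def)
  let ?ws' = "\<lambda>i. if i \<in> set [0..<32] then ws i @ replicate (W - length (ws i)) False else ws i"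
  have 3: "runs orc (pad_all [0..<32]) (stage ws {} cat) (length [0..<32] * (21 * (W + 1))) (stage ?ws' {} cat)"
    unfolding ws_def using nv_le by (intro runs_pad_all) (auto simp: start_state_def)
  have 4: "runs orc (clear_flags [34..<40]) (stage ?ws' {} cat) (length [34..<40]) (stage ?ws' ({} \<union> set [34..<40]) cat)"
    unfolding ws_def by (intro runs_clear_flags) (auto simp: start_state_def)
  have 5: "stage ?ws' ({} \<union> set [34..<40]) cat = conc (start_state xs cat)"
    unfolding ws_def using bin_padded[OF nv_le(2)]
    by (auto simp: stage_def conc_def fun_eq_iff start_state_def)
  \<comment> \<open>The parts take \<open>12 * W\<close>, \<open>3 * W + 1\<close>,
    \<open>32 * 21 * (W + 1)\<close> and 6 steps, together at most
    \<open>700 * (W + 1)\<close>.\<close>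
  show ?thesis
    unfolding init_def
    by (rule runs_mono[OF runs_Seq[OF 1 runs_Seq[OF 2 runs_Seq[OF 3 4[unfolded 5]]]]]) simp
qed

end

section \<open>Resource bounds\<close>

text \<open>\<open>problem.main\<close> takes no arguments, as no parameter of the locale occurs in
  the code; the algorithm is thus uniform in the input and the graph.\<close>

definition program :: com where
  "program = init ;; problem.main"

context problem
begin

text \<open>Writing the register values back reproduces the tape, so a final tape
  \<open>stored X\<close> means exact restoration.\<close>

lemma stored_registers:
  assumes "\<And>g. g < 2 * n \<Longrightarrow> X g = horner_sum of_bool 2 (take l (drop (g * l) cat))"
  shows "stored X = cat"
proof (rule nth_equalityI)
  fix k assume k: "k < length (stored X)"
  show "stored X ! k = cat ! k"
  proof (cases "k < 2 * n * l")
    case True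
    then have l: "0 < l" by (cases l) auto
    let ?g = "k div l"
    have g: "?g < 2 * n" using True l by (simp add: less_mult_imp_div_less)
    have "(?g + 1) * l \<le> 2 * n * l" using g by (intro mult_right_mono) auto
    then have le: "l + ?g * l \<le> length cat" using length_cat by (simp add: algebra_simps)
    have "stored X ! k = bit (X ?g) (k mod l)"
      using True k by (simp add: stored_def regs_def)
    also have "\<dots> = take l (drop (?g * l) cat) ! (k mod l)"
      using l le by (simp add: assms[OF g] bit_horner_sum_bit_iff)
    also have "\<dots> = cat ! (?g * l + k mod l)"
      using l le by simp
    also have "?g * l + k mod l = k" by simp
    finally show ?thesis .
  qed (use k in \<open>simp add: stored_def regs_def\<close>)
qed (simp add: stored_def)

text \<open>The constants add up as follows: 2 * 139 + 23 = 301 for one update of a layer, 301 + 8 =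
  309 for all of them, 2 * 309 + 2 * 62 + 2 = 744 for a phase, and 2 * 744 + 2 * 514 + 19 = 2535.
  The factors 2 come from \<open>l + 1 \<le> 2 * max 1 l\<close>, or from passing twice in a phase
  and having two phases.\<close>

lemma main_cost_le: "main_cost \<le> 2535 * (max 1 l * max 1 T * (n + arcs))"
proof -
  let ?L = "max 1 l" and ?T = "max 1 T" and ?v = "n + arcs"
  have one: "1 \<le> ?L" "1 \<le> ?T" "1 \<le> ?v" using n_pos by auto
  have v: "1 \<le> ?T * ?L * ?v" "?L \<le> ?T * ?L * ?v"
    using one mult_le_mono[OF mult_le_mono[OF one(2) order_refl[of ?L]] one(3)] by auto
  have l: "l + 1 \<le> 2 * ?L" by auto
  have "(l + 1) * (139 * arcs + 39 * n) \<le> (2 * ?L) * (139 * ?v)"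
    using l by (intro mult_le_mono) auto
  moreover have "1 \<le> ?L * ?v" using one by (metis mult_le_mono nat_mult_1)
  ultimately have "(l + 1) * (139 * arcs + 39 * n) + 23 \<le> 301 * (?L * ?v)" by (simp add: algebra_simps)
  then have "T * ((l + 1) * (139 * arcs + 39 * n) + 23) \<le> ?T * (301 * (?L * ?v))"
    by (intro mult_le_mono) auto
  then have pass: "pass_cost \<le> 309 * (?T * ?L * ?v)"
    using v(1) unfolding pass_cost_def by (simp add: algebra_simps)
  have "main_cost \<le> 2535 * Z" if "pass_cost \<le> 309 * Z" "1 \<le> Z" "l + 1 \<le> 2 * Z" for Z
  proof -
    have "phase_cost \<le> 2 * (309 * Z) + 62 * (2 * Z) + 2 * Z"
      unfolding phase_cost_def by (intro add_mono mult_le_mono2 that) (use that(2) in simp)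
    then have "main_cost \<le> 2 * (744 * Z) + 514 * (2 * Z) + 19 * Z"
      unfolding main_cost_def by (intro add_mono mult_le_mono2 that) (use that(2) in simp_all)
    then show ?thesis by simp
  qed
  from this[OF pass v(1) order_trans[OF l mult_le_mono2[OF v(2)]]]
  have "main_cost \<le> 2535 * (?T * ?L * ?v)" .
  then show ?thesis by (simp only: mult.commute mult.left_commute)
qed

lemma catalytic_run_program:
  assumes nbrs: "\<And>v. v < n \<Longrightarrow> distinct (in_nbrs orc v) \<and> set (in_nbrs orc v) = {u. (u, v) \<in> parcs G}"
    and W: "W = (\<Sum>x\<leftarrow>[n, l, q, T, s, t]. length (bin x) + 1)"
    and inp: "inp = (input_tape [n, l, q, T, s, t])\<lparr>pos := W\<rparr>"
    and X: "\<And>g. g < 2 * n \<Longrightarrow> X g = horner_sum of_bool 2 (take l (drop (g * l) cat))" "valid X"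
  shows "\<exists>k \<le> 127450 * (W + 1) * (max 1 l * max 1 T * (n + arcs)).
    catalytic_run orc (compile 0 program) S [n, l, q, T, s, t] cat k (walk_count G s (Suc T) t mod q)"
proof -
  let ?xs = "[n, l, q, T, s, t]"
  let ?a = "start_state ?xs cat"
  let ?v = "max 1 l * max 1 T * (n + arcs)"
  have a: "glob ?a" "ct ?a = stored X" "clk ?a = 0"
    using stored_registers[of X] X(1) by (simp_all add: glob_def start_state_def)
  have "wp main (\<lambda>b. nv b 0 = walk_count G s (Suc T) t mod q \<and> ct b = cat \<and> clk b \<le> main_cost) ?a"
    by (rule wp_main[OF nbrs a(1,2) X(2)]) (use a(2,3) in \<open>auto simp: start_state_def\<close>)
  then obtain b where b: "runs orc main (conc ?a) (clk b * tick) (conc b)"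
    "nv b 0 = walk_count G s (Suc T) t mod q" "ct b = cat" "clk b \<le> main_cost"
    unfolding wp_def a(3) by auto
  have "runs orc init (initial S ?xs cat) (700 * (W + 1)) (conc ?a)"
    using W inp by (intro runs_init) auto
  from runs_Seq[OF this b(1)]
  have "runs orc program (initial S ?xs cat) (700 * (W + 1) + clk b * tick) (conc b)"
    by (simp only: program_def)
  then obtain k where k: "k \<le> 700 * (W + 1) + clk b * tick"
    "run orc (compile 0 program) k ((initial S ?xs cat)\<lparr>pc := 0\<rparr>) = Some (conc b\<lparr>pc := len program\<rparr>)"
    unfolding runs_def by (metis append_Nil append_Nil2 list.size(3) add_0)
  \<comment> \<open>127450 = 2535 * 50 + 700, for the main part in machine steps and for the
    initialisation.\<close>
  have "clk b * tick \<le> 2535 * ?v * (50 * (W + 1))"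
    using b(4) main_cost_le unfolding tick_def by (intro mult_le_mono) auto
  moreover have "1 \<le> ?v"
    using n_pos by (simp add: Suc_le_eq less_max_iff_disj)
  then have "700 * (W + 1) * 1 \<le> 700 * (W + 1) * ?v" by (intro mult_le_mono) auto
  ultimately have "k \<le> 127450 * (W + 1) * ?v"
    using k(1) by (simp only: mult_ac mult_1)
  moreover have "nv b 0 < 2 ^ W"
    using b(2) q_pos small by (metis mod_less_divisor less_trans)
  then have "catalytic_run orc (compile 0 program) S ?xs cat k (walk_count G s (Suc T) t mod q)"
    unfolding catalytic_run_def using k(2) b(2,3) number_conc[of 0 b]
    by (intro exI[of _ "conc b\<lparr>pc := len program\<rparr>"]) (simp add: initial_def)
  ultimately show ?thesis by blast
qed

end

section \<open>Logarithmic estimates for space and time\<close>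

lemma two_power_log: "0 < x \<Longrightarrow> x \<le> z \<Longrightarrow> 2 ^ k \<le> 2 * x \<Longrightarrow> real k \<le> log 2 (real z) + 1" for x z k :: nat
proof -
  assume *: "0 < x" "x \<le> z" "2 ^ k \<le> 2 * x"
  have "(2::real) ^ k \<le> 2 * real z"
  proof -
    have "real (2 ^ k) \<le> real (2 * z)" using * by (intro of_nat_mono) linarith
    then show ?thesis by simp
  qed
  then have "log 2 (2 ^ k) \<le> log 2 (2 * real z)" using * by (subst log_le_cancel_iff) auto
  also have "\<dots> = log 2 (real z) + 1" using * by (simp add: log_mult)
  finally show ?thesis by (simp add: log_nat_power)
qed

lemma length_bin_log: "x \<le> z \<Longrightarrow> 0 < z \<Longrightarrow> real (length (bin x)) \<le> log 2 (real z) + 1"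
proof (cases "x = 0")
  case True
  assume "0 < z"
  then have "0 \<le> log 2 (real z)" by simp
  then show ?thesis using True by simp
next
  case False
  assume "x \<le> z"
  then show ?thesis using False power_length_bin_le[of x] by (intro two_power_log[of x]) auto
qed

lemma valid_for_iff:
  assumes "0 < q"
  shows "valid_for q l x \<longleftrightarrow> x < 2 ^ l - 2 ^ l mod q"
proof -
  have "(GREATEST d. q * d \<le> 2 ^ l) = 2 ^ l div q"
    using assms by (intro Greatest_equality) (auto simp: less_eq_div_iff_mult_less_eq mult.commute)
  then show ?thesis
    by (simp add: valid_for_def minus_mod_eq_mult_div)
qed

text \<open>Sums are estimated by products and these by powers of two. The separators of the six
  numbers, also counted in W, provide the factor \<open>2 ^ 6 = 64\<close>, while passing from sums
  to products costs only 4.\<close>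

lemma capacity_bound:
  fixes n l q T s t :: nat
  assumes "W = (\<Sum>x\<leftarrow>[n, l, q, T, s, t]. length (bin x) + 1)"
  shows "2 * n * l + n + 2 * q + l + T + 2 \<le> 2 ^ W"
proof -
  have le: "x + 1 \<le> 2 ^ length (bin x)" for x
    using less_power_length_bin[of x] by simp
  let ?A = "(n + 1) * (l + 1)" and ?B = "(q + 1) * (T + 1)"
  have pos: "1 \<le> ?A" "1 \<le> ?B" by simp_all
  define Y where "Y = (2::nat) ^ length (bin n) * 2 ^ length (bin l) * (2 ^ length (bin q) * 2 ^ length (bin T))"
  define Z where "Z = (2::nat) ^ length (bin s) * 2 ^ length (bin t)"
  have "2 * n * l + n + 2 * q + l + T + 2 \<le> 2 * (?A + ?B)"
    by (simp add: algebra_simps)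
  also have "?A + ?B \<le> 2 * (?A * ?B)"
    using mult_le_mono2[OF pos(2), of ?A] mult_le_mono1[OF pos(1), of ?B] by linarith
  also have "?A * ?B \<le> Y"
    unfolding Y_def by (intro mult_le_mono le)
  also have "Y \<le> Y * Z"
    by (simp add: Z_def)
  finally have "2 * n * l + n + 2 * q + l + T + 2 \<le> 64 * (Y * Z)"
    by linarith
  also have "\<dots> = 2 ^ W"
    by (simp add: assms power_add Y_def Z_def)
  finally show ?thesis .
qed

lemma sum_card_in_nbrs:
  assumes "finite A" "R \<subseteq> A \<times> A"
  shows "(\<Sum>v\<in>A. card {u. (u, v) \<in> R}) = card R"
proof -
  have "finite {u. (u, v) \<in> R}" for v
    using assms by (auto intro: finite_subset[of _ A])
  then have "(\<Sum>v\<in>A. card {u. (u, v) \<in> R}) = card (SIGMA v:A. {u. (u, v) \<in> R})"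
    using assms(1) by (simp add: card_SigmaI)
  also have "(SIGMA v:A. {u. (u, v) \<in> R}) = prod.swap ` R"
    using assms(2) by force
  also have "card (prod.swap ` R) = card R"
    by (rule card_image) (auto intro: inj_onI)
  finally show ?thesis .
qed

text \<open>Strictness leaves a blank cell behind the marks of the ruler, by which its end is
  recognised. As the logarithm g is at least 1,
  \<open>6 * (g + 2) \<le> 18 * g < 20 * g\<close>.\<close>

lemma log_space_bound:
  fixes n l q T s t :: nat
  assumes "s < n" "t < n"
  shows "(\<Sum>x\<leftarrow>[n, l, q, T, s, t]. length (bin x) + 1) < log_space 20 n l q T"
proof -
  let ?z = "n + l + q + T + 2"
  have z: "1 \<le> log 2 (real ?z)"
    by (subst le_log_iff) auto
  have b: "real (length (bin x)) \<le> log 2 (real ?z) + 1" if "x \<le> ?z" for x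
    using that by (intro length_bin_log) auto
  have "real (\<Sum>x\<leftarrow>[n, l, q, T, s, t]. length (bin x) + 1) \<le> 6 * (log 2 (real ?z) + 2)"
    using b[of n] b[of l] b[of q] b[of T] b[of s] b[of t] assms by simp
  also have "6 * (log 2 (real ?z) + 2) < 20 * log 2 (real ?z)"
  proof -
    have "6 * (x + 2) < 20 * x" if "1 \<le> x" for x :: real
      using that by (simp add: distrib_left)
    from this[OF z] show ?thesis .
  qed
  also have "\<dots> \<le> real (log_space 20 n l q T)"
    unfolding log_space_def by linarith
  finally show ?thesis by linarith
qed

text \<open>Since \<open>q \<le> 2 ^ l\<close>, q has at most \<open>l + 1\<close> digits, so W is
  bounded by l plus logarithms that do not involve q. This is the second factor l, and one
  logarithmic factor suffices.\<close>

lemma time_bound: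
  fixes n l q T s t m :: nat
  assumes "s < n" "t < n" "q \<le> 2 ^ l"
  shows "real (127450 * ((\<Sum>x\<leftarrow>[n, l, q, T, s, t]. length (bin x) + 1) + 1) * (max 1 l * max 1 T * (n + m)))
     \<le> soft_time_bound 2500000 1 l T n m"
proof -
  let ?z = "l + T + n + m + 2"
  let ?W = "\<Sum>x\<leftarrow>[n, l, q, T, s, t]. length (bin x) + 1"
  let ?L = "real (max 1 l)" and ?g = "log 2 (real ?z)"
  have z: "1 \<le> ?g"
    by (subst le_log_iff) auto
  have b: "real (length (bin x)) \<le> ?g + 1" if "x \<le> ?z" for x
    using that by (intro length_bin_log) auto
  have "q < 2 ^ (l + 1)" using assms(3) by (rule order_le_less_trans) simp
  then have "length (bin q) \<le> l + 1" by (rule length_bin_le)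
  then have q: "real (length (bin q)) \<le> real l + 1" by simp
  have "real ?W + 1 \<le> real l + 13 + 5 * ?g"
    using b[of n] b[of l] b[of T] b[of s] b[of t] q assms(1,2) by simp
  \<comment> \<open>Each term is at most a multiple of \<open>?L * ?g\<close>, both factors being at
    least 1; the total is 1 + 13 + 5 = 19, and 127450 * 19 = 2421550.\<close>
  also have "\<dots> \<le> ?L * ?g + 13 * (?L * ?g) + 5 * (?L * ?g)"
  proof (intro add_mono)
    have L: "1 \<le> ?L" "real l \<le> ?L" by simp_all
    show "real l \<le> ?L * ?g"
      using mult_mono[OF L(2) z] by simp
    have "1 \<le> ?L * ?g" using mult_mono[OF L(1) z] by simp
    then show "13 \<le> 13 * (?L * ?g)" by simp
    show "5 * ?g \<le> 5 * (?L * ?g)"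
      using mult_right_mono[OF L(1), of ?g] z by simp
  qed
  finally have W: "real ?W + 1 \<le> 19 * (?L * ?g)" by simp
  have "real (127450 * (?W + 1) * (max 1 l * max 1 T * (n + m))) =
      127450 * (real ?W + 1) * (?L * (real (max 1 T) * real (n + m)))"
    by (simp only: of_nat_mult of_nat_add of_nat_1 of_nat_numeral mult_ac)
  also have "\<dots> \<le> 127450 * (19 * (?L * ?g)) * (?L * (real (max 1 T) * real (n + m)))"
    by (intro mult_right_mono mult_left_mono W) auto
  also have "\<dots> = 2421550 * (?L\<^sup>2 * real (max 1 T) * real (n + m) * ?g)"
    by (simp add: power2_eq_square)
  also have "\<dots> \<le> 2500000 * (?L\<^sup>2 * real (max 1 T) * real (n + m) * ?g)"
    using z by (intro mult_right_mono) auto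
  also have "\<dots> = soft_time_bound 2500000 1 l T n m"
    unfolding soft_time_bound_def by (simp only: of_nat_mult of_nat_power of_nat_numeral power_one_right mult_ac)
  finally show ?thesis .
qed

lemma catalytic_run_walk_count:
  assumes "0 < q" "pair_fin_digraph G" and V: "pverts G = {..<n}" and m: "card (parcs G) = m"
    and orc: "oracle_for G orc" and st: "s \<in> pverts G" "t \<in> pverts G" and len: "2 * n * l \<le> length cat"
    and valid: "\<forall>\<sigma>\<in>{0, 1}. \<forall>v\<in>pverts G. valid_for q l (register n l cat \<sigma> v)"
  shows "\<exists>k. catalytic_run orc (compile 0 program) (log_space 20 n l q T) [n, l, q, T, s, t] cat k
      (walk_count G s (Suc T) t mod q) \<and> real k \<le> soft_time_bound 2500000 1 l T n m"
proof -
  interpret G: pair_fin_digraph G by fact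
  have stn: "s < n" "t < n" using st V by auto
  have nbrs: "distinct (in_nbrs orc v) \<and> set (in_nbrs orc v) = {u. (u, v) \<in> parcs G}" if "v < n" for v
    using that orc V by (auto simp: oracle_for_def)
  have sub: "set (in_nbrs orc v) \<subseteq> {..<n}" if "v < n" for v
    using nbrs[OF that] G.in_arcsD1 V by auto
  have deg: "length (in_nbrs orc v) = card {u. (u, v) \<in> parcs G}" if "v < n" for v
    using nbrs[OF that] distinct_card by metis
  have deg_le: "length (in_nbrs orc v) \<le> n" if "v < n" for v
    using card_mono[OF _ sub[OF that]] nbrs[OF that] distinct_card[of "in_nbrs orc v"] by simp
  define W where "W = (\<Sum>x\<leftarrow>[n, l, q, T, s, t]. length (bin x) + 1)"
  have reg: "register n l cat \<sigma> v < 2 ^ l - 2 ^ l mod q" if "\<sigma> \<in> {0, 1}" "v < n" for \<sigma> v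
    using valid[rule_format, of \<sigma> v] that V by (simp only: valid_for_iff[OF assms(1)] lessThan_iff simp_thms)
  \<comment> \<open>For \<open>q > 2 ^ l\<close> no register is valid, yet there is one, since s is
    a vertex.\<close>
  have q_le: "q \<le> 2 ^ l"
  proof (rule ccontr)
    assume "\<not> q \<le> 2 ^ l"
    then show False using reg[of 0 s] stn by simp
  qed
  interpret problem orc "log_space 20 n l q T" W "(input_tape [n, l, q, T, s, t])\<lparr>pos := W\<rparr>" n l q T s t cat
  proof unfold_locales
    show "W < log_space 20 n l q T"
      unfolding W_def using stn by (rule log_space_bound)
    show "2 * n * l + n + 2 * q + l + T + 2 \<le> 2 ^ W"
      by (rule capacity_bound) (rule W_def)
    show "length (in_nbrs orc v) \<le> n \<and> set (in_nbrs orc v) \<subseteq> {..<n}" if "v < n" for v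
      using deg_le[OF that] sub[OF that] ..
  qed (use stn assms(1) len q_le in auto)
  define X :: "nat \<Rightarrow> nat" where "X g = horner_sum of_bool 2 (take l (drop (g * l) cat))" for g
  have "X g < N" if g: "g < 2 * n" for g
    using reg[of 0 g] reg[of 1 "g - n"] g by (cases "g < n") (simp_all add: X_def register_def N_def r_def)
  then have "valid X" by (simp add: valid_def)
  have "arcs = (\<Sum>v<n. card {u. (u, v) \<in> parcs G})"
    unfolding arcs_def by (intro sum.cong refl deg) simp
  also have "\<dots> = m"
    unfolding m[symmetric] using G.in_arcsD1 G.in_arcsD2 V by (intro sum_card_in_nbrs) auto
  finally have arcs: "arcs = m" .
  obtain k where k: "k \<le> 127450 * (W + 1) * (max 1 l * max 1 T * (n + m))"
    "catalytic_run orc (compile 0 program) (log_space 20 n l q T) [n, l, q, T, s, t] cat k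
      (walk_count G s (Suc T) t mod q)"
    using catalytic_run_program[OF nbrs W_def refl, of X] \<open>valid X\<close> arcs X_def by auto
  have "real k \<le> real (127450 * (W + 1) * (max 1 l * max 1 T * (n + m)))"
    using k(1) by (rule of_nat_mono)
  also have "\<dots> \<le> soft_time_bound 2500000 1 l T n m"
    unfolding W_def using stn q_le by (rule time_bound)
  finally show ?thesis using k(2) by blast
qed

theorem theorem3p6:
  "\<exists>\<zeta> :: nat \<Rightarrow> nat pair_pre_digraph \<Rightarrow> nat \<Rightarrow> nat \<Rightarrow> nat.
     (\<forall>T G s t. pair_fin_digraph G \<longrightarrow> s \<in> pverts G \<longrightarrow> t \<in> pverts G \<longrightarrow>
        \<zeta> T G s t \<le> (card (pverts G) + 1) ^ T \<and>
        (\<zeta> T G s t \<noteq> 0 \<longleftrightarrow> (\<exists>p. pre_digraph.apath (with_proj G) s p t \<and> length p \<le> T))) \<and>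
     (\<exists>(M :: instr list) a C e. \<forall>l q T n m G orc s t cat.
        0 < q \<longrightarrow>
        pair_fin_digraph G \<longrightarrow> pverts G = {..<n} \<longrightarrow> card (parcs G) = m \<longrightarrow>
        oracle_for G orc \<longrightarrow> s \<in> pverts G \<longrightarrow> t \<in> pverts G \<longrightarrow>
        2 * n * l \<le> length cat \<longrightarrow>
        (\<forall>\<sigma> \<in> {0, 1}. \<forall>v \<in> pverts G. valid_for q l (register n l cat \<sigma> v)) \<longrightarrow>
        (\<exists>k. catalytic_run orc M (log_space a n l q T) [n, l, q, T, s, t] cat k (\<zeta> T G s t mod q) \<and>
             real k \<le> soft_time_bound C e l T n m))"
proof (rule exI[of _ "\<lambda>T G s t. walk_count G s (Suc T) t"], intro conjI allI impI)
  fix T s t and G :: "nat pair_pre_digraph"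
  assume G: "pair_fin_digraph G" and s: "s \<in> pverts G"
  interpret pair_fin_digraph G by fact
  \<comment> \<open>The index is \<open>Suc T\<close> because index 0 stands for
    \<open>F(-1)\<close>.\<close>
  show "walk_count G s (Suc T) t \<le> (card (pverts G) + 1) ^ T"
    using walk_count_le[of s "Suc T" t] by simp
  show "walk_count G s (Suc T) t \<noteq> 0 \<longleftrightarrow> (\<exists>p. apath s p t \<and> length p \<le> T)"
    using s by (rule walk_count_neq_0_iff)
qed (use catalytic_run_walk_count in blast)

end
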